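(* Let $j$ be an integer, let $\boldsymbol{\mu}$ be an $\boldsymbol{l}$-partition of $\boldsymbol{m}$, and let $\boldsymbol{\gamma}=(\gamma_1,\ldots,\gamma_n)$, where $\gamma_h$ is the multiplicative order of $\zeta_{l_h}^j$. Then for every $\sigma\in S_m$ of cycle type $\rho$, $$\sum_{k\in\mathbb{Z}/l\mathbb{Z}}\zeta_l^{jk}\,\operatorname{Char}\big(M^{\boldsymbol{\mu}}(k;\boldsymbol{l})\big)(\sigma)=\#\{(Y,c): (Y,c)\text{ is a marked }(\rho,\boldsymbol{\gamma})\text{-tabloid on }\boldsymbol{\mu}\}.$$
   Context: A partition $\mu=(\mu_1\ge\mu_2\ge\cdots)$ is identified with its Young diagram $\{(i,j)\in\mathbb{N}^2:1\le j\le\mu_i\}$; $(i,j)$ is the box in row $i$, column $j$. For a positive integer $l$, a partition $\mu$ is an $l$-partition if for every $i$ the number of $k$ with $\mu_k=i$ is divisible by $l$. Fix $n$-tuples $\boldsymbol{m}=(m_1,\ldots,m_n)$, $\boldsymbol{l}=(l_1,\ldots,l_n)$ of positive integers; $m=\sum_h m_h$, $l=\operatorname{lcm}(l_1,\ldots,l_n)$, and $\zeta_k=e^{2\pi i/k}$. An $\boldsymbol{l}$-partition of $\boldsymbol{m}$ is an $n$-tuple $\boldsymbol{\mu}=(\mu^{(1)},\ldots,\mu^{(n)})$ with $\mu^{(h)}$ an $l_h$-partition of $m_h$; its boxes are the triples $(i,j;h)$ with $(i,j)\in\mu^{(h)}$. A numbering on $\boldsymbol{\mu}$ is a bijection $\boldsymbol{T}$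 from the boxes of $\boldsymbol{\mu}$ to $\{1,\ldots,m\}$. The standard numbering $\boldsymbol{t}_{\boldsymbol{\mu}}$ puts $1,\ldots,m$ into the boxes left to right in each row, rows top to bottom, first in $\mu^{(1)}$, then $\mu^{(2)}$, etc. Two numberings are row-equivalent if for every $h$ and $i$ the $i$-th rows of $\mu^{(h)}$ contain the same set of numbers under both; the class $\{\boldsymbol{T}\}$ is a tabloid, $\mathcal{T}(\boldsymbol{\mu})$ is the set of tabloids on $\boldsymbol{\mu}$, and $M^{\boldsymbol{\mu}}$ is the $\mathbb{C}$-vector space with basis $\mathcal{T}(\boldsymbol{\mu})$, with left $S_m$-action $\sigma\{\boldsymbol{T}\}=\{\sigma\circ\boldsymbol{T}\}$. Let $a_{\boldsymbol{\mu},\boldsymbol{l}}\in S_m$ be the product, over all $h$ and all boxes $(l_hq+1,j;h)$ of $\boldsymbol{\mu}$ ($q\ge0$), of the cycles $(\boldsymbol{t}_{\boldsymbol{\mu}}(l_hq+1,j;h),\boldsymbol{t}_{\boldsymbol{\mu}}(l_hq+2,j;h),\ldots,\boldsymbol{t}_{\boldsymbol{\mu}}(l_hq+l_h,j;h))$. For $k\in\mathbb{Z}/l\mathbb{Z}$, let $\widetilde I_{\boldsymbol{\mu}}(k;\boldsymbol{l})$ be the $\mathbb{C}[S_m]$-submodule of $M^{\boldsymbol{\mu}}$ generated by $\{a_{\boldsymbol{\mu},\boldsymbol{l}}^i\{\boldsymbol{t}_{\boldsymbol{\mu}}\}-\zeta_l^{ki}\{\boldsymbol{t}_{\boldsymbol{\mu}}\}: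 i\in\mathbb{Z}/l\mathbb{Z}\}$, and $M^{\boldsymbol{\mu}}(k;\boldsymbol{l})=M^{\boldsymbol{\mu}}/\widetilde I_{\boldsymbol{\mu}}(k;\boldsymbol{l})$ (an $S_m$-module); $\operatorname{Char}$ denotes the character. Let $\rho=(\rho_1\ge\rho_2\ge\cdots)$ be a partition of $m$ and $\boldsymbol{\gamma}=(\gamma_h)$ positive integers with $\gamma_h\mid l_h$. A $(\rho,\boldsymbol{\gamma},\boldsymbol{l})$-tabloid on $\boldsymbol{\mu}$ is a map $Y$ from the boxes of $\boldsymbol{\mu}$ to $\mathbb{N}$ such that: (i) $|Y^{-1}(k)|=\rho_k$ for all $k$; (ii) for each $k$ there exist $h$ and $(i',j')\in\mathbb{N}^2$ with $\gamma_h\mid\rho_k$ and $Y^{-1}(k)=\{(s\,l_h/\gamma_h+i',\,t+j';h):1\le s\le\gamma_h,\ 1\le t\le\rho_k/\gamma_h\}$; (iii) $Y(i,j;h)\le Y(i,k;h)$ whenever $j\le k$. A marked $(\rho,\boldsymbol{\gamma},\boldsymbol{l})$-tabloid is a pair $(Y,c)$ with $Y$ a $(\rho,\boldsymbol{\gamma},\boldsymbol{l})$-tabloid and $c$ a map from $\{i:\rho_i\ne0\}$ to $\coprod_h\mathbb{Z}/\gamma_h\mathbb{Z}$ with $c(i)\in\mathbb{Z}/\gamma_h\mathbb{Z}$ whenever $Y^{-1}(i)\subset\mu^{(h)}$. Since $\gamma_h\mid l_h$, $\boldsymbol{\mu}$ is also a $\boldsymbol{\gamma}$-partition, and a (marked)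 $(\rho,\boldsymbol{\gamma})$-tabloid on $\boldsymbol{\mu}$ means a (marked) $(\rho,\boldsymbol{\gamma},\boldsymbol{\gamma})$-tabloid on $\boldsymbol{\mu}$ (so each $Y^{-1}(k)$ is a rectangle occupying $\gamma_h$ consecutive rows). *)

theory Defs
  imports
    "Jordan_Normal_Form.VS_Connect"
    "HOL-Algebra.AbelCoset"
    "HOL-Combinatorics.Cycles"
    "HOL-Combinatorics.Orbits"
begin

hide_const (open) Multiset.mult Polynomial.smult

section \<open>Roots of unity\<close>

definition zeta :: "nat \<Rightarrow> complex" where
  "zeta k = exp (2 * complex_of_real pi * \<i> / of_nat k)"

definition mult_order :: "complex \<Rightarrow> nat" where
  "mult_order z = (LEAST d. 0 < d \<and> z ^ d = 1)"

section \<open>Partitions\<close>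

text \<open>Sequences are indexed from 1, as are the components of tuples; values at index 0 and
  at tuple indices above \<open>n\<close> are never looked at.\<close>

definition is_partition :: "nat \<Rightarrow> (nat \<Rightarrow> nat) \<Rightarrow> bool" where
  "is_partition N \<mu> \<longleftrightarrow>
     (\<forall>i\<ge>1. \<mu> (Suc i) \<le> \<mu> i) \<and> finite {i. 1 \<le> i \<and> \<mu> i \<noteq> 0} \<and>
     (\<Sum>i | 1 \<le> i \<and> \<mu> i \<noteq> 0. \<mu> i) = N"

definition is_l_partition :: "nat \<Rightarrow> nat \<Rightarrow> (nat \<Rightarrow> nat) \<Rightarrow> bool" where
  "is_l_partition l N \<mu> \<longleftrightarrow>
     is_partition N \<mu> \<and> (\<forall>i\<ge>1. l dvd card {k. 1 \<le> k \<and> \<mu> k = i})"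

definition is_multi_partition ::
  "nat \<Rightarrow> (nat \<Rightarrow> nat) \<Rightarrow> (nat \<Rightarrow> nat) \<Rightarrow> (nat \<Rightarrow> nat \<Rightarrow> nat) \<Rightarrow> bool" where
  "is_multi_partition n l m \<mu> \<longleftrightarrow> (\<forall>h\<in>{1..n}. is_l_partition (l h) (m h) (\<mu> h))"

definition cycle_type :: "nat \<Rightarrow> (nat \<Rightarrow> nat) \<Rightarrow> nat multiset" where
  "cycle_type N \<sigma> = image_mset card (mset_set (orbit \<sigma> ` {1..N}))"

definition has_cycle_type :: "nat \<Rightarrow> (nat \<Rightarrow> nat) \<Rightarrow> (nat \<Rightarrow> nat) \<Rightarrow> bool" where
  "has_cycle_type N \<sigma> \<rho> \<longleftrightarrow>
     is_partition N \<rho> \<and> cycle_type N \<sigma> = image_mset \<rho> (mset_set {i. 1 \<le> i \<and> \<rho> i \<noteq> 0})"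

section \<open>Boxes, numberings and tabloids\<close>

text \<open>The triple \<open>(i, j, h)\<close> is the box in row \<open>i\<close> and column \<open>j\<close> of the diagram of \<open>\<mu> h\<close>.\<close>

type_synonym box = "nat \<times> nat \<times> nat"

definition boxes :: "nat \<Rightarrow> (nat \<Rightarrow> nat \<Rightarrow> nat) \<Rightarrow> box set" where
  "boxes n \<mu> = {(i, j, h). 1 \<le> h \<and> h \<le> n \<and> 1 \<le> i \<and> 1 \<le> j \<and> j \<le> \<mu> h i}"

definition numberings ::
  "nat \<Rightarrow> (nat \<Rightarrow> nat) \<Rightarrow> (nat \<Rightarrow> nat \<Rightarrow> nat) \<Rightarrow> (box \<Rightarrow> nat) set" where
  "numberings n m \<mu> =
     {T \<in> extensional (boxes n \<mu>). bij_betw T (boxes n \<mu>) {1..\<Sum>h=1..n. m h}}"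

definition std_numbering ::
  "nat \<Rightarrow> (nat \<Rightarrow> nat) \<Rightarrow> (nat \<Rightarrow> nat \<Rightarrow> nat) \<Rightarrow> box \<Rightarrow> nat" where
  "std_numbering n m \<mu> =
     restrict (\<lambda>(i, j, h). (\<Sum>h'=1..<h. m h') + (\<Sum>i'=1..<i. \<mu> h i') + j) (boxes n \<mu>)"

definition row_equiv ::
  "nat \<Rightarrow> (nat \<Rightarrow> nat) \<Rightarrow> (nat \<Rightarrow> nat \<Rightarrow> nat) \<Rightarrow> ((box \<Rightarrow> nat) \<times> (box \<Rightarrow> nat)) set" where
  "row_equiv n m \<mu> =
     {(T, T'). T \<in> numberings n m \<mu> \<and> T' \<in> numberings n m \<mu> \<and>
        (\<forall>h\<in>{1..n}. \<forall>i\<ge>1.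
           (\<lambda>j. T (i, j, h)) ` {1..\<mu> h i} = (\<lambda>j. T' (i, j, h)) ` {1..\<mu> h i})}"

definition tabloids ::
  "nat \<Rightarrow> (nat \<Rightarrow> nat) \<Rightarrow> (nat \<Rightarrow> nat \<Rightarrow> nat) \<Rightarrow> (box \<Rightarrow> nat) set set" where
  "tabloids n m \<mu> = numberings n m \<mu> // row_equiv n m \<mu>"

definition tabloid_of ::
  "nat \<Rightarrow> (nat \<Rightarrow> nat) \<Rightarrow> (nat \<Rightarrow> nat \<Rightarrow> nat) \<Rightarrow> (box \<Rightarrow> nat) \<Rightarrow> (box \<Rightarrow> nat) set" where
  "tabloid_of n m \<mu> T = row_equiv n m \<mu> `` {T}"

definition tabloid_act ::
  "nat \<Rightarrow> (nat \<Rightarrow> nat \<Rightarrow> nat) \<Rightarrow> (nat \<Rightarrow> nat) \<Rightarrow> (box \<Rightarrow> nat) set \<Rightarrow> (box \<Rightarrow> nat) set" where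
  "tabloid_act n \<mu> \<sigma> X = compose (boxes n \<mu>) \<sigma> ` X"

text \<open>The cycles are pairwise disjoint, so the order of the factors is immaterial. Restricting to
  \<open>q < m h\<close> loses no box, because \<open>\<mu> h\<close> has at most \<open>m h\<close> rows.\<close>

definition a_perm ::
  "nat \<Rightarrow> (nat \<Rightarrow> nat) \<Rightarrow> (nat \<Rightarrow> nat) \<Rightarrow> (nat \<Rightarrow> nat \<Rightarrow> nat) \<Rightarrow> nat \<Rightarrow> nat" where
  "a_perm n m l \<mu> =
     foldr (\<circ>)
       [cycle_of_list [std_numbering n m \<mu> (l h * q + s, j, h). s \<leftarrow> [1..<Suc (l h)]].
          h \<leftarrow> [1..<Suc n], q \<leftarrow> [0..<m h], j \<leftarrow> [1..<Suc (\<mu> h (l h * q + 1))]]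
       id"

section \<open>Complex vector spaces and traces\<close>

definition free_space :: "'a set \<Rightarrow> (complex, 'a \<Rightarrow> complex) module" where
  "free_space X =
     \<lparr> carrier = {f. finite {x. f x \<noteq> 0} \<and> {x. f x \<noteq> 0} \<subseteq> X},
       mult = undefined, one = undefined,
       zero = (\<lambda>x. 0), add = (\<lambda>f g x. f x + g x), smult = (\<lambda>c f x. c * f x) \<rparr>"

definition basis_vec :: "'a \<Rightarrow> 'a \<Rightarrow> complex" where
  "basis_vec x = (\<lambda>y. if y = x then 1 else 0)"

definition quot_space :: "(complex, 'v) module \<Rightarrow> 'v set \<Rightarrow> (complex, 'v set) module" where
  "quot_space V W =
     \<lparr> carrier = a_rcosets\<^bsub>V\<^esub> W,
       mult = undefined, one = undefined,
       zero = W, add = set_add V, smult = (\<lambda>c A. \<Union>a\<in>A. W +>\<^bsub>V\<^esub> (c \<odot>\<^bsub>V\<^esub> a)) \<rparr>"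

definition quot_map ::
  "(complex, 'v) module \<Rightarrow> 'v set \<Rightarrow> ('v \<Rightarrow> 'v) \<Rightarrow> 'v set \<Rightarrow> 'v set" where
  "quot_map V W f = (\<lambda>A. \<Union>a\<in>A. W +>\<^bsub>V\<^esub> f a)"

definition coords :: "(complex, 'v) module \<Rightarrow> 'v set \<Rightarrow> 'v \<Rightarrow> 'v \<Rightarrow> complex" where
  "coords V B v = (SOME a. v = (\<Oplus>\<^bsub>V\<^esub>b\<in>B. a b \<odot>\<^bsub>V\<^esub> b))"

definition lin_trace :: "(complex, 'v) module \<Rightarrow> ('v \<Rightarrow> 'v) \<Rightarrow> complex" where
  "lin_trace V f =
     (let B = (SOME B. finite B \<and> vectorspace.basis class_ring V B)
      in \<Sum>b\<in>B. coords V B (f b) b)"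

section \<open>The permutation module and its quotients\<close>

definition perm_module ::
  "nat \<Rightarrow> (nat \<Rightarrow> nat) \<Rightarrow> (nat \<Rightarrow> nat \<Rightarrow> nat) \<Rightarrow> (complex, (box \<Rightarrow> nat) set \<Rightarrow> complex) module" where
  "perm_module n m \<mu> = free_space (tabloids n m \<mu>)"

text \<open>Linear extension of \<open>X \<mapsto> \<sigma> X\<close>: the coefficient of \<open>Y\<close> in \<open>\<sigma> (\<Sum>X. f X \<cdot> X)\<close>.\<close>

definition perm_act ::
  "nat \<Rightarrow> (nat \<Rightarrow> nat) \<Rightarrow> (nat \<Rightarrow> nat \<Rightarrow> nat) \<Rightarrow> (nat \<Rightarrow> nat) \<Rightarrow>
   ((box \<Rightarrow> nat) set \<Rightarrow> complex) \<Rightarrow> (box \<Rightarrow> nat) set \<Rightarrow> complex" where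
  "perm_act n m \<mu> \<sigma> f = (\<lambda>Y. \<Sum>X | X \<in> tabloids n m \<mu> \<and> tabloid_act n \<mu> \<sigma> X = Y. f X)"

definition generated_submodule ::
  "nat \<Rightarrow> (nat \<Rightarrow> nat) \<Rightarrow> (nat \<Rightarrow> nat \<Rightarrow> nat) \<Rightarrow>
   ((box \<Rightarrow> nat) set \<Rightarrow> complex) set \<Rightarrow> ((box \<Rightarrow> nat) set \<Rightarrow> complex) set" where
  "generated_submodule n m \<mu> G =
     \<Inter>{N. LinearCombinations.submodule class_ring N (perm_module n m \<mu>) \<and>
          (\<forall>\<sigma>. \<sigma> permutes {1..\<Sum>h=1..n. m h} \<longrightarrow> perm_act n m \<mu> \<sigma> ` N \<subseteq> N) \<and> G \<subseteq> N}"

definition lcm_tuple :: "nat \<Rightarrow> (nat \<Rightarrow> nat) \<Rightarrow> nat" where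
  "lcm_tuple n l = Lcm (l ` {1..n})"

definition I_tilde ::
  "nat \<Rightarrow> (nat \<Rightarrow> nat) \<Rightarrow> (nat \<Rightarrow> nat) \<Rightarrow> (nat \<Rightarrow> nat \<Rightarrow> nat) \<Rightarrow> nat \<Rightarrow>
   ((box \<Rightarrow> nat) set \<Rightarrow> complex) set" where
  "I_tilde n m l \<mu> k =
     (let t = tabloid_of n m \<mu> (std_numbering n m \<mu>); L = lcm_tuple n l
      in generated_submodule n m \<mu>
           {(\<lambda>X. basis_vec (tabloid_act n \<mu> (a_perm n m l \<mu> ^^ i) t) X
                  - zeta L ^ (k * i) * basis_vec t X) | i. i < L})"

definition M_quot ::
  "nat \<Rightarrow> (nat \<Rightarrow> nat) \<Rightarrow> (nat \<Rightarrow> nat) \<Rightarrow> (nat \<Rightarrow> nat \<Rightarrow> nat) \<Rightarrow> nat \<Rightarrow>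
   (complex, ((box \<Rightarrow> nat) set \<Rightarrow> complex) set) module" where
  "M_quot n m l \<mu> k = quot_space (perm_module n m \<mu>) (I_tilde n m l \<mu> k)"

definition Char_M ::
  "nat \<Rightarrow> (nat \<Rightarrow> nat) \<Rightarrow> (nat \<Rightarrow> nat) \<Rightarrow> (nat \<Rightarrow> nat \<Rightarrow> nat) \<Rightarrow> nat \<Rightarrow> (nat \<Rightarrow> nat) \<Rightarrow> complex" where
  "Char_M n m l \<mu> k \<sigma> =
     lin_trace (M_quot n m l \<mu> k)
       (quot_map (perm_module n m \<mu>) (I_tilde n m l \<mu> k) (perm_act n m \<mu> \<sigma>))"

section \<open>Marked tabloids\<close>

definition preim :: "nat \<Rightarrow> (nat \<Rightarrow> nat \<Rightarrow> nat) \<Rightarrow> (box \<Rightarrow> nat) \<Rightarrow> nat \<Rightarrow> box set" where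
  "preim n \<mu> Y k = {b \<in> boxes n \<mu>. Y b = k}"

text \<open>Since \<open>\<rho>\<close> is a partition of the number of boxes, the first condition forces \<open>Y\<close> to take
  positive values only.\<close>

definition gl_tabloids ::
  "nat \<Rightarrow> (nat \<Rightarrow> nat) \<Rightarrow> (nat \<Rightarrow> nat) \<Rightarrow> (nat \<Rightarrow> nat) \<Rightarrow> (nat \<Rightarrow> nat \<Rightarrow> nat) \<Rightarrow> (box \<Rightarrow> nat) set" where
  "gl_tabloids n \<rho> \<gamma> l \<mu> =
     {Y \<in> extensional (boxes n \<mu>).
        (\<forall>k\<ge>1. card (preim n \<mu> Y k) = \<rho> k) \<and>
        (\<forall>k\<ge>1. \<exists>h\<in>{1..n}. \<exists>i' j'. \<gamma> h dvd \<rho> k \<and>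
           preim n \<mu> Y k =
             {(s * (l h div \<gamma> h) + i', t + j', h) | s t.
                1 \<le> s \<and> s \<le> \<gamma> h \<and> 1 \<le> t \<and> t \<le> \<rho> k div \<gamma> h}) \<and>
        (\<forall>i j k h. (i, j, h) \<in> boxes n \<mu> \<and> (i, k, h) \<in> boxes n \<mu> \<and> j \<le> k \<longrightarrow>
           Y (i, j, h) \<le> Y (i, k, h))}"

text \<open>An element of the coproduct of the \<open>\<int>/\<gamma> h\<int>\<close> is a pair of an index \<open>h\<close> and a
  representative in \<open>{0..<\<gamma> h}\<close>.\<close>

definition marked_gl_tabloids ::
  "nat \<Rightarrow> (nat \<Rightarrow> nat) \<Rightarrow> (nat \<Rightarrow> nat) \<Rightarrow> (nat \<Rightarrow> nat) \<Rightarrow> (nat \<Rightarrow> nat \<Rightarrow> nat) \<Rightarrow>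
   ((box \<Rightarrow> nat) \<times> (nat \<Rightarrow> nat \<times> nat)) set" where
  "marked_gl_tabloids n \<rho> \<gamma> l \<mu> =
     {(Y, c). Y \<in> gl_tabloids n \<rho> \<gamma> l \<mu> \<and>
        c \<in> {i. 1 \<le> i \<and> \<rho> i \<noteq> 0} \<rightarrow>\<^sub>E (SIGMA h:{1..n}. {0..<\<gamma> h}) \<and>
        (\<forall>i h. 1 \<le> i \<and> \<rho> i \<noteq> 0 \<and> h \<in> {1..n} \<and>
           preim n \<mu> Y i \<subseteq> {(i', j', h'). h' = h} \<longrightarrow> fst (c i) = h)}"

definition marked_tabloids ::
  "nat \<Rightarrow> (nat \<Rightarrow> nat) \<Rightarrow> (nat \<Rightarrow> nat) \<Rightarrow> (nat \<Rightarrow> nat \<Rightarrow> nat) \<Rightarrow>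
   ((box \<Rightarrow> nat) \<times> (nat \<Rightarrow> nat \<times> nat)) set" where
  "marked_tabloids n \<rho> \<gamma> \<mu> = marked_gl_tabloids n \<rho> \<gamma> \<gamma> \<mu>"

end

theory Submission
  imports Defs
begin

text \<open>
  Shifting the rows of a numbering cyclically inside each block of \<open>l h\<close> consecutive rows of
  \<open>\<mu> h\<close> induces an operator \<open>A\<close> on tabloids that commutes with the symmetric group, satisfies
  \<open>A ^ L = 1\<close> for \<open>L = lcm_tuple n l\<close>, and agrees with \<open>a_perm\<close> on the standard tabloid. By
  transitivity, \<open>I_tilde n m l \<mu> k\<close> is the kernel of the projection
  \<open>P = (\<Sum>i<L. \<omega> powi (- i) * A ^ i) / L\<close> with \<open>\<omega> = zeta L ^ k\<close>, so the character of the quotient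
  at \<open>\<sigma>\<close> is the trace of \<open>\<sigma> P\<close>. Fourier inversion over \<open>k\<close> leaves the number of tabloids fixed
  by \<open>\<sigma> A ^ j\<close>.

  A tabloid is a function from \<open>{1..M}\<close> to the rows with prescribed fibre sizes, and it is fixed
  iff this function intertwines the inverse of \<open>\<sigma>\<close> with the \<open>j\<close>-fold row shift, whose orbits on
  the rows of \<open>\<mu> h\<close> have length \<open>\<gamma> h\<close>. Such a function amounts to sending every cycle of \<open>\<sigma>\<close> to an
  orbit of rows together with a starting row in it. Matching the orbits inside a block of \<open>l h\<close> rows
  with the groups of \<open>\<gamma> h\<close> consecutive rows turns the first datum into a \<open>(\<rho>, \<gamma>)\<close>-tabloid and the
  second into its marking.
\<close>

section \<open>Traces on quotients of free spaces\<close>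

text \<open>The permutation \<open>a_perm\<close> moves numbers and in general does not commute with
  the symmetric group, so it gives no equivariant operator by left multiplication. Moving boxes
  instead composes on the other side; this is what spreads the relation at the standard tabloid to
  all tabloids.

  With \<open>J\<close> the residue of the given exponent modulo \<open>L\<close> and d = gcd (l h)
  J, a block of \<open>l h\<close> rows splits into d orbits of length \<gamma> h = l h / d, and one
  step of the inverse of \<sigma> advances J / d places in its orbit, a number coprime to \<gamma>
  h. A cycle of length \<rho> k therefore winds evenly around its orbit: \<gamma> h divides \<rho>
  k, and each row of the orbit receives \<rho> k / \<gamma> h entries, which is the width of the
  rectangle.

  The rows of an orbit are d apart while those of a rectangle are consecutive. They can be exchanged
  because all rows of a block have the same length and a block contains d orbits as well as d
  groups. The starting row depends on a chosen point of each cycle, so the bijection is not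
  canonical and only its cardinality statement is used.\<close>

lemma carrier_free_space:
  "finite X \<Longrightarrow> v \<in> carrier (free_space X) \<longleftrightarrow> (\<forall>x. x \<notin> X \<longrightarrow> v x = 0)"
  by (auto simp: free_space_def intro: finite_subset)

lemma free_space_simps [simp]:
  "zero (free_space X) = (\<lambda>x. 0)"
  "add (free_space X) = (\<lambda>f g x. f x + g x)"
  "module.smult (free_space X) = (\<lambda>c f x. c * f x)"
  by (simp_all add: free_space_def)

lemma field_class_ring: "field (class_ring :: complex ring)"
  by (rule class_field.field_axioms)

lemma vectorspace_free_space:
  assumes "finite X"
  shows "vectorspace class_ring (free_space X)"
proof (rule vs_criteria)
  show "\<forall>v\<in>carrier (free_space X). \<exists>neg_v\<in>carrier (free_space X).
          v \<oplus>\<^bsub>free_space X\<^esub> neg_v = \<zero>\<^bsub>free_space X\<^esub>"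
  proof
    fix v assume "v \<in> carrier (free_space X)"
    then have "(\<lambda>x. - v x) \<in> carrier (free_space X)"
      "v \<oplus>\<^bsub>free_space X\<^esub> (\<lambda>x. - v x) = \<zero>\<^bsub>free_space X\<^esub>"
      by (auto simp: carrier_free_space assms)
    then show "\<exists>neg_v\<in>carrier (free_space X). v \<oplus>\<^bsub>free_space X\<^esub> neg_v = \<zero>\<^bsub>free_space X\<^esub>"
      by blast
  qed
qed (auto simp: field_class_ring carrier_free_space assms algebra_simps fun_eq_iff)

text \<open>Linearity is encoded as being given by a matrix, together with closure of the carrier.
  For finite \<open>X\<close> this is ordinary linearity, and arguments turn into exchanges of
  finite sums.\<close>

definition linear_on :: "'a set \<Rightarrow> (('a \<Rightarrow> complex) \<Rightarrow> 'a \<Rightarrow> complex) \<Rightarrow> bool" where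
  "linear_on X F \<longleftrightarrow> (\<forall>v\<in>carrier (free_space X). F v \<in> carrier (free_space X) \<and>
      (\<forall>y. F v y = (\<Sum>x\<in>X. v x * F (basis_vec x) y)))"

lemma linear_on_closed:
  "linear_on X F \<Longrightarrow> v \<in> carrier (free_space X) \<Longrightarrow> F v \<in> carrier (free_space X)"
  by (auto simp: linear_on_def)

lemma linear_on_apply:
  "linear_on X F \<Longrightarrow> v \<in> carrier (free_space X) \<Longrightarrow> F v y = (\<Sum>x\<in>X. v x * F (basis_vec x) y)"
  by (auto simp: linear_on_def)

lemma basis_vec_carrier: "x \<in> X \<Longrightarrow> finite X \<Longrightarrow> basis_vec x \<in> carrier (free_space X)"
  by (auto simp: carrier_free_space basis_vec_def)

lemma sum_basis_vec: "finite X \<Longrightarrow> v \<in> carrier (free_space X) \<Longrightarrow> (\<Sum>x\<in>X. v x * basis_vec x y) = v y"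
  by (auto simp: basis_vec_def carrier_free_space sum.delta' if_distrib cong: if_cong)

lemma free_space_sum_closed:
  assumes "finite X" "\<And>b. b \<in> B \<Longrightarrow> r b \<in> carrier (free_space X)"
  shows "(\<lambda>x. \<Sum>b\<in>B. a b * r b x) \<in> carrier (free_space X)"
  using assms by (auto simp: carrier_free_space)

lemma linear_on_sum:
  assumes "linear_on X F" "finite X" "\<And>b. b \<in> B \<Longrightarrow> r b \<in> carrier (free_space X)"
  shows "F (\<lambda>x. \<Sum>b\<in>B. a b * r b x) y = (\<Sum>b\<in>B. a b * F (r b) y)"
proof -
  have "F (\<lambda>x. \<Sum>b\<in>B. a b * r b x) y = (\<Sum>x\<in>X. (\<Sum>b\<in>B. a b * r b x) * F (basis_vec x) y)"
    using assms by (intro linear_on_apply free_space_sum_closed)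
  also have "\<dots> = (\<Sum>x\<in>X. \<Sum>b\<in>B. a b * (r b x * F (basis_vec x) y))"
    by (simp add: sum_distrib_right mult.assoc)
  also have "\<dots> = (\<Sum>b\<in>B. \<Sum>x\<in>X. a b * (r b x * F (basis_vec x) y))"
    by (rule sum.swap)
  also have "\<dots> = (\<Sum>b\<in>B. a b * F (r b) y)"
    using assms by (intro sum.cong) (auto simp: sum_distrib_left linear_on_apply[of X F "r _"])
  finally show ?thesis .
qed

lemma linear_on_add:
  assumes "linear_on X F" "u \<in> carrier (free_space X)" "v \<in> carrier (free_space X)" "finite X"
  shows "F (\<lambda>x. u x + v x) y = F u y + F v y"
proof -
  have "(\<lambda>x. u x + v x) \<in> carrier (free_space X)"
    using assms by (auto simp: carrier_free_space)
  with assms show ?thesis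
    by (simp add: linear_on_apply[of X F u] linear_on_apply[of X F v] sum.distrib algebra_simps
        linear_on_apply[of X F "\<lambda>x. u x + v x"])
qed

lemma linear_on_scale:
  assumes "linear_on X F" "u \<in> carrier (free_space X)" "finite X"
  shows "F (\<lambda>x. c * u x) y = c * F u y"
proof -
  have "(\<lambda>x. c * u x) \<in> carrier (free_space X)"
    using assms by (auto simp: carrier_free_space)
  with assms show ?thesis
    by (simp add: linear_on_apply[of X F u] sum_distrib_left mult.assoc
        linear_on_apply[of X F "\<lambda>x. c * u x"])
qed

lemma linear_on_diff:
  assumes "linear_on X F" "u \<in> carrier (free_space X)" "v \<in> carrier (free_space X)" "finite X"
  shows "F (\<lambda>x. u x - v x) y = F u y - F v y"
proof -
  have "(\<lambda>x. u x - v x) \<in> carrier (free_space X)"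
    using assms by (auto simp: carrier_free_space)
  with assms show ?thesis
    by (simp add: linear_on_apply[of X F u] linear_on_apply[of X F v] sum_subtractf algebra_simps
        linear_on_apply[of X F "\<lambda>x. u x - v x"])
qed

section \<open>Cosets of a subspace of a free space\<close>

locale free_quotient =
  fixes X :: "'a set" and W :: "('a \<Rightarrow> complex) set"
  assumes finX: "finite X"
    and sub: "LinearCombinations.submodule class_ring W (free_space X)"
begin

abbreviation V where "V \<equiv> free_space X"
abbreviation cs where "cs v \<equiv> W +>\<^bsub>V\<^esub> v"
abbreviation Q where "Q \<equiv> quot_space V W"

lemma W_sub: "W \<subseteq> carrier V"
  using sub by (rule submodule.subset)

lemma W_carrier: "w \<in> W \<Longrightarrow> w \<in> carrier V" using W_sub by auto

lemma W_zero: "(\<lambda>x. 0) \<in> W"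
  using submodule.zero_closed[OF sub] by simp

lemma W_add: "u \<in> W \<Longrightarrow> v \<in> W \<Longrightarrow> (\<lambda>x. u x + v x) \<in> W"
  using submodule.m_closed[OF sub, of u v] by simp

lemma W_smult: "u \<in> W \<Longrightarrow> (\<lambda>x. c * u x) \<in> W"
  using submodule.smult_closed[OF sub, of c u] by simp

lemma W_uminus: "u \<in> W \<Longrightarrow> (\<lambda>x. - u x) \<in> W"
  using W_smult[of u "-1"] by simp

lemma W_diff: "u \<in> W \<Longrightarrow> v \<in> W \<Longrightarrow> (\<lambda>x. u x - v x) \<in> W"
  using W_add[OF _ W_uminus, of u v] by simp

lemma W_sum:
  assumes "\<And>b. b \<in> B \<Longrightarrow> r b \<in> W"
  shows "(\<lambda>x. \<Sum>b\<in>B. a b * r b x) \<in> W"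
  using assms
proof (induction B rule: infinite_finite_induct)
  case (insert b B)
  then show ?case using W_add[OF W_smult[of "r b" "a b"], of "\<lambda>x. \<Sum>b\<in>B. a b * r b x"]
    by simp
qed (auto simp: W_zero)

lemma cs_def': "cs v = {(\<lambda>x. w x + v x) | w. w \<in> W}"
  by (auto simp: a_r_coset_def r_coset_def)

lemma cs_mem: "u \<in> cs v \<longleftrightarrow> (\<lambda>x. u x - v x) \<in> W"
proof
  assume "u \<in> cs v"
  then obtain w where "w \<in> W" "u = (\<lambda>x. w x + v x)" unfolding cs_def' by auto
  then show "(\<lambda>x. u x - v x) \<in> W" by simp
next
  assume "(\<lambda>x. u x - v x) \<in> W"
  then have "(\<lambda>x. (u x - v x) + v x) \<in> cs v"
    unfolding cs_def' by (intro CollectI exI[of _ "\<lambda>x. u x - v x"]) simp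
  then show "u \<in> cs v" by simp
qed

lemma cs_eq_iff: "cs u = cs v \<longleftrightarrow> (\<lambda>x. u x - v x) \<in> W"
proof
  assume "cs u = cs v"
  moreover have "u \<in> cs u" by (simp add: cs_mem W_zero)
  ultimately show "(\<lambda>x. u x - v x) \<in> W" using cs_mem by blast
next
  assume *: "(\<lambda>x. u x - v x) \<in> W"
  show "cs u = cs v"
  proof (intro Set.set_eqI iffI)
    fix z assume "z \<in> cs u"
    then show "z \<in> cs v" using W_add[OF _ *, of "\<lambda>x. z x - u x"] by (simp add: cs_mem)
  next
    fix z assume "z \<in> cs v"
    then show "z \<in> cs u" using W_diff[OF _ *, of "\<lambda>x. z x - v x"] by (simp add: cs_mem)
  qed
qed

lemma cs_self: "v \<in> cs v" by (simp add: cs_mem W_zero)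

lemma cs_zero: "cs (\<lambda>x. 0) = W" by (auto simp: cs_mem)

lemma carrier_Q: "carrier Q = cs ` carrier V"
  by (auto simp: quot_space_def A_RCOSETS_def RCOSETS_def a_r_coset_def)

lemma zero_Q: "\<zero>\<^bsub>Q\<^esub> = W" by (simp add: quot_space_def)

lemma add_Q: "cs u \<oplus>\<^bsub>Q\<^esub> cs v = cs (\<lambda>x. u x + v x)"
proof (intro Set.set_eqI iffI)
  fix z assume "z \<in> cs u \<oplus>\<^bsub>Q\<^esub> cs v"
  then obtain a b where "a \<in> cs u" "b \<in> cs v" "z = (\<lambda>x. a x + b x)"
    by (auto simp: quot_space_def set_add_def set_mult_def)
  then show "z \<in> cs (\<lambda>x. u x + v x)"
    using W_add[of "\<lambda>x. a x - u x" "\<lambda>x. b x - v x"] by (simp add: cs_mem algebra_simps)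
next
  fix z assume z: "z \<in> cs (\<lambda>x. u x + v x)"
  have "(\<lambda>x. z x - v x) \<in> cs u" "v \<in> cs v" "z = (\<lambda>x. (z x - v x) + v x)"
    using z by (auto simp: cs_mem W_zero algebra_simps)
  then show "z \<in> cs u \<oplus>\<^bsub>Q\<^esub> cs v"
    by (simp add: quot_space_def set_add_def set_mult_def) (rule bexI[of _ "\<lambda>x. z x - v x"], rule bexI[of _ v], auto)
qed

text \<open>Scaling is defined as a union over all representatives. The cosets in this union
  coincide, since two representatives differ by an element of \<open>W\<close> and \<open>W\<close>
  is closed under scaling.\<close>

lemma smult_Q: "c \<odot>\<^bsub>Q\<^esub> cs u = cs (\<lambda>x. c * u x)"
proof -
  have "cs (\<lambda>x. c * a x) = cs (\<lambda>x. c * u x)" if "a \<in> cs u" for a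
    using that W_smult[of "\<lambda>x. a x - u x" c] by (simp add: cs_eq_iff cs_mem algebra_simps)
  moreover have "c \<odot>\<^bsub>Q\<^esub> cs u = (\<Union>a\<in>cs u. cs (\<lambda>x. c * a x))"
    by (simp add: quot_space_def)
  ultimately show ?thesis using cs_self[of u] by blast
qed

lemma vectorspace_Q: "vectorspace class_ring Q"
proof -
  have closed: "(\<lambda>x. u x + v x) \<in> carrier V" "(\<lambda>x. c * u x) \<in> carrier V" "(\<lambda>x. - u x) \<in> carrier V"
    "(\<lambda>x. 0) \<in> carrier V"
    if "u \<in> carrier V" "v \<in> carrier V" for u v c
    using that by (auto simp: carrier_free_space finX)
  have zero_Q': "\<zero>\<^bsub>Q\<^esub> = cs (\<lambda>x. 0)" by (simp add: zero_Q cs_zero)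
  have "\<exists>neg_v\<in>cs ` carrier V. cs u \<oplus>\<^bsub>Q\<^esub> neg_v = cs (\<lambda>x. 0)" if "u \<in> carrier V" for u
    using closed(3)[OF that that] by (intro bexI[of _ "cs (\<lambda>x. - u x)"]) (auto simp: add_Q)
  moreover have "(\<lambda>x. 0) \<in> carrier V" by (simp add: carrier_free_space finX)
  ultimately show ?thesis
    by (intro vs_criteria)
       (auto simp: field_class_ring carrier_Q zero_Q' add_Q smult_Q closed algebra_simps)
qed

sublocale Q: vectorspace class_ring Q by (rule vectorspace_Q)

text \<open>Replaces the abstract finite sum of the quotient by a sum of representatives, so that
  coefficients are handled by pointwise arithmetic.\<close>

lemma lincomb_Q:
  assumes "finite B" "\<And>b. b \<in> B \<Longrightarrow> r b \<in> carrier V \<and> cs (r b) = b"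
  shows "(\<Oplus>\<^bsub>Q\<^esub>b\<in>B. a b \<odot>\<^bsub>Q\<^esub> b) = cs (\<lambda>x. \<Sum>b\<in>B. a b * r b x)"
  using assms
proof (induction B rule: finite_induct)
  case empty
  then show ?case by (simp add: zero_Q cs_zero)
next
  case (insert b B)
  have "b' \<in> carrier Q" if "b' \<in> insert b B" for b'
    using insert.prems[OF that] unfolding carrier_Q by (metis imageI)
  then have B: "B \<subseteq> carrier Q" "b \<in> carrier Q" by blast+
  have "(\<Oplus>\<^bsub>Q\<^esub>b\<in>insert b B. a b \<odot>\<^bsub>Q\<^esub> b) = a b \<odot>\<^bsub>Q\<^esub> b \<oplus>\<^bsub>Q\<^esub> (\<Oplus>\<^bsub>Q\<^esub>b\<in>B. a b \<odot>\<^bsub>Q\<^esub> b)"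
    using insert.hyps B by (intro Q.finsum_insert) auto
  also have "\<dots> = a b \<odot>\<^bsub>Q\<^esub> cs (r b) \<oplus>\<^bsub>Q\<^esub> cs (\<lambda>x. \<Sum>b\<in>B. a b * r b x)"
    using insert by simp
  also have "\<dots> = cs (\<lambda>x. \<Sum>b\<in>insert b B. a b * r b x)"
    using insert.hyps by (simp add: smult_Q add_Q)
  finally show ?case .
qed

text \<open>Supplies a witness for the finite basis that \<open>lin_trace\<close> picks by
  \<open>SOME\<close>. The cosets of the basis vectors span.\<close>

lemma fin_dim_Q: "Q.fin_dim"
proof -
  let ?A = "cs ` basis_vec ` X"
  have A: "finite ?A" "?A \<subseteq> carrier Q"
    using finX by (auto simp: carrier_Q basis_vec_carrier)
  have sp: "subspace class_ring (Q.span ?A) Q" using A by (rule_tac Q.span_is_subspace)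
  then have sm: "LinearCombinations.submodule class_ring (Q.span ?A) Q"
    by (simp add: subspace_def)
  have *: "finite Y \<Longrightarrow> Y \<subseteq> X \<Longrightarrow> cs (\<lambda>y. \<Sum>x\<in>Y. v x * basis_vec x y) \<in> Q.span ?A" for Y v
  proof (induction Y rule: finite_induct)
    case empty
    then show ?case using submodule.zero_closed[OF sm] by (simp add: zero_Q cs_zero)
  next
    case (insert x Y)
    have "cs (basis_vec x) \<in> Q.span ?A"
      using Q.in_own_span[OF A(2)] insert.prems by auto
    then have "v x \<odot>\<^bsub>Q\<^esub> cs (basis_vec x) \<in> Q.span ?A"
      by (intro submodule.smult_closed[OF sm]) auto
    then have "v x \<odot>\<^bsub>Q\<^esub> cs (basis_vec x) \<oplus>\<^bsub>Q\<^esub> cs (\<lambda>y. \<Sum>x\<in>Y. v x * basis_vec x y) \<in> Q.span ?A"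
      using insert by (intro submodule.m_closed[OF sm]) auto
    then show ?case using insert by (simp add: smult_Q add_Q)
  qed
  have "cs v \<in> Q.span ?A" if "v \<in> carrier V" for v
    using *[OF finX subset_refl, of v] sum_basis_vec[OF finX that] by simp
  then have "Q.span ?A = carrier Q"
    using submodule.subset[OF sm] by (auto simp: carrier_Q)
  then show ?thesis using A unfolding Q.fin_dim_def by blast
qed

lemma quot_map_cs:
  assumes "linear_on X F" "\<And>w. w \<in> W \<Longrightarrow> F w \<in> W" "v \<in> carrier V"
  shows "quot_map V W F (cs v) = cs (F v)"
proof -
  have "cs (F a) = cs (F v)" if a: "a \<in> cs v" for a
  proof -
    have w: "(\<lambda>x. a x - v x) \<in> W" using a by (simp add: cs_mem)
    have "(\<lambda>x. (a x - v x) + v x) \<in> carrier V"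
      using W_carrier[OF w] assms(3) finX by (simp add: carrier_free_space)
    then have "F (\<lambda>x. a x - v x) = (\<lambda>y. F a y - F v y)"
      using linear_on_diff[OF assms(1) _ assms(3) finX, of a] by (simp add: fun_eq_iff)
    then show ?thesis using assms(2)[OF w] by (simp add: cs_eq_iff)
  qed
  with cs_self show ?thesis unfolding quot_map_def by blast
qed

end

text \<open>Expanding \<open>P v\<close> in the images \<open>P (r b)\<close> of representatives of an arbitrary basis of the quotient
  computes the trace without any independence-of-basis argument.\<close>

lemma lin_trace_quotient_by_kernel:
  assumes finX: "finite X" and F: "linear_on X F" and P: "linear_on X P"
    and W: "W = {v \<in> carrier (free_space X). P v = (\<lambda>x. 0)}"
    and idem: "\<And>v. v \<in> carrier (free_space X) \<Longrightarrow> P (P v) = P v"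
    and comm: "\<And>v. v \<in> carrier (free_space X) \<Longrightarrow> P (F v) = F (P v)"
    and sub: "LinearCombinations.submodule class_ring W (free_space X)"
  shows "lin_trace (quot_space (free_space X) W) (quot_map (free_space X) W F)
    = (\<Sum>x\<in>X. F (P (basis_vec x)) x)"
proof -
  interpret free_quotient X W using finX sub by (rule free_quotient.intro)
  define B where "B = (SOME B. finite B \<and> Q.basis B)"
  have "\<exists>B. finite B \<and> Q.basis B"
    using Q.finite_basis_exists[OF fin_dim_Q] by blast
  then have B: "finite B" "Q.basis B"
    using someI_ex[of "\<lambda>B. finite B \<and> Q.basis B"] by (auto simp: B_def)
  then have BQ: "B \<subseteq> carrier Q" "Q.lin_indpt B" "Q.span B = carrier Q"
    by (auto simp: Q.basis_def)
  then have "\<forall>b\<in>B. \<exists>v. v \<in> carrier V \<and> cs v = b" by (auto simp: carrier_Q)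
  then obtain r where r: "\<And>b. b \<in> B \<Longrightarrow> r b \<in> carrier V \<and> cs (r b) = b"
    by (auto simp: bchoice_iff)
  note lc = lincomb_Q[OF B(1) r]
  define c where "c v = coords Q B (cs v)" for v
  have c: "cs v = cs (\<lambda>x. \<Sum>b\<in>B. c v b * r b x)" if "v \<in> carrier V" for v
  proof -
    have "cs v \<in> Q.span B" using BQ that by (auto simp: carrier_Q)
    then obtain a where "Q.lincomb a B = cs v"
      using Q.finite_in_span[OF B(1) BQ(1)] by blast
    then have "\<exists>a. cs v = (\<Oplus>\<^bsub>Q\<^esub>b\<in>B. a b \<odot>\<^bsub>Q\<^esub> b)"
      unfolding Q.lincomb_def by (intro exI) (rule sym)
    then have "cs v = (\<Oplus>\<^bsub>Q\<^esub>b\<in>B. c v b \<odot>\<^bsub>Q\<^esub> b)"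
      unfolding c_def coords_def by (rule someI_ex)
    then show ?thesis by (simp add: lc)
  qed
  \<comment> \<open>\<open>coords\<close> is only some choice of coefficients. Independence of
    \<open>B\<close> makes it the unique one, and uniqueness is the source of the linearity of
    \<open>c\<close>.\<close>
  have uniq: "a b = a' b"
    if eq: "cs (\<lambda>x. \<Sum>b\<in>B. a b * r b x) = cs (\<lambda>x. \<Sum>b\<in>B. a' b * r b x)" and b: "b \<in> B" for a a' b
  proof (rule ccontr)
    assume ne: "a b \<noteq> a' b"
    have "(\<lambda>x. \<Sum>b\<in>B. (a b - a' b) * r b x) \<in> W"
      using eq by (simp add: cs_eq_iff sum_subtractf algebra_simps)
    then have "cs (\<lambda>x. \<Sum>b\<in>B. (a b - a' b) * r b x) = cs (\<lambda>x. 0)"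
      by (simp add: cs_eq_iff)
    then have "Q.lincomb (\<lambda>b. a b - a' b) B = \<zero>\<^bsub>Q\<^esub>"
      unfolding Q.lincomb_def by (simp add: lc cs_zero zero_Q)
    then have "Q.lin_dep B"
      using B(1) b ne by (intro Q.lin_dep_crit[of B B "\<lambda>b. a b - a' b" b]) auto
    with BQ show False by simp
  qed
  have c_cong: "c u b = c v b" if "(\<lambda>x. u x - v x) \<in> W" for u v b
    using that unfolding c_def cs_eq_iff[symmetric] by simp
  have clin: "c v b = (\<Sum>x\<in>X. v x * c (basis_vec x) b)" if v: "v \<in> carrier V" and b: "b \<in> B" for v b
  proof (rule uniq[OF _ b])
    \<comment> \<open>Expand \<open>v\<close> in the basis vectors and each of these modulo
      \<open>W\<close>; all the errors lie in \<open>W\<close>.\<close>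
    have "(\<lambda>y. \<Sum>x\<in>X. v x * (basis_vec x y - (\<Sum>b\<in>B. c (basis_vec x) b * r b y))) \<in> W"
      using c finX by (intro W_sum) (auto simp flip: cs_eq_iff intro: basis_vec_carrier)
    moreover have "(\<Sum>x\<in>X. v x * (basis_vec x y - (\<Sum>b\<in>B. c (basis_vec x) b * r b y)))
        = v y - (\<Sum>b\<in>B. (\<Sum>x\<in>X. v x * c (basis_vec x) b) * r b y)" for y
    proof -
      have "(\<Sum>x\<in>X. v x * (\<Sum>b\<in>B. c (basis_vec x) b * r b y))
          = (\<Sum>x\<in>X. \<Sum>b\<in>B. v x * c (basis_vec x) b * r b y)"
        by (simp add: sum_distrib_left mult.assoc)
      also have "\<dots> = (\<Sum>b\<in>B. \<Sum>x\<in>X. v x * c (basis_vec x) b * r b y)"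
        by (rule sum.swap)
      finally show ?thesis
        by (simp add: right_diff_distrib sum_subtractf sum_basis_vec[OF finX v] sum_distrib_right)
    qed
    ultimately have "cs v = cs (\<lambda>y. \<Sum>b\<in>B. (\<Sum>x\<in>X. v x * c (basis_vec x) b) * r b y)"
      by (simp add: cs_eq_iff)
    then show "cs (\<lambda>x. \<Sum>b\<in>B. c v b * r b x) = cs (\<lambda>y. \<Sum>b\<in>B. (\<Sum>x\<in>X. v x * c (basis_vec x) b) * r b y)"
      using c[OF v] by simp
  qed
  have PV: "P v \<in> carrier V" and FV: "F v \<in> carrier V" if "v \<in> carrier V" for v
    using that linear_on_closed P F by blast+
  have FW: "F w \<in> W" if "w \<in> W" for w
  proof -
    have "w \<in> carrier V" "P w = (\<lambda>x. 0)" using that W by auto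
    moreover have "F (\<lambda>x. 0) = (\<lambda>x. 0)"
      using linear_on_scale[OF F, of "\<lambda>x. 0" 0] finX by (auto simp: carrier_free_space)
    ultimately show ?thesis using comm[of w] FV by (simp add: W)
  qed
  \<comment> \<open>\<open>P\<close> vanishes on \<open>W\<close>, so \<open>P v\<close> depends
    only on the coset of \<open>v\<close> and inherits its expansion.\<close>
  have Pexp: "P v = (\<lambda>y. \<Sum>b\<in>B. c v b * P (r b) y)" if v: "v \<in> carrier V" for v
  proof -
    have s: "(\<lambda>x. \<Sum>b\<in>B. c v b * r b x) \<in> carrier V"
      using r by (intro free_space_sum_closed finX) auto
    have "(\<lambda>x. v x - (\<Sum>b\<in>B. c v b * r b x)) \<in> W" using c[OF v] by (simp add: cs_eq_iff)
    then have "P v = P (\<lambda>x. \<Sum>b\<in>B. c v b * r b x)"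
      using linear_on_diff[OF P v s finX] by (auto simp: W fun_eq_iff)
    also have "\<dots> = (\<lambda>y. \<Sum>b\<in>B. c v b * P (r b) y)"
      using r by (intro ext linear_on_sum[OF P finX]) auto
    finally show ?thesis .
  qed
  have "(\<Sum>x\<in>X. F (P (basis_vec x)) x)
      = (\<Sum>x\<in>X. \<Sum>b\<in>B. c (basis_vec x) b * F (P (r b)) x)"
  proof (rule sum.cong[OF refl])
    fix x assume x: "x \<in> X"
    have "F (P (basis_vec x)) x = F (\<lambda>y. \<Sum>b\<in>B. c (basis_vec x) b * P (r b) y) x"
      using Pexp[OF basis_vec_carrier[OF x finX]] by simp
    also have "\<dots> = (\<Sum>b\<in>B. c (basis_vec x) b * F (P (r b)) x)"
      using r PV by (intro linear_on_sum[OF F finX]) auto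
    finally show "F (P (basis_vec x)) x = (\<Sum>b\<in>B. c (basis_vec x) b * F (P (r b)) x)" .
  qed
  also have "\<dots> = (\<Sum>b\<in>B. \<Sum>x\<in>X. F (P (r b)) x * c (basis_vec x) b)"
    by (subst sum.swap) (simp add: mult.commute)
  \<comment> \<open>By linearity of the coordinates the inner sum over \<open>X\<close> is the
    \<open>b\<close>-coordinate of \<open>F (P (r b))\<close>.\<close>
  also have "\<dots> = (\<Sum>b\<in>B. c (F (P (r b))) b)"
    using r PV FV by (intro sum.cong) (auto simp: clin)
  \<comment> \<open>\<open>P\<close> commutes with \<open>F\<close>, and by idempotence
    \<open>P u\<close> and \<open>u\<close> differ by an element of the kernel; dropping
    \<open>P\<close> keeps the coset.\<close>
  also have "\<dots> = (\<Sum>b\<in>B. c (F (r b)) b)"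
  proof (intro sum.cong refl c_cong)
    fix b assume "b \<in> B"
    then have rb: "F (r b) \<in> carrier V" using r FV by auto
    then have "P (\<lambda>x. P (F (r b)) x - F (r b) x) = (\<lambda>x. 0)"
      using linear_on_diff[OF P PV[OF rb] rb finX] idem[OF rb] by (simp add: fun_eq_iff)
    moreover have "(\<lambda>x. P (F (r b)) x - F (r b) x) \<in> carrier V"
      using rb PV[OF rb] finX by (simp add: carrier_free_space)
    ultimately have "(\<lambda>x. P (F (r b)) x - F (r b) x) \<in> W"
      by (simp add: W)
    then show "(\<lambda>x. F (P (r b)) x - F (r b) x) \<in> W"
      using comm r \<open>b \<in> B\<close> by simp
  qed
  also have "\<dots> = (\<Sum>b\<in>B. coords Q B (quot_map V W F b) b)"
  proof (rule sum.cong[OF refl])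
    fix b assume "b \<in> B"
    then have "quot_map V W F b = cs (F (r b))"
      using quot_map_cs[OF F FW, of "r b"] r by auto
    then show "c (F (r b)) b = coords Q B (quot_map V W F b) b" by (simp add: c_def)
  qed
  also have "\<dots> = lin_trace Q (quot_map V W F)"
    unfolding lin_trace_def B_def Let_def ..
  finally show ?thesis ..
qed

section \<open>Quotients by twisted cyclic actions\<close>

text \<open>Written as a sum over fibres so that \<open>perm_act\<close> is an instance by
  unfolding.\<close>

definition lin_ext :: "'a set \<Rightarrow> ('a \<Rightarrow> 'a) \<Rightarrow> ('a \<Rightarrow> complex) \<Rightarrow> 'a \<Rightarrow> complex" where
  "lin_ext X p v = (\<lambda>y. \<Sum>x | x \<in> X \<and> p x = y. v x)"

lemma lin_ext_eq: "finite X \<Longrightarrow> lin_ext X p v y = (\<Sum>x\<in>X. v x * basis_vec (p x) y)"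
  unfolding lin_ext_def basis_vec_def
  by (auto simp: if_distrib sum.If_cases Int_def intro!: sum.cong cong: if_cong)

lemma lin_ext_basis_vec: "finite X \<Longrightarrow> x \<in> X \<Longrightarrow> lin_ext X p (basis_vec x) = basis_vec (p x)"
  by (rule ext) (simp add: lin_ext_eq basis_vec_def[of x] if_distribR if_distrib[of "\<lambda>c. c * _"] cong: if_cong)

lemma linear_on_lin_ext:
  assumes "finite X" "p ` X \<subseteq> X"
  shows "linear_on X (lin_ext X p)"
  unfolding linear_on_def
proof (intro ballI conjI allI)
  fix v y assume "v \<in> carrier (free_space X)"
  show "lin_ext X p v \<in> carrier (free_space X)"
    using assms by (auto simp: lin_ext_eq carrier_free_space basis_vec_def intro!: sum.neutral)
  show "lin_ext X p v y = (\<Sum>x\<in>X. v x * lin_ext X p (basis_vec x) y)"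
    using assms(1) by (simp add: lin_ext_basis_vec lin_ext_eq[of X p v])
qed

lemma linear_on_comp:
  assumes "finite X" "linear_on X F" "linear_on X H"
  shows "linear_on X (\<lambda>v. F (H v))"
  unfolding linear_on_def
proof (intro ballI conjI allI)
  fix v y assume v: "v \<in> carrier (free_space X)"
  show "F (H v) \<in> carrier (free_space X)"
    by (rule linear_on_closed[OF assms(2) linear_on_closed[OF assms(3) v]])
  have "H v = (\<lambda>y. \<Sum>x\<in>X. v x * H (basis_vec x) y)"
    using linear_on_apply[OF assms(3) v] by auto
  then show "F (H v) y = (\<Sum>x\<in>X. v x * F (H (basis_vec x)) y)"
    using linear_on_sum[OF assms(2,1), of X "\<lambda>x. H (basis_vec x)" v y]
      linear_on_closed[OF assms(3) basis_vec_carrier[OF _ assms(1)]] by simp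
qed

lemma linear_on_eqI:
  assumes "linear_on X F" "linear_on X H" "\<And>x. x \<in> X \<Longrightarrow> F (basis_vec x) = H (basis_vec x)"
    "v \<in> carrier (free_space X)"
  shows "F v = H v"
  using assms by (auto simp: linear_on_apply[of X F] linear_on_apply[of X H] intro!: ext)

text \<open>When \<alpha> has period \<open>L\<close> and \<omega> is an \<open>L\<close>-th root of
  unity, this is the spectral projection of the operator of \<alpha> to the eigenvalue
  \<omega>.\<close>

definition twisted_mean :: "'a set \<Rightarrow> nat \<Rightarrow> ('a \<Rightarrow> 'a) \<Rightarrow> complex \<Rightarrow> ('a \<Rightarrow> complex) \<Rightarrow> 'a \<Rightarrow> complex" where
  "twisted_mean X L \<alpha> \<omega> v = (\<lambda>y. (\<Sum>i<L. inverse \<omega> ^ i * lin_ext X (\<alpha> ^^ i) v y) / of_nat L)"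

locale cyclic_quotient =
  fixes X :: "'a set" and t :: 'a and L :: nat and \<alpha> :: "'a \<Rightarrow> 'a" and \<omega> :: complex
    and G :: "('a \<Rightarrow> 'a) set"
  assumes finX: "finite X" and t: "t \<in> X" and L: "0 < L" and \<omega>: "\<omega> ^ L = 1"
    and G: "\<And>g x. g \<in> G \<Longrightarrow> x \<in> X \<Longrightarrow> g x \<in> X" and \<alpha>: "\<And>x. x \<in> X \<Longrightarrow> \<alpha> x \<in> X"
    and comm: "\<And>g x. g \<in> G \<Longrightarrow> x \<in> X \<Longrightarrow> g (\<alpha> x) = \<alpha> (g x)"
    and \<alpha>L: "\<And>x. x \<in> X \<Longrightarrow> (\<alpha> ^^ L) x = x"
    and trans: "\<And>x. x \<in> X \<Longrightarrow> \<exists>g\<in>G. g t = x"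
begin

abbreviation "P \<equiv> twisted_mean X L \<alpha> \<omega>"

definition "W = \<Inter>{N. LinearCombinations.submodule class_ring N (free_space X) \<and>
  (\<forall>g\<in>G. lin_ext X g ` N \<subseteq> N) \<and>
  {(\<lambda>x. basis_vec ((\<alpha> ^^ i) t) x - \<omega> ^ i * basis_vec t x) | i. i < L} \<subseteq> N}"

lemma \<omega>_nz: "\<omega> \<noteq> 0" using \<omega> L by (auto simp: power_0_left)

lemma \<alpha>_pow: "x \<in> X \<Longrightarrow> (\<alpha> ^^ i) x \<in> X"
  by (induction i) (auto simp: \<alpha>)

lemma comm_pow: "g \<in> G \<Longrightarrow> x \<in> X \<Longrightarrow> g ((\<alpha> ^^ i) x) = (\<alpha> ^^ i) (g x)"
  by (induction i) (auto simp: comm \<alpha>_pow)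

lemma P_basis_vec:
  "x \<in> X \<Longrightarrow> P (basis_vec x) y = (\<Sum>i<L. inverse \<omega> ^ i * basis_vec ((\<alpha> ^^ i) x) y) / of_nat L"
  by (simp add: twisted_mean_def lin_ext_basis_vec finX)

lemma linear_on_P: "linear_on X P"
  unfolding linear_on_def
proof (intro ballI conjI allI)
  fix v y assume v: "v \<in> carrier (free_space X)"
  have lin: "linear_on X (lin_ext X (\<alpha> ^^ i))" for i
    by (intro linear_on_lin_ext finX) (auto simp: \<alpha>_pow)
  show "P v \<in> carrier (free_space X)"
    using linear_on_closed[OF lin v] finX by (auto simp: twisted_mean_def carrier_free_space)
  have "P v y = (\<Sum>i<L. \<Sum>x\<in>X. v x * (inverse \<omega> ^ i * basis_vec ((\<alpha> ^^ i) x) y / of_nat L))"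
    by (simp add: twisted_mean_def lin_ext_eq[OF finX] sum_distrib_left sum_divide_distrib algebra_simps)
  also have "\<dots> = (\<Sum>x\<in>X. \<Sum>i<L. v x * (inverse \<omega> ^ i * basis_vec ((\<alpha> ^^ i) x) y / of_nat L))"
    by (rule sum.swap)
  also have "\<dots> = (\<Sum>x\<in>X. v x * P (basis_vec x) y)"
    by (intro sum.cong refl) (simp add: P_basis_vec sum_distrib_left sum_divide_distrib)
  finally show "P v y = (\<Sum>x\<in>X. v x * P (basis_vec x) y)" .
qed

text \<open>Replacing i by i + 1 in the mean costs a factor \<omega>. The sum is cyclic: its term at
  \<open>L\<close> equals its term at 0, because both \<omega> and \<alpha> have period
  \<open>L\<close>.\<close>

lemma P_shift: "x \<in> X \<Longrightarrow> P (basis_vec (\<alpha> x)) y = \<omega> * P (basis_vec x) y"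
proof -
  assume x: "x \<in> X"
  define f where "f i = inverse \<omega> ^ i * basis_vec ((\<alpha> ^^ i) x) y" for i
  have "(\<Sum>i<L. f (Suc i)) = (\<Sum>i<L. f i)"
  proof -
    have "(\<Sum>i<L. f (Suc i)) + f 0 = (\<Sum>i<L. f i) + f L"
      using sum.lessThan_Suc[of f L] sum.lessThan_Suc_shift[of f L] by simp
    moreover have "f L = f 0" using \<omega> \<alpha>L[OF x] by (simp add: f_def power_inverse)
    ultimately show ?thesis by simp
  qed
  moreover have "inverse \<omega> ^ i * basis_vec ((\<alpha> ^^ i) (\<alpha> x)) y = \<omega> * f (Suc i)" for i
    using \<omega>_nz by (simp add: f_def funpow_swap1)
  ultimately show ?thesis
    using x \<alpha> by (simp add: P_basis_vec f_def[symmetric] sum_distrib_left[symmetric] del: funpow.simps)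
qed

lemma P_shift_pow: "x \<in> X \<Longrightarrow> P (basis_vec ((\<alpha> ^^ i) x)) y = \<omega> ^ i * P (basis_vec x) y"
  by (induction i) (auto simp: P_shift \<alpha>_pow)

text \<open>Applying \<open>P\<close> to the i-th summand produces \<omega> to the power i, which
  cancels the weight; what remains is the average of \<open>L\<close> equal terms.\<close>

lemma P_idem:
  assumes v: "v \<in> carrier (free_space X)"
  shows "P (P v) = P v"
proof (rule linear_on_eqI[where F = "\<lambda>v. P (P v)" and H = P, OF _ linear_on_P _ v])
  show "linear_on X (\<lambda>v. P (P v))" by (rule linear_on_comp[OF finX linear_on_P linear_on_P])
  fix x assume x: "x \<in> X"
  show "P (P (basis_vec x)) = P (basis_vec x)"
  proof
    fix y
    have "P (basis_vec x) = (\<lambda>y. \<Sum>i<L. (inverse \<omega> ^ i / of_nat L) * basis_vec ((\<alpha> ^^ i) x) y)"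
      using x by (auto simp: P_basis_vec sum_divide_distrib)
    then have "P (P (basis_vec x)) y = (\<Sum>i<L. (inverse \<omega> ^ i / of_nat L) * P (basis_vec ((\<alpha> ^^ i) x)) y)"
      by (simp only:) (intro linear_on_sum[OF linear_on_P finX] basis_vec_carrier[OF \<alpha>_pow[OF x] finX])
    also have "\<dots> = (\<Sum>i<L. P (basis_vec x) y / of_nat L)"
      using \<omega>_nz x by (intro sum.cong refl) (simp add: P_shift_pow field_simps power_inverse)
    also have "\<dots> = P (basis_vec x) y" using L by simp
    finally show "P (P (basis_vec x)) y = P (basis_vec x) y" .
  qed
qed

lemma linear_on_G: "g \<in> G \<Longrightarrow> linear_on X (lin_ext X g)"
  by (intro linear_on_lin_ext finX) (auto simp: G)

lemma lin_ext_P_basis_vec: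
  assumes g: "g \<in> G" and x: "x \<in> X"
  shows "lin_ext X g (P (basis_vec x)) y = (\<Sum>i<L. inverse \<omega> ^ i * basis_vec (g ((\<alpha> ^^ i) x)) y) / of_nat L"
proof -
  have "P (basis_vec x) = (\<lambda>y. \<Sum>i<L. (inverse \<omega> ^ i / of_nat L) * basis_vec ((\<alpha> ^^ i) x) y)"
    using x by (auto simp: P_basis_vec sum_divide_distrib)
  then have "lin_ext X g (P (basis_vec x)) y
      = (\<Sum>i<L. (inverse \<omega> ^ i / of_nat L) * lin_ext X g (basis_vec ((\<alpha> ^^ i) x)) y)"
    by (simp only:) (intro linear_on_sum[OF linear_on_G[OF g] finX] basis_vec_carrier[OF \<alpha>_pow[OF x] finX])
  then show ?thesis
    by (simp add: lin_ext_basis_vec finX \<alpha>_pow x sum_divide_distrib)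
qed

lemma P_comm:
  assumes g: "g \<in> G" and v: "v \<in> carrier (free_space X)"
  shows "P (lin_ext X g v) = lin_ext X g (P v)"
proof (rule linear_on_eqI[where F = "\<lambda>v. P (lin_ext X g v)" and H = "\<lambda>v. lin_ext X g (P v)", OF _ _ _ v])
  show "linear_on X (\<lambda>v. P (lin_ext X g v))" "linear_on X (\<lambda>v. lin_ext X g (P v))"
    by (rule linear_on_comp[OF finX linear_on_P linear_on_G[OF g]], rule linear_on_comp[OF finX linear_on_G[OF g] linear_on_P])
  fix x assume x: "x \<in> X"
  show "P (lin_ext X g (basis_vec x)) = lin_ext X g (P (basis_vec x))"
    using g x G by (intro ext) (simp add: lin_ext_basis_vec finX lin_ext_P_basis_vec P_basis_vec comm_pow)
qed

definition "kerP = {v \<in> carrier (free_space X). P v = (\<lambda>x. 0)}"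

lemma submodule_kerP: "LinearCombinations.submodule class_ring kerP (free_space X)"
proof -
  interpret V: vectorspace class_ring "free_space X" by (rule vectorspace_free_space[OF finX])
  have "(\<lambda>x. 0) \<in> carrier (free_space X)" by (simp add: carrier_free_space finX)
  then have "P (\<lambda>x. 0) = (\<lambda>x. 0)"
    using linear_on_scale[OF linear_on_P, of "\<lambda>x. 0" 0] finX by auto
  then show ?thesis
    using V.module_axioms
    by (intro submodule.intro)
      (auto simp: kerP_def carrier_free_space finX linear_on_add[OF linear_on_P]
        linear_on_scale[OF linear_on_P] intro!: ext)
qed

lemma gen_in_kerP:
  "(\<lambda>x. basis_vec ((\<alpha> ^^ i) t) x - \<omega> ^ i * basis_vec t x) \<in> kerP"
proof -
  have c: "basis_vec ((\<alpha> ^^ i) t) \<in> carrier (free_space X)"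
    "basis_vec t \<in> carrier (free_space X)"
    "(\<lambda>x. \<omega> ^ i * basis_vec t x) \<in> carrier (free_space X)"
    "(\<lambda>x. basis_vec ((\<alpha> ^^ i) t) x - \<omega> ^ i * basis_vec t x) \<in> carrier (free_space X)"
    using t \<alpha>_pow by (auto simp: carrier_free_space basis_vec_def finX)
  then show ?thesis unfolding kerP_def
    using linear_on_diff[OF linear_on_P c(1,3) finX] linear_on_scale[OF linear_on_P c(2) finX]
    by (auto simp: P_shift_pow t)
qed

text \<open>\<open>P\<close> kills the generators and commutes with \<open>G\<close>. Conversely, a
  stable submodule containing the generators contains e - P e for every basis vector e, and an
  element of the kernel is a combination of these differences with its own coefficients.\<close>

lemma W_eq: "W = kerP"
proof
  have "lin_ext X g ` kerP \<subseteq> kerP" if g: "g \<in> G" for g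
  proof (rule image_subsetI)
    fix v assume v: "v \<in> kerP"
    have "lin_ext X g (\<lambda>x. 0) = (\<lambda>x. 0)" by (simp add: lin_ext_def)
    then show "lin_ext X g v \<in> kerP"
      using v P_comm[OF g, of v] linear_on_closed[OF linear_on_G[OF g], of v] by (simp add: kerP_def)
  qed
  then show "W \<subseteq> kerP"
    unfolding W_def using submodule_kerP gen_in_kerP by (intro Inter_lower) auto
  show "kerP \<subseteq> W"
    unfolding W_def
  proof (intro Inter_greatest subsetI)
    fix N v
    assume v: "v \<in> kerP" and "N \<in> {N. LinearCombinations.submodule class_ring N (free_space X) \<and>
      (\<forall>g\<in>G. lin_ext X g ` N \<subseteq> N) \<and>
      {(\<lambda>x. basis_vec ((\<alpha> ^^ i) t) x - \<omega> ^ i * basis_vec t x) | i. i < L} \<subseteq> N}"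
    then have N: "LinearCombinations.submodule class_ring N (free_space X)"
      and NG: "\<And>g v. g \<in> G \<Longrightarrow> v \<in> N \<Longrightarrow> lin_ext X g v \<in> N"
      and gen: "\<And>i. i < L \<Longrightarrow> (\<lambda>x. basis_vec ((\<alpha> ^^ i) t) x - \<omega> ^ i * basis_vec t x) \<in> N"
      by blast+
    interpret N: free_quotient X N using finX N by (rule free_quotient.intro)
    \<comment> \<open>A map \<open>g\<close> taking \<open>t\<close> to \<open>x\<close> carries the
      relation at \<open>t\<close> to the same relation at \<open>x\<close>, because it commutes
      with \<alpha>.\<close>
    have gen': "(\<lambda>y. basis_vec ((\<alpha> ^^ i) x) y - \<omega> ^ i * basis_vec x y) \<in> N" if i: "i < L" and x: "x \<in> X" for i x
    proof -
      obtain g where g: "g \<in> G" "g t = x" using trans x by blast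
      have c: "basis_vec ((\<alpha> ^^ i) t) \<in> carrier (free_space X)"
        "basis_vec t \<in> carrier (free_space X)"
        "(\<lambda>x. \<omega> ^ i * basis_vec t x) \<in> carrier (free_space X)"
        using t \<alpha>_pow by (auto simp: carrier_free_space basis_vec_def finX)
      have "lin_ext X g (\<lambda>x. basis_vec ((\<alpha> ^^ i) t) x - \<omega> ^ i * basis_vec t x)
        = (\<lambda>y. basis_vec ((\<alpha> ^^ i) x) y - \<omega> ^ i * basis_vec x y)"
        using linear_on_diff[OF linear_on_G[OF g(1)] c(1,3) finX] g t
          linear_on_scale[OF linear_on_G[OF g(1)] c(2) finX]
        by (auto simp: lin_ext_basis_vec finX \<alpha>_pow comm_pow)
      with NG[OF g(1) gen[OF i]] show ?thesis by simp
    qed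
    have "(\<lambda>y. basis_vec x y - P (basis_vec x) y) \<in> N" if x: "x \<in> X" for x
    proof -
      \<comment> \<open>The weights are those of the mean, negated: the second halves of the
        relations then add up to \<open>L\<close> copies of e / L, the first halves to minus P
        e.\<close>
      have "(\<lambda>y. \<Sum>i<L. (- (inverse \<omega> ^ i / of_nat L)) * (basis_vec ((\<alpha> ^^ i) x) y - \<omega> ^ i * basis_vec x y)) \<in> N"
        using gen'[OF _ x] by (intro N.W_sum) auto
      moreover have "(\<Sum>i<L. (- (inverse \<omega> ^ i / of_nat L)) * (basis_vec ((\<alpha> ^^ i) x) y - \<omega> ^ i * basis_vec x y))
        = basis_vec x y - P (basis_vec x) y" for y
      proof -
        have "(\<Sum>i<L. (- (inverse \<omega> ^ i / of_nat L)) * (basis_vec ((\<alpha> ^^ i) x) y - \<omega> ^ i * basis_vec x y))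
          = (\<Sum>i<L. basis_vec x y / of_nat L - inverse \<omega> ^ i * basis_vec ((\<alpha> ^^ i) x) y / of_nat L)"
          using \<omega>_nz by (intro sum.cong refl) (simp add: field_simps power_inverse)
        also have "\<dots> = basis_vec x y - P (basis_vec x) y"
          using L by (simp add: sum_subtractf P_basis_vec[OF x] sum_divide_distrib)
        finally show ?thesis .
      qed
      ultimately show ?thesis by simp
    qed
    then have "(\<lambda>y. \<Sum>x\<in>X. v x * (basis_vec x y - P (basis_vec x) y)) \<in> N"
      by (intro N.W_sum) auto
    moreover have "(\<Sum>x\<in>X. v x * (basis_vec x y - P (basis_vec x) y)) = v y" for y
      using v linear_on_apply[OF linear_on_P, of v y]
      by (simp add: kerP_def right_diff_distrib sum_subtractf sum_basis_vec finX)
    ultimately show "v \<in> N" by simp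
  qed
qed

text \<open>The diagonal entry at \<open>x\<close> of the operator of \<open>s\<close> composed with
  \<open>P\<close> collects the weights of those i for which \<open>s\<close> after the i-th power
  of \<alpha> fixes \<open>x\<close>.\<close>

lemma lin_trace_cyclic_quotient:
  assumes s: "s \<in> G"
  shows "lin_trace (quot_space (free_space X) W) (quot_map (free_space X) W (lin_ext X s))
    = (\<Sum>i<L. inverse \<omega> ^ i * of_nat (card {x \<in> X. s ((\<alpha> ^^ i) x) = x})) / of_nat L"
proof -
  have "lin_trace (quot_space (free_space X) W) (quot_map (free_space X) W (lin_ext X s))
    = (\<Sum>x\<in>X. lin_ext X s (P (basis_vec x)) x)"
    by (intro lin_trace_quotient_by_kernel finX linear_on_P linear_on_G s P_idem P_comm)
       (auto simp: W_eq submodule_kerP, auto simp: kerP_def)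
  also have "\<dots> = (\<Sum>x\<in>X. \<Sum>i<L. inverse \<omega> ^ i * basis_vec (s ((\<alpha> ^^ i) x)) x) / of_nat L"
    by (simp add: lin_ext_P_basis_vec s sum_divide_distrib)
  also have "(\<Sum>x\<in>X. \<Sum>i<L. inverse \<omega> ^ i * basis_vec (s ((\<alpha> ^^ i) x)) x)
      = (\<Sum>i<L. inverse \<omega> ^ i * (\<Sum>x\<in>X. basis_vec (s ((\<alpha> ^^ i) x)) x))"
    by (subst sum.swap) (simp add: sum_distrib_left)
  also have "\<dots> = (\<Sum>i<L. inverse \<omega> ^ i * of_nat (card {x \<in> X. s ((\<alpha> ^^ i) x) = x}))"
    using finX by (intro sum.cong refl arg_cong2[of _ _ _ _ "(*)"])
      (auto simp: basis_vec_def sum.If_cases Int_def intro!: arg_cong[of _ _ card])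
  finally show ?thesis .
qed

end

section \<open>Powers of roots of unity\<close>

lemma zeta_power_eq_1_iff:
  assumes "0 < L"
  shows "zeta L powi i = 1 \<longleftrightarrow> int L dvd i"
proof -
  have "zeta L powi i = cis (2 * pi * of_int i / of_nat L)"
    unfolding zeta_def cis_conv_exp by (simp add: exp_power_int algebra_simps)
  also have "\<dots> = 1 \<longleftrightarrow> cos (2 * pi * of_int i / of_nat L) = 1"
    by (auto simp: complex_eq_iff dest: cos_one_sin_zero)
  also have "\<dots> \<longleftrightarrow> (\<exists>n::int. 2 * pi * of_int i / of_nat L = of_int n * 2 * pi)"
    by (rule cos_one_2pi_int)
  also have "\<dots> \<longleftrightarrow> (\<exists>n::int. of_int i = (of_int (int L * n) :: real))"
    using assms by (simp add: field_simps)
  also have "\<dots> \<longleftrightarrow> int L dvd i"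
    unfolding of_int_eq_iff dvd_def by auto
  finally show ?thesis .
qed

text \<open>Orthogonality of the characters of the cyclic group of order \<open>L\<close>, as a
  geometric series whose ratio is the power j - i of \<open>zeta L\<close>.\<close>

lemma sum_zeta_powers:
  assumes L: "0 < L"
  shows "(\<Sum>k<L. zeta L powi (j * int k) * inverse (zeta L ^ k) ^ i)
    = (if int L dvd j - int i then of_nat L else 0)"
proof -
  define z where "z = zeta L powi (j - int i)"
  have nz: "zeta L \<noteq> 0" by (simp add: zeta_def)
  have "zeta L powi (j * int k) * inverse (zeta L ^ k) ^ i = z ^ k" for k
  proof -
    have "inverse (zeta L ^ k) ^ i = zeta L powi (- (int k * int i))"
      unfolding of_nat_mult[symmetric] power_int_minus power_int_of_nat
      by (simp add: power_inverse power_mult)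
    moreover have "z ^ k = zeta L powi ((j - int i) * int k)"
      by (simp add: z_def power_int_mult)
    ultimately show ?thesis
      using nz by (simp add: power_int_add[symmetric] algebra_simps)
  qed
  then have "(\<Sum>k<L. zeta L powi (j * int k) * inverse (zeta L ^ k) ^ i) = (\<Sum>k<L. z ^ k)"
    by simp
  moreover have "z = 1 \<longleftrightarrow> int L dvd j - int i"
    unfolding z_def by (rule zeta_power_eq_1_iff[OF L])
  moreover have "z ^ L = 1"
  proof -
    have "z ^ L = zeta L powi ((j - int i) * int L)" by (simp add: z_def power_int_mult)
    also have "\<dots> = 1" by (simp add: zeta_power_eq_1_iff[OF L])
    finally show ?thesis .
  qed
  ultimately show ?thesis
    using geometric_sum[of z L] by auto
qed

text \<open>Dividing \<open>l\<close> and \<open>j\<close> by their gcd leaves coprime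
  \<open>g\<close> and \<open>j1\<close>; the e-th power is 1 iff \<open>g\<close> divides j1 * e,
  hence iff \<open>g\<close> divides e. The gcd is formed in the integers because \<open>j\<close>
  may be negative.\<close>

lemma mult_order_zeta:
  assumes "0 < l"
  shows "mult_order (zeta l powi j) = l div nat (gcd (int l) j)"
proof -
  define d where "d = nat (gcd (int l) j)"
  have d: "int d = gcd (int l) j" by (simp add: d_def)
  have "gcd (int l) j > 0" using assms by simp
  then have "d > 0" using d by linarith
  have "int d dvd int l" unfolding d by simp
  then obtain g where g: "l = d * g" by auto
  have "int d dvd j" unfolding d by simp
  then obtain j1 where j1: "j = int d * j1" by blast
  have cop: "coprime (int g) j1"
  proof -
    have "int d * gcd (int g) j1 = int d"
      using d gcd_mult_distrib_int[of "int d" "int g" j1] by (simp add: g j1)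
    then show ?thesis using \<open>d > 0\<close> by (simp add: coprime_iff_gcd_eq_1)
  qed
  have "(zeta l powi j) ^ e = 1 \<longleftrightarrow> g dvd e" for e
  proof -
    have "(zeta l powi j) ^ e = zeta l powi (j * int e)" by (simp add: power_int_mult)
    then have "(zeta l powi j) ^ e = 1 \<longleftrightarrow> int l dvd j * int e"
      by (simp add: zeta_power_eq_1_iff[OF assms])
    also have "\<dots> \<longleftrightarrow> int g dvd j1 * int e" using \<open>d > 0\<close> by (simp add: g j1 mult.assoc)
    also have "\<dots> \<longleftrightarrow> int g dvd int e" using cop by (simp add: coprime_dvd_mult_right_iff)
    finally show ?thesis by simp
  qed
  then have "mult_order (zeta l powi j) = (LEAST e. 0 < e \<and> g dvd e)" by (simp add: mult_order_def)
  also have "\<dots> = g"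
    using assms g by (intro Least_equality) (auto dest: dvd_imp_le)
  also have "g = l div d" using \<open>d > 0\<close> g by simp
  finally show ?thesis by (simp add: d_def)
qed

section \<open>Marked tabloids and assignments of cycles to row groups\<close>

lemma dvd_div_gt0: "d dvd a \<Longrightarrow> 0 < a \<Longrightarrow> 0 < a div d" for a d :: nat
  by (auto elim!: dvdE)

text \<open>A pair \<open>(p, h)\<close> stands for the rows \<open>p * \<gamma> h + 1, \<dots>, p * \<gamma> h + \<gamma> h\<close> of \<open>\<mu> h\<close>, all of the same
  length.\<close>

locale block_diagrams =
  fixes n :: nat and \<mu> :: "nat \<Rightarrow> nat \<Rightarrow> nat" and \<gamma> :: "nat \<Rightarrow> nat" and \<rho> :: "nat \<Rightarrow> nat" and K :: "nat set"
  assumes n_pos: "1 \<le> n"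
    and \<gamma>_pos: "\<And>h. h \<in> {1..n} \<Longrightarrow> 0 < \<gamma> h"
    and \<mu>_mono: "\<And>h i i'. h \<in> {1..n} \<Longrightarrow> 1 \<le> i \<Longrightarrow> i \<le> i' \<Longrightarrow> \<mu> h i' \<le> \<mu> h i"
    and \<mu>_block: "\<And>h i. h \<in> {1..n} \<Longrightarrow> 1 \<le> i \<Longrightarrow> \<mu> h i = \<mu> h ((i - 1) div \<gamma> h * \<gamma> h + 1)"
    and K_def: "K = {k. 1 \<le> k \<and> \<rho> k \<noteq> 0}" and fin_K: "finite K"
    and fin_boxes: "finite (boxes n \<mu>)" and sum_\<rho>: "(\<Sum>k\<in>K. \<rho> k) = card (boxes n \<mu>)"
begin

text \<open>A code ((p, h), c) has two readings. For tabloids, (p, h) is a group of consecutive rows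
  and c a mark; for \<open>equivariant_maps\<close>, (p, h) is an orbit of the row shift and c a
  position in it.\<close>

definition "row_codes = {((p, h), c). h \<in> {1..n} \<and> 0 < \<mu> h (p * \<gamma> h + 1) \<and> c < \<gamma> h}"

text \<open>The last condition says that the widths of the rectangles sent to a group add up to the
  common length of its rows.\<close>

definition "block_assignments = {g \<in> K \<rightarrow>\<^sub>E row_codes.
    (\<forall>k\<in>K. \<gamma> (snd (fst (g k))) dvd \<rho> k) \<and>
    (\<forall>p. \<forall>h\<in>{1..n}. (\<Sum>k | k \<in> K \<and> fst (g k) = (p, h). \<rho> k div \<gamma> h) = \<mu> h (p * \<gamma> h + 1))}"

definition "filled g p h k = (\<Sum>k' | k' \<in> K \<and> k' \<le> k \<and> fst (g k') = (p, h). \<rho> k' div \<gamma> h)"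

text \<open>Greedy filling: in each group the rectangles are placed from left to right by increasing
  label, the only order in which rows increase weakly.\<close>

definition "tabloid_of_assignment g =
  (\<lambda>(i, j, h)\<in>boxes n \<mu>. LEAST k. j \<le> filled g ((i - 1) div \<gamma> h) h k)"

definition "marks_of_assignment g = (\<lambda>k\<in>K. (snd (fst (g k)), snd (g k)))"

section \<open>From assignments to marked tabloids\<close>

lemma filled_mono: "k \<le> k' \<Longrightarrow> filled g p h k \<le> filled g p h k'"
  unfolding filled_def using fin_K by (intro sum_mono2) auto

lemma filled_step:
  assumes "1 \<le> k"
  shows "filled g p h k = filled g p h (k - 1) + (if k \<in> K \<and> fst (g k) = (p, h) then \<rho> k div \<gamma> h else 0)"
proof (cases "k \<in> K \<and> fst (g k) = (p, h)")
  case True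
  then have "{k'. k' \<in> K \<and> k' \<le> k \<and> fst (g k') = (p, h)}
    = insert k {k'. k' \<in> K \<and> k' \<le> k - 1 \<and> fst (g k') = (p, h)}" using assms by auto
  moreover have "k \<notin> {k'. k' \<in> K \<and> k' \<le> k - 1 \<and> fst (g k') = (p, h)}" using assms by auto
  ultimately show ?thesis using True fin_K unfolding filled_def by simp
next
  case False
  moreover have "k' \<le> k \<longleftrightarrow> k' \<le> k - 1 \<or> k' = k" for k' using assms by auto
  ultimately have "{k'. k' \<in> K \<and> k' \<le> k \<and> fst (g k') = (p, h)}
    = {k'. k' \<in> K \<and> k' \<le> k - 1 \<and> fst (g k') = (p, h)}"
    by blast
  then show ?thesis using False unfolding filled_def by auto
qed

lemma filled_le_total:
  assumes "g \<in> block_assignments" "h \<in> {1..n}"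
  shows "filled g p h k \<le> \<mu> h (p * \<gamma> h + 1)"
proof -
  have "filled g p h k \<le> (\<Sum>k | k \<in> K \<and> fst (g k) = (p, h). \<rho> k div \<gamma> h)"
    unfolding filled_def using fin_K by (intro sum_mono2) auto
  then show ?thesis using assms by (auto simp: block_assignments_def)
qed

lemma ex_filled:
  assumes "g \<in> block_assignments" "h \<in> {1..n}" "j \<le> \<mu> h (p * \<gamma> h + 1)"
  shows "\<exists>k. j \<le> filled g p h k"
proof
  \<comment> \<open>The sum of \<open>K\<close> serves merely as an upper bound for the elements of
    \<open>K\<close>.\<close>
  have "{k' \<in> K. k' \<le> \<Sum> K \<and> fst (g k') = (p, h)} = {k \<in> K. fst (g k) = (p, h)}"
    using fin_K by (auto intro: member_le_sum)
  then have "filled g p h (\<Sum> K) = \<mu> h (p * \<gamma> h + 1)"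
    unfolding filled_def using assms(1,2) by (simp add: block_assignments_def)
  with assms(3) show "j \<le> filled g p h (\<Sum> K)" by simp
qed

lemma boxes_block:
  "(i, j, h) \<in> boxes n \<mu> \<longleftrightarrow> h \<in> {1..n} \<and> 1 \<le> i \<and> 1 \<le> j \<and> j \<le> \<mu> h ((i - 1) div \<gamma> h * \<gamma> h + 1)"
  using \<mu>_block[of h i] by (auto simp: boxes_def)

text \<open>Galois connection between labels and columns. Both the fibres and the monotonicity of
  rows are derived from it instead of from the \<open>LEAST\<close> in the definition.\<close>

lemma tabloid_of_assignment_le_iff:
  assumes "g \<in> block_assignments" "(i, j, h) \<in> boxes n \<mu>"
  shows "tabloid_of_assignment g (i, j, h) \<le> k \<longleftrightarrow> j \<le> filled g ((i - 1) div \<gamma> h) h k"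
proof -
  let ?P = "\<lambda>k. j \<le> filled g ((i - 1) div \<gamma> h) h k"
  have ex: "\<exists>k. ?P k" using assms by (intro ex_filled) (auto simp: boxes_block)
  have eq: "tabloid_of_assignment g (i, j, h) = (LEAST k. ?P k)"
    using assms by (simp add: tabloid_of_assignment_def)
  have "?P (LEAST k. ?P k)" using ex by (rule LeastI_ex)
  then show ?thesis unfolding eq
    using filled_mono[of "LEAST k. ?P k" k g] Least_le[of ?P k] by (auto intro: order_trans)
qed

lemma row_index_iff:
  assumes "0 < c"
  shows "(1 \<le> i \<and> (i - 1) div c = p) \<longleftrightarrow> (\<exists>s. 1 \<le> s \<and> s \<le> c \<and> i = s + p * (c::nat))"
proof
  assume i: "1 \<le> i \<and> (i - 1) div c = p"
  have "(i - 1) div c * c + (i - 1) mod c = i - 1" by simp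
  moreover have "(i - 1) mod c < c" using assms by simp
  ultimately show "\<exists>s. 1 \<le> s \<and> s \<le> c \<and> i = s + p * c"
    using i by (intro exI[of _ "(i - 1) mod c + 1"]) auto
next
  assume "\<exists>s. 1 \<le> s \<and> s \<le> c \<and> i = s + p * c"
  then obtain s where s: "1 \<le> s" "s \<le> c" "i = s + p * c" by blast
  then have "i - 1 = (s - 1) + p * c" by simp
  moreover have "((s - 1) + p * c) div c = p" using s by (subst div_mult_self1) auto
  ultimately show "1 \<le> i \<and> (i - 1) div c = p" using s by simp
qed

definition "rect h p b w = {(i, j, h'). h' = h \<and> 1 \<le> i \<and> (i - 1) div \<gamma> h = p \<and> b < j \<and> j \<le> b + w}" for h p b w :: nat

text \<open>The quotient of \<gamma> h by itself is left unevaluated to match condition (ii) in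
  \<open>gl_tabloids\<close> when \<open>l\<close> is \<gamma>.\<close>

lemma rect_eq:
  assumes "h \<in> {1..n}"
  shows "rect h p b w =
     {(s * (\<gamma> h div \<gamma> h) + p * \<gamma> h, t + b, h) | s t. 1 \<le> s \<and> s \<le> \<gamma> h \<and> 1 \<le> t \<and> t \<le> w}"
proof (intro Set.set_eqI iffI)
  fix x assume "x \<in> rect h p b w"
  then obtain i j where x: "x = (i, j, h)" "1 \<le> i \<and> (i - 1) div \<gamma> h = p" "b < j" "j \<le> b + w"
    by (auto simp: rect_def)
  then obtain s where "1 \<le> s" "s \<le> \<gamma> h" "i = s + p * \<gamma> h"
    using row_index_iff[OF \<gamma>_pos[OF assms]] by blast
  then show "x \<in> {(s * (\<gamma> h div \<gamma> h) + p * \<gamma> h, t + b, h) | s t. 1 \<le> s \<and> s \<le> \<gamma> h \<and> 1 \<le> t \<and> t \<le> w}"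
    using x \<gamma>_pos[OF assms] by (auto intro!: exI[of _ s] exI[of _ "j - b"])
next
  fix x assume "x \<in> {(s * (\<gamma> h div \<gamma> h) + p * \<gamma> h, t + b, h) | s t. 1 \<le> s \<and> s \<le> \<gamma> h \<and> 1 \<le> t \<and> t \<le> w}"
  then obtain s t where "x = (s + p * \<gamma> h, t + b, h)" "1 \<le> s" "s \<le> \<gamma> h" "1 \<le> t" "t \<le> w"
    using \<gamma>_pos[OF assms] by auto
  moreover from this have "1 \<le> s + p * \<gamma> h \<and> (s + p * \<gamma> h - 1) div \<gamma> h = p"
    using row_index_iff[OF \<gamma>_pos[OF assms], of "s + p * \<gamma> h"] by blast
  ultimately show "x \<in> rect h p b w" by (auto simp: rect_def)
qed

lemma card_rect: "h \<in> {1..n} \<Longrightarrow> card (rect h p b w) = \<gamma> h * w"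
proof -
  assume h: "h \<in> {1..n}"
  have "rect h p b w = (\<lambda>(s, t). (s + p * \<gamma> h, t + b, h)) ` ({1..\<gamma> h} \<times> {1..w})"
    using \<gamma>_pos[OF h] by (auto simp: rect_eq[OF h])
  moreover have "inj_on (\<lambda>(s, t). (s + p * \<gamma> h, t + b, h)) ({1..\<gamma> h} \<times> {1..w})"
    by (auto simp: inj_on_def)
  ultimately show ?thesis by (simp add: card_image card_cartesian_product)
qed

text \<open>A box has label \<open>k\<close> iff its column exceeds \<open>filled\<close> at k - 1
  but not at \<open>k\<close>. By \<open>filled_step\<close> these two values differ only in the
  group \<open>fst (g k)\<close>, and there by the width of the rectangle.\<close>

lemma preim_tabloid_of_assignment:
  assumes g: "g \<in> block_assignments" and k: "k \<in> K" "g k = ((p, h), c)"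
  shows "preim n \<mu> (tabloid_of_assignment g) k = rect h p (filled g p h (k - 1)) (\<rho> k div \<gamma> h)"
proof -
  have k1: "1 \<le> k" using k by (simp add: K_def)
  have h: "h \<in> {1..n}" using g k by (auto simp: block_assignments_def row_codes_def PiE_def Pi_def)
  have iff: "tabloid_of_assignment g b = k \<longleftrightarrow> tabloid_of_assignment g b \<le> k \<and> \<not> tabloid_of_assignment g b \<le> k - 1" for b
    using k1 by auto
  show ?thesis
  proof (intro Set.set_eqI iffI)
    fix x assume "x \<in> preim n \<mu> (tabloid_of_assignment g) k"
    then obtain i j h' where x: "x = (i, j, h')" "(i, j, h') \<in> boxes n \<mu>" "tabloid_of_assignment g (i, j, h') = k"
      by (cases x) (auto simp: preim_def)
    let ?p = "(i - 1) div \<gamma> h'"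
    have j: "j \<le> filled g ?p h' k" "\<not> j \<le> filled g ?p h' (k - 1)"
      using x(3) unfolding iff tabloid_of_assignment_le_iff[OF g x(2)] by auto
    with filled_step[OF k1, of g ?p h'] have "fst (g k) = (?p, h')" by (auto split: if_splits)
    with k j filled_step[OF k1, of g ?p h'] x show "x \<in> rect h p (filled g p h (k - 1)) (\<rho> k div \<gamma> h)"
      by (auto simp: rect_def boxes_def)
  next
    fix x assume "x \<in> rect h p (filled g p h (k - 1)) (\<rho> k div \<gamma> h)"
    then obtain i j where x: "x = (i, j, h)" "1 \<le> i" "(i - 1) div \<gamma> h = p" "filled g p h (k - 1) < j"
      "j \<le> filled g p h (k - 1) + \<rho> k div \<gamma> h" by (auto simp: rect_def)
    have j: "j \<le> filled g p h k" using x k filled_step[OF k1, of g p h] by auto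
    then have b: "(i, j, h) \<in> boxes n \<mu>"
      using x h filled_le_total[OF g h, of p k] by (auto simp: boxes_block)
    have "tabloid_of_assignment g (i, j, h) = k"
      using x j unfolding iff tabloid_of_assignment_le_iff[OF g b] by auto
    with b x show "x \<in> preim n \<mu> (tabloid_of_assignment g) k" by (simp add: preim_def)
  qed
qed

lemma assignment_component:
  assumes "g \<in> block_assignments" "k \<in> K"
  obtains p h c where "g k = ((p, h), c)" "h \<in> {1..n}" "c < \<gamma> h" "\<gamma> h dvd \<rho> k" "0 < \<rho> k div \<gamma> h"
    "0 < \<mu> h (p * \<gamma> h + 1)"
proof -
  have "g k \<in> row_codes" using assms by (auto simp: block_assignments_def)
  then obtain p h c where *: "g k = ((p, h), c)" "h \<in> {1..n}" "c < \<gamma> h" "0 < \<mu> h (p * \<gamma> h + 1)"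
    by (auto simp: row_codes_def)
  moreover have "\<gamma> h dvd \<rho> k" using assms * by (auto simp: block_assignments_def)
  moreover have "0 < \<rho> k" using assms by (simp add: K_def)
  ultimately show ?thesis using that by (metis dvd_div_gt0)
qed

lemma tabloid_of_assignment_in:
  assumes g: "g \<in> block_assignments"
  shows "(tabloid_of_assignment g, marks_of_assignment g) \<in> marked_tabloids n \<rho> \<gamma> \<mu>"
proof -
  let ?Y = "tabloid_of_assignment g"
  have empty: "preim n \<mu> ?Y k = {}" if "1 \<le> k" "k \<notin> K" for k
  proof (rule ccontr)
    assume "preim n \<mu> ?Y k \<noteq> {}"
    then obtain i j h where b: "(i, j, h) \<in> boxes n \<mu>" "?Y (i, j, h) = k" by (auto simp: preim_def)
    then have "?Y (i, j, h) \<le> k" "\<not> ?Y (i, j, h) \<le> k - 1" using that by auto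
    then show False
      unfolding tabloid_of_assignment_le_iff[OF g b(1)] using filled_step[OF that(1), of g "(i - 1) div \<gamma> h" h] that by auto
  qed
  have "card (preim n \<mu> ?Y k) = \<rho> k \<and> (\<exists>h\<in>{1..n}. \<exists>i' j'. \<gamma> h dvd \<rho> k \<and>
           preim n \<mu> ?Y k = {(s * (\<gamma> h div \<gamma> h) + i', t + j', h) | s t.
                1 \<le> s \<and> s \<le> \<gamma> h \<and> 1 \<le> t \<and> t \<le> \<rho> k div \<gamma> h})" if k: "1 \<le> k" for k
  proof (cases "k \<in> K")
    case True
    then obtain p h c where *: "g k = ((p, h), c)" "h \<in> {1..n}" "\<gamma> h dvd \<rho> k"
      using assignment_component[OF g] by metis
    note pre = preim_tabloid_of_assignment[OF g True *(1)]
    have "card (preim n \<mu> ?Y k) = \<rho> k" using * by (simp add: pre card_rect)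
    moreover have "preim n \<mu> ?Y k = {(s * (\<gamma> h div \<gamma> h) + p * \<gamma> h, t + filled g p h (k - 1), h) | s t.
                1 \<le> s \<and> s \<le> \<gamma> h \<and> 1 \<le> t \<and> t \<le> \<rho> k div \<gamma> h}"
      unfolding pre rect_eq[OF *(2)] ..
    ultimately show ?thesis using * by blast
  next
    case False
    then have "\<rho> k = 0" using k by (simp add: K_def)
    \<comment> \<open>A label with \<rho> k = 0 gets an empty rectangle, which may be placed in any
      component; component 1 exists by \<open>n_pos\<close>.\<close>
    with empty[OF k False] n_pos show ?thesis by (auto intro!: bexI[of _ 1])
  qed
  moreover have "?Y (i, j, h) \<le> ?Y (i, k, h)"
    if "(i, j, h) \<in> boxes n \<mu>" "(i, k, h) \<in> boxes n \<mu>" "j \<le> k" for i j k h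
    using that tabloid_of_assignment_le_iff[OF g that(1)] tabloid_of_assignment_le_iff[OF g that(2)]
    by (meson order_refl order_trans)
  moreover have "?Y \<in> extensional (boxes n \<mu>)" by (simp add: tabloid_of_assignment_def)
  ultimately have Y: "?Y \<in> gl_tabloids n \<rho> \<gamma> \<gamma> \<mu>" unfolding gl_tabloids_def by blast
  have marks: "marks_of_assignment g k \<in> (SIGMA h:{1..n}. {0..<\<gamma> h})" if "k \<in> K" for k
    by (rule assignment_component[OF g that]) (simp add: marks_of_assignment_def that)
  have fst_marks: "fst (marks_of_assignment g k) = h"
    if k: "k \<in> K" and sub: "preim n \<mu> ?Y k \<subseteq> {(i', j', h'). h' = h}" for k h
  proof -
    obtain p h' c where *: "g k = ((p, h'), c)" "h' \<in> {1..n}" "0 < \<rho> k div \<gamma> h'"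
      using assignment_component[OF g k] by metis
    have "card (preim n \<mu> ?Y k) > 0"
      unfolding preim_tabloid_of_assignment[OF g k *(1)] using card_rect[OF *(2)] *(3) \<gamma>_pos[OF *(2)] by simp
    then obtain x where "x \<in> preim n \<mu> ?Y k" by (metis card_gt_0_iff ex_in_conv)
    with sub have "h' = h"
      unfolding preim_tabloid_of_assignment[OF g k *(1)] by (auto simp: rect_def)
    then show ?thesis using k * by (simp add: marks_of_assignment_def)
  qed
  have "marks_of_assignment g \<in> {k. 1 \<le> k \<and> \<rho> k \<noteq> 0} \<rightarrow>\<^sub>E (SIGMA h:{1..n}. {0..<\<gamma> h})"
    unfolding K_def[symmetric] using marks by (intro PiE_I) (simp_all add: marks_of_assignment_def)
  moreover have "\<forall>k h. 1 \<le> k \<and> \<rho> k \<noteq> 0 \<and> h \<in> {1..n} \<and>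
      preim n \<mu> ?Y k \<subseteq> {(i', j', h'). h' = h} \<longrightarrow> fst (marks_of_assignment g k) = h"
    using fst_marks unfolding K_def by blast
  ultimately show ?thesis
    unfolding marked_tabloids_def marked_gl_tabloids_def using Y by blast
qed

text \<open>The marks give back the component and the position c; the group is read off from the
  rectangle of the label, which is nonempty.\<close>

lemma inj_on_assignment:
  "inj_on (\<lambda>g. (tabloid_of_assignment g, marks_of_assignment g)) block_assignments"
proof (rule inj_onI)
  fix g g' assume g: "g \<in> block_assignments" and g': "g' \<in> block_assignments"
    and eq: "(tabloid_of_assignment g, marks_of_assignment g) = (tabloid_of_assignment g', marks_of_assignment g')"
  show "g = g'"
  proof
    fix k show "g k = g' k"
    proof (cases "k \<in> K")
      case True
      obtain p h c where 1: "g k = ((p, h), c)" "h \<in> {1..n}" "0 < \<rho> k div \<gamma> h"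
        using assignment_component[OF g True] by metis
      obtain p' h' c' where 2: "g' k = ((p', h'), c')" "h' \<in> {1..n}"
        using assignment_component[OF g' True] by metis
      have "marks_of_assignment g k = marks_of_assignment g' k" using eq by simp
      then have "h = h'" "c = c'" using 1 2 True by (auto simp: marks_of_assignment_def)
      have "card (preim n \<mu> (tabloid_of_assignment g) k) > 0"
        unfolding preim_tabloid_of_assignment[OF g True 1(1)] using card_rect 1 \<gamma>_pos by simp
      then obtain x where x: "x \<in> preim n \<mu> (tabloid_of_assignment g) k" by (metis card_gt_0_iff ex_in_conv)
      moreover from x have "x \<in> preim n \<mu> (tabloid_of_assignment g') k" using eq by simp
      ultimately have "p = p'"
        unfolding preim_tabloid_of_assignment[OF g True 1(1)] preim_tabloid_of_assignment[OF g' True 2(1)]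
        using \<open>h = h'\<close> by (auto simp: rect_def)
      with 1 2 \<open>h = h'\<close> \<open>c = c'\<close> show ?thesis by simp
    next
      case False
      then show ?thesis using g g' by (auto simp: block_assignments_def PiE_def extensional_def)
    qed
  qed
qed

section \<open>From marked tabloids to assignments\<close>

lemma gl_tabloid_rect_raw:
  assumes Y: "Y \<in> gl_tabloids n \<rho> \<gamma> \<gamma> \<mu>" and k: "k \<in> K"
  obtains h i' j' where "h \<in> {1..n}" "\<gamma> h dvd \<rho> k"
    "preim n \<mu> Y k = {(s * (\<gamma> h div \<gamma> h) + i', t + j', h) | s t. 1 \<le> s \<and> s \<le> \<gamma> h \<and> 1 \<le> t \<and> t \<le> \<rho> k div \<gamma> h}"
proof -
  have "1 \<le> k" using k by (simp add: K_def)
  moreover have "\<forall>k\<ge>1. \<exists>h\<in>{1..n}. \<exists>i' j'. \<gamma> h dvd \<rho> k \<and> preim n \<mu> Y k =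
    {(s * (\<gamma> h div \<gamma> h) + i', t + j', h) | s t. 1 \<le> s \<and> s \<le> \<gamma> h \<and> 1 \<le> t \<and> t \<le> \<rho> k div \<gamma> h}"
    using Y unfolding gl_tabloids_def mem_Collect_eq by (elim conjE)
  ultimately show ?thesis using that by meson
qed

text \<open>The fibres over \<open>K\<close> are disjoint and their sizes already add up to the
  number of boxes, which rules out every other value, in particular 0.\<close>

lemma gl_tabloid_value:
  assumes Y: "Y \<in> gl_tabloids n \<rho> \<gamma> \<gamma> \<mu>" and b: "b \<in> boxes n \<mu>"
  shows "Y b \<in> K"
proof -
  have card: "card (preim n \<mu> Y k) = \<rho> k" if "1 \<le> k" for k using Y that by (auto simp: gl_tabloids_def)
  have "card (\<Union>k\<in>K. preim n \<mu> Y k) = (\<Sum>k\<in>K. card (preim n \<mu> Y k))"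
    using fin_K fin_boxes by (intro card_UN_disjoint) (auto simp: preim_def)
  also have "\<dots> = card (boxes n \<mu>)" using card by (simp add: sum_\<rho>[symmetric] K_def)
  finally have "(\<Union>k\<in>K. preim n \<mu> Y k) = boxes n \<mu>"
    using fin_boxes by (intro card_subset_eq) (auto simp: preim_def)
  with b show ?thesis by (auto simp: preim_def)
qed

text \<open>A rectangle starting at a row \<open>i'\<close> not divisible by \<open>\<gamma> h\<close> would lie below a box of row
  \<open>i' div \<gamma> h * \<gamma> h + 1\<close>, whose own rectangle is aligned by induction and hence reaches down to row
  \<open>i' + 1\<close>.\<close>

lemma gl_tabloid_aligned:
  assumes Y: "Y \<in> gl_tabloids n \<rho> \<gamma> \<gamma> \<mu>" and h: "h \<in> {1..n}"
    and "k \<in> K" "\<gamma> h dvd \<rho> k"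
    and "preim n \<mu> Y k = {(s + i', t + j', h) | s t. 1 \<le> s \<and> s \<le> \<gamma> h \<and> 1 \<le> t \<and> t \<le> \<rho> k div \<gamma> h}"
  shows "\<gamma> h dvd i'"
  using assms(3-)
proof (induction i' arbitrary: k j' rule: less_induct)
  case (less i')
  note pre = less.prems(3)
  show ?case
  proof (rule ccontr)
    assume nd: "\<not> \<gamma> h dvd i'"
    define q where "q = i' div \<gamma> h"
    define r where "r = i' mod \<gamma> h"
    have r: "0 < r" "r < \<gamma> h" "i' = q * \<gamma> h + r"
      using nd \<gamma>_pos[OF h] by (auto simp: q_def r_def dvd_eq_mod_eq_0)
    have "0 < \<rho> k div \<gamma> h" using less.prems by (simp add: K_def dvd_div_gt0)
    then have bk: "(i' + 1, j' + 1, h) \<in> preim n \<mu> Y k"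
      unfolding pre using \<gamma>_pos[OF h] by (auto intro!: exI[of _ 1])
    then have "j' + 1 \<le> \<mu> h (i' + 1)" by (auto simp: preim_def boxes_def)
    also have "\<dots> \<le> \<mu> h (q * \<gamma> h + 1)" using r by (intro \<mu>_mono[OF h]) auto
    finally have b2: "(q * \<gamma> h + 1, j' + 1, h) \<in> boxes n \<mu>" using h by (auto simp: boxes_def)
    define k' where "k' = Y (q * \<gamma> h + 1, j' + 1, h)"
    have k': "k' \<in> K" unfolding k'_def by (rule gl_tabloid_value[OF Y b2])
    obtain h' i'' j'' where "h' \<in> {1..n}" "\<gamma> h' dvd \<rho> k'"
      "preim n \<mu> Y k' = {(s * (\<gamma> h' div \<gamma> h') + i'', t + j'', h') | s t. 1 \<le> s \<and> s \<le> \<gamma> h' \<and> 1 \<le> t \<and> t \<le> \<rho> k' div \<gamma> h'}"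
      by (rule gl_tabloid_rect_raw[OF Y k'])
    then have h': "h' \<in> {1..n}" "\<gamma> h' dvd \<rho> k'"
      "preim n \<mu> Y k' = {(s + i'', t + j'', h') | s t. 1 \<le> s \<and> s \<le> \<gamma> h' \<and> 1 \<le> t \<and> t \<le> \<rho> k' div \<gamma> h'}"
      using \<gamma>_pos by auto
    have "(q * \<gamma> h + 1, j' + 1, h) \<in> preim n \<mu> Y k'" using b2 by (simp add: preim_def k'_def)
    then obtain s t where st: "q * \<gamma> h + 1 = s + i''" "1 \<le> s" "s \<le> \<gamma> h" "j' + 1 = t + j''" "1 \<le> t"
      "t \<le> \<rho> k' div \<gamma> h" "h' = h"
      unfolding h'(3) by auto
    have "i'' < i'" using st r by linarith
    then have "\<gamma> h dvd i''"
      using less.IH[of i'' k' j''] k' h' st by simp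
    then obtain a where a: "i'' = \<gamma> h * a" by blast
    have "q = a"
    proof (rule antisym)
      show "q \<le> a"
      proof (rule ccontr)
        assume "\<not> q \<le> a"
        then have "\<gamma> h * Suc a \<le> \<gamma> h * q" by (intro mult_le_mono2) auto
        with st a show False by (simp add: mult.commute)
      qed
      show "a \<le> q"
      proof (rule ccontr)
        assume "\<not> a \<le> q"
        then have "\<gamma> h * Suc q \<le> \<gamma> h * a" by (intro mult_le_mono2) auto
        with st a \<gamma>_pos[OF h] show False by (simp add: mult.commute)
      qed
    qed
    then have "(i' + 1, j' + 1, h) \<in> preim n \<mu> Y k'"
      unfolding h'(3) using r st a by (auto intro!: exI[of _ "r + 1"] exI[of _ t] simp: mult.commute)
    \<comment> \<open>The rectangle of \<open>k\<close> lies strictly below row \<open>i'\<close>.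
      If k' = k, it would also contain a box of row q * \<gamma> h + 1, which is at most
      \<open>i'\<close>.\<close>
    with bk have "k' = k" by (simp add: preim_def)
    with \<open>(q * \<gamma> h + 1, j' + 1, h) \<in> preim n \<mu> Y k'\<close> have "i' < q * \<gamma> h + 1"
      unfolding \<open>k' = k\<close> pre by auto
    with r show False by simp
  qed
qed

lemma gl_tabloid_rect:
  assumes Y: "Y \<in> gl_tabloids n \<rho> \<gamma> \<gamma> \<mu>" and k: "k \<in> K"
  obtains h p b where "h \<in> {1..n}" "\<gamma> h dvd \<rho> k" "preim n \<mu> Y k = rect h p b (\<rho> k div \<gamma> h)"
proof -
  obtain h i' j' where *: "h \<in> {1..n}" "\<gamma> h dvd \<rho> k"
    "preim n \<mu> Y k = {(s * (\<gamma> h div \<gamma> h) + i', t + j', h) | s t. 1 \<le> s \<and> s \<le> \<gamma> h \<and> 1 \<le> t \<and> t \<le> \<rho> k div \<gamma> h}"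
    by (rule gl_tabloid_rect_raw[OF Y k])
  have "\<gamma> h dvd i'"
    using * \<gamma>_pos by (intro gl_tabloid_aligned[OF Y *(1) k *(2), of i' j']) auto
  then obtain p where "i' = p * \<gamma> h" by (metis dvd_def mult.commute)
  with * show ?thesis using that[of h p j'] rect_eq[OF *(1)] by simp
qed

lemma surj_assignment:
  assumes "(Y, c) \<in> marked_tabloids n \<rho> \<gamma> \<mu>"
  shows "\<exists>g\<in>block_assignments. tabloid_of_assignment g = Y \<and> marks_of_assignment g = c"
proof -
  have Y: "Y \<in> gl_tabloids n \<rho> \<gamma> \<gamma> \<mu>" and c: "c \<in> K \<rightarrow>\<^sub>E (SIGMA h:{1..n}. {0..<\<gamma> h})"
    and ch: "\<And>k h. k \<in> K \<Longrightarrow> h \<in> {1..n} \<Longrightarrow> preim n \<mu> Y k \<subseteq> {(i', j', h'). h' = h} \<Longrightarrow> fst (c k) = h"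
    using assms by (auto simp: marked_tabloids_def marked_gl_tabloids_def K_def)
  have "\<forall>k\<in>K. \<exists>x. fst x \<in> {1..n} \<and> \<gamma> (fst x) dvd \<rho> k \<and>
      preim n \<mu> Y k = rect (fst x) (fst (snd x)) (snd (snd x)) (\<rho> k div \<gamma> (fst x))"
    using gl_tabloid_rect[OF Y] by (metis fst_conv snd_conv)
  then obtain X where X: "\<And>k. k \<in> K \<Longrightarrow> fst (X k) \<in> {1..n} \<and> \<gamma> (fst (X k)) dvd \<rho> k \<and>
      preim n \<mu> Y k = rect (fst (X k)) (fst (snd (X k))) (snd (snd (X k))) (\<rho> k div \<gamma> (fst (X k)))"
    by (metis bchoice)
  define H where "H k = fst (X k)" for k
  define p where "p k = fst (snd (X k))" for k
  define b where "b k = snd (snd (X k))" for k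
  have H: "H k \<in> {1..n}" "\<gamma> (H k) dvd \<rho> k" "preim n \<mu> Y k = rect (H k) (p k) (b k) (\<rho> k div \<gamma> (H k))"
    if "k \<in> K" for k using X[OF that] by (auto simp: H_def p_def b_def)
  have w: "0 < \<rho> k div \<gamma> (H k)" if "k \<in> K" for k
    using that H(2)[OF that] by (simp add: K_def dvd_div_gt0)
  define g where "g = (\<lambda>k\<in>K. ((p k, H k), snd (c k)))"
  have cH: "fst (c k) = H k" if "k \<in> K" for k
    using H[OF that] that by (intro ch) (auto simp: rect_def)
  \<comment> \<open>Rows increase weakly, so the labels up to \<open>k\<close> occupy an initial
    segment of the row. Its length is the total width of the rectangles of these labels in the
    group, which is \<open>filled\<close>; hence \<open>Y\<close> is the greedy filling.\<close>
  have seg: "{j. (i, j, h) \<in> boxes n \<mu> \<and> Y (i, j, h) \<le> k} = {1..filled g ((i - 1) div \<gamma> h) h k}"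
    if h: "h \<in> {1..n}" and i: "1 \<le> i" for i h k
  proof -
    let ?p = "(i - 1) div \<gamma> h"
    let ?J = "{j. (i, j, h) \<in> boxes n \<mu> \<and> Y (i, j, h) \<le> k}"
    let ?I = "{k' \<in> K. k' \<le> k \<and> fst (g k') = (?p, h)}"
    have "?J = (\<Union>k'\<in>?I. {b k'<..b k' + \<rho> k' div \<gamma> h})"
    proof (intro Set.set_eqI iffI)
      fix j assume j: "j \<in> ?J"
      then have k': "Y (i, j, h) \<in> K" using gl_tabloid_value[OF Y] by simp
      have "(i, j, h) \<in> preim n \<mu> Y (Y (i, j, h))" using j by (simp add: preim_def)
      then have "(i, j, h) \<in> rect (H (Y (i, j, h))) (p (Y (i, j, h))) (b (Y (i, j, h))) (\<rho> (Y (i, j, h)) div \<gamma> (H (Y (i, j, h))))"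
        using H(3)[OF k'] by simp
      with j k' show "j \<in> (\<Union>k'\<in>?I. {b k'<..b k' + \<rho> k' div \<gamma> h})"
        by (intro UN_I[of "Y (i, j, h)"]) (auto simp: rect_def g_def)
    next
      fix j assume "j \<in> (\<Union>k'\<in>?I. {b k'<..b k' + \<rho> k' div \<gamma> h})"
      then obtain k' where k': "k' \<in> K" "k' \<le> k" "p k' = ?p" "H k' = h" "b k' < j" "j \<le> b k' + \<rho> k' div \<gamma> h"
        by (auto simp: g_def)
      then have "(i, j, h) \<in> preim n \<mu> Y k'"
        unfolding H(3)[OF k'(1)] using i by (auto simp: rect_def)
      with k' show "j \<in> ?J" by (auto simp: preim_def)
    qed
    moreover have "disjoint_family_on (\<lambda>k'. {b k'<..b k' + \<rho> k' div \<gamma> h}) ?I"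
      unfolding disjoint_family_on_def
    proof (intro ballI impI)
      fix k1 k2 assume k: "k1 \<in> ?I" "k2 \<in> ?I" "k1 \<noteq> k2"
      have "(i, j, h) \<in> preim n \<mu> Y k'" if "k' \<in> ?I" "j \<in> {b k'<..b k' + \<rho> k' div \<gamma> h}" for j k'
      proof -
        have k': "k' \<in> K" "p k' = ?p" "H k' = h" using that by (auto simp: g_def)
        then show ?thesis unfolding H(3)[OF k'(1)] using i that by (auto simp: rect_def)
      qed
      with k show "{b k1<..b k1 + \<rho> k1 div \<gamma> h} \<inter> {b k2<..b k2 + \<rho> k2 div \<gamma> h} = {}"
        unfolding preim_def by blast
    qed
    ultimately have card: "card ?J = filled g ?p h k"
      using fin_K by (simp add: filled_def card_UN_disjoint' disjoint_family_on_def)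
    have down: "j' \<in> ?J" if j: "j \<in> ?J" and j': "1 \<le> j'" "j' \<le> j" for j j'
    proof -
      have b': "(i, j', h) \<in> boxes n \<mu>" using j j' by (auto simp: boxes_def)
      moreover have "Y (i, j', h) \<le> Y (i, j, h)"
        using Y b' j j' by (simp add: gl_tabloids_def)
      ultimately show ?thesis using j by simp
    qed
    have finJ: "finite ?J" by (rule finite_subset[of _ "{..\<mu> h i}"]) (auto simp: boxes_def)
    show ?thesis
    proof (cases "?J = {}")
      case True
      show ?thesis using card unfolding True by simp
    next
      case False
      have J: "?J = {1..Max ?J}"
      proof (intro Set.set_eqI iffI)
        fix j assume "j \<in> ?J"
        then show "j \<in> {1..Max ?J}" using Max_ge[OF finJ] by (auto simp: boxes_def)
      next
        fix j assume "j \<in> {1..Max ?J}"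
        then show "j \<in> ?J" using down[OF Max_in[OF finJ False], of j] by simp
      qed
      then obtain N where N: "?J = {1..N}" by blast
      have "card ?J = N" unfolding N by simp
      with N card show ?thesis by simp
    qed
  qed
  have mem: "g \<in> block_assignments"
    unfolding block_assignments_def
  proof (intro CollectI conjI allI ballI)
    show "g \<in> K \<rightarrow>\<^sub>E row_codes"
    proof (rule PiE_I)
      fix k assume k: "k \<in> K"
      have "c k \<in> (SIGMA h:{1..n}. {0..<\<gamma> h})" using c k by blast
      then have ck: "snd (c k) < \<gamma> (H k)" using cH[OF k] by (auto simp: mem_Sigma_iff[of "fst (c k)" "snd (c k)", simplified])
      have "(p k * \<gamma> (H k) + 1, b k + 1, H k) \<in> rect (H k) (p k) (b k) (\<rho> k div \<gamma> (H k))"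
        using w[OF k] \<gamma>_pos[OF H(1)[OF k]] by (auto simp: rect_def)
      then have "(p k * \<gamma> (H k) + 1, b k + 1, H k) \<in> boxes n \<mu>"
        unfolding H(3)[OF k, symmetric] by (simp add: preim_def)
      then show "g k \<in> row_codes" using k H(1)[OF k] ck by (auto simp: g_def row_codes_def boxes_def)
    qed (simp add: g_def)
    show "\<gamma> (snd (fst (g k))) dvd \<rho> k" if "k \<in> K" for k using that H(2) by (simp add: g_def)
    fix q h assume h: "h \<in> {1..n}"
    have K: "k \<le> \<Sum> K" if "k \<in> K" for k using fin_K that by (auto intro: member_le_sum)
    let ?i = "q * \<gamma> h + 1"
    have q: "(?i - 1) div \<gamma> h = q" using \<gamma>_pos[OF h] by simp
    have "{1..\<mu> h ?i} = {j. (?i, j, h) \<in> boxes n \<mu> \<and> Y (?i, j, h) \<le> \<Sum> K}"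
      using h gl_tabloid_value[OF Y] K by (auto simp: boxes_def)
    also have "\<dots> = {1..filled g q h (\<Sum> K)}" using seg[OF h, of ?i] q by simp
    finally have "\<mu> h ?i = filled g q h (\<Sum> K)" by (metis card_atLeastAtMost diff_Suc_1)
    moreover have "{k' \<in> K. k' \<le> \<Sum> K \<and> fst (g k') = (q, h)} = {k \<in> K. fst (g k) = (q, h)}"
      using K by auto
    ultimately show "(\<Sum>k | k \<in> K \<and> fst (g k) = (q, h). \<rho> k div \<gamma> h) = \<mu> h (q * \<gamma> h + 1)"
      unfolding filled_def by simp
  qed
  moreover have "tabloid_of_assignment g = Y"
  proof (rule extensionalityI[of _ "boxes n \<mu>"])
    show "tabloid_of_assignment g \<in> extensional (boxes n \<mu>)" by (simp add: tabloid_of_assignment_def)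
    show "Y \<in> extensional (boxes n \<mu>)" using Y by (simp add: gl_tabloids_def)
    fix x assume "x \<in> boxes n \<mu>"
    then obtain i j h where x: "x = (i, j, h)" "(i, j, h) \<in> boxes n \<mu>" by (cases x) auto
    then have h: "h \<in> {1..n}" "1 \<le> i" "1 \<le> j" by (auto simp: boxes_def)
    have le_iff: "tabloid_of_assignment g (i, j, h) \<le> k \<longleftrightarrow> Y (i, j, h) \<le> k" for k
      unfolding tabloid_of_assignment_le_iff[OF mem x(2)]
      using eqset_imp_iff[OF seg[OF h(1,2), of k], of j] x(2) h(3) by simp
    show "tabloid_of_assignment g x = Y x"
      using le_iff[of "Y (i, j, h)"] le_iff[of "tabloid_of_assignment g (i, j, h)"] x(1) by simp
  qed
  moreover have "marks_of_assignment g = c"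
  proof
    fix k show "marks_of_assignment g k = c k"
      using c cH[of k] by (cases "k \<in> K") (auto simp: marks_of_assignment_def g_def PiE_def extensional_def prod_eq_iff)
  qed
  ultimately show ?thesis by blast
qed

lemma card_marked_tabloids: "card (marked_tabloids n \<rho> \<gamma> \<mu>) = card block_assignments"
proof -
  have "bij_betw (\<lambda>g. (tabloid_of_assignment g, marks_of_assignment g)) block_assignments (marked_tabloids n \<rho> \<gamma> \<mu>)"
    unfolding bij_betw_def
  proof
    show "(\<lambda>g. (tabloid_of_assignment g, marks_of_assignment g)) ` block_assignments = marked_tabloids n \<rho> \<gamma> \<mu>"
      using tabloid_of_assignment_in surj_assignment by (auto simp: image_def) fastforce+
  qed (rule inj_on_assignment)
  then show ?thesis by (rule bij_betw_same_card[symmetric])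
qed

end

section \<open>Equivariant maps to the rows\<close>

text \<open>Serves to name the cycles of \<sigma> by the indices of the parts of \<rho>, with
  matching lengths. The choice among cycles of equal length is arbitrary.\<close>

lemma image_mset_eq_imp_bij:
  assumes "finite B" "finite A" "image_mset f (mset_set A) = image_mset g (mset_set B)"
  shows "\<exists>\<kappa>. bij_betw \<kappa> B A \<and> (\<forall>b\<in>B. f (\<kappa> b) = g b)"
  using assms
proof (induction B arbitrary: A rule: finite_induct)
  case empty
  then have "A = {}" by (simp add: mset_set_empty_iff)
  then show ?case by (auto simp: bij_betw_def)
next
  case (insert b B)
  have "f ` A = g ` insert b B"
    using arg_cong[OF insert.prems(2), of set_mset] insert.hyps insert.prems(1) by simp
  then obtain a where a: "a \<in> A" "f a = g b" by (metis imageE insertI1 image_eqI)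
  have "mset_set A = add_mset a (mset_set (A - {a}))" using a insert.prems by (simp add: mset_set.remove)
  then have "image_mset f (mset_set (A - {a})) = image_mset g (mset_set B)"
    using insert a by simp
  then obtain \<kappa> where \<kappa>: "bij_betw \<kappa> B (A - {a})" "\<forall>b\<in>B. f (\<kappa> b) = g b"
    using insert.IH[of "A - {a}"] insert.prems by auto
  have "bij_betw (\<kappa>(b := a)) (insert b B) A"
  proof -
    have "bij_betw (\<kappa>(b := a)) B (A - {a})"
      using \<kappa>(1) insert.hyps by (subst bij_betw_cong[of B _ \<kappa>]) auto
    then have "bij_betw (\<kappa>(b := a)) (insert b B) (insert ((\<kappa>(b := a)) b) (A - {a}))"
      using insert.hyps by (intro notIn_Un_bij_betw[of b B, simplified Un_insert_right sup_bot_right]) auto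
    then show ?thesis using a by (simp add: insert_absorb)
  qed
  moreover have "\<forall>b'\<in>insert b B. f ((\<kappa>(b := a)) b') = g b'" using \<kappa> a insert.hyps by auto
  ultimately show ?case by blast
qed

lemma orbit_enumeration:
  assumes "permutation \<tau>"
  shows "bij_betw (\<lambda>t. (\<tau> ^^ t) x) {..<card (orbit \<tau> x)} (orbit \<tau> x)"
    and "(\<tau> ^^ card (orbit \<tau> x)) x = x"
proof -
  have x: "x \<in> orbit \<tau> x" by (rule permutation_self_in_orbit[OF assms])
  let ?d = "funpow_dist1 \<tau> x x"
  have bij: "bij_betw (\<lambda>t. (\<tau> ^^ t) x) {0..<?d} (orbit \<tau> x)"
    unfolding bij_betw_def using orbit_conv_funpow_dist1[OF x] inj_on_funpow_dist1[OF x] by simp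
  then have d: "card (orbit \<tau> x) = ?d" using bij_betw_same_card by fastforce
  show "bij_betw (\<lambda>t. (\<tau> ^^ t) x) {..<card (orbit \<tau> x)} (orbit \<tau> x)"
    unfolding d using bij by (simp only: atLeast0LessThan)
  show "(\<tau> ^^ card (orbit \<tau> x)) x = x"
    unfolding d using funpow_dist1_prop[OF x] .
qed

text \<open>Picks a starting point \<open>z k\<close> on each cycle. The pairs (k, t) become
  coordinates on \<open>S\<close> in which \<tau> increases t by 1, cyclically modulo \<rho>
  k.\<close>

lemma cycle_representatives:
  assumes \<tau>: "\<tau> permutes S" "finite S" and \<kappa>: "bij_betw \<kappa> K (orbit \<tau> ` S)"
    and card: "\<And>k. k \<in> K \<Longrightarrow> card (\<kappa> k) = \<rho> k"
  obtains z where "bij_betw (\<lambda>(k, t). (\<tau> ^^ t) (z k)) (SIGMA k:K. {..<\<rho> k}) S"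
    and "\<And>k. k \<in> K \<Longrightarrow> (\<tau> ^^ \<rho> k) (z k) = z k"
proof -
  have perm: "permutation \<tau>" using \<tau> by (auto simp: permutation_permutes)
  have "\<forall>k\<in>K. \<exists>x. x \<in> S \<and> \<kappa> k = orbit \<tau> x" using bij_betwE[OF \<kappa>] by blast
  then obtain z where z: "\<And>k. k \<in> K \<Longrightarrow> z k \<in> S \<and> \<kappa> k = orbit \<tau> (z k)" by metis
  have enum: "bij_betw (\<lambda>t. (\<tau> ^^ t) (z k)) {..<\<rho> k} (\<kappa> k)" "(\<tau> ^^ \<rho> k) (z k) = z k" if "k \<in> K" for k
    using orbit_enumeration[OF perm, of "z k"] z[OF that] card[OF that] by auto
  have orbit_eq: "orbit \<tau> y = orbit \<tau> x" if "y \<in> orbit \<tau> x" for x y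
    using orbit_cyclic_eq3[OF cyclic_on_orbit'[OF perm] that] .
  have "bij_betw (\<lambda>(k, t). (\<tau> ^^ t) (z k)) (SIGMA k:K. {..<\<rho> k}) S"
    unfolding bij_betw_def
  proof
    show "inj_on (\<lambda>(k, t). (\<tau> ^^ t) (z k)) (SIGMA k:K. {..<\<rho> k})"
    proof (rule inj_onI, clarify)
      fix k t k' t'
      assume k: "k \<in> K" "t < \<rho> k" "k' \<in> K" "t' < \<rho> k'" and eq: "(\<tau> ^^ t) (z k) = (\<tau> ^^ t') (z k')"
      have "(\<tau> ^^ t) (z k) \<in> \<kappa> k" "(\<tau> ^^ t') (z k') \<in> \<kappa> k'"
        using enum(1)[OF k(1)] enum(1)[OF k(3)] k by (auto simp: bij_betw_def)
      then have "\<kappa> k = \<kappa> k'" using orbit_eq z k eq by metis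
      then have "k = k'" using \<kappa> k by (auto simp: bij_betw_def dest: inj_onD)
      moreover from this have "t = t'" using enum(1)[OF k(1)] k eq by (auto simp: bij_betw_def dest: inj_onD)
      ultimately show "k = k' \<and> t = t'" by simp
    qed
    show "(\<lambda>(k, t). (\<tau> ^^ t) (z k)) ` (SIGMA k:K. {..<\<rho> k}) = S"
    proof
      show "(\<lambda>(k, t). (\<tau> ^^ t) (z k)) ` (SIGMA k:K. {..<\<rho> k}) \<subseteq> S"
        using z permutes_in_image[OF permutes_funpow[OF \<tau>(1)]] by auto
      show "S \<subseteq> (\<lambda>(k, t). (\<tau> ^^ t) (z k)) ` (SIGMA k:K. {..<\<rho> k})"
      proof
        fix x assume x: "x \<in> S"
        then have "orbit \<tau> x \<in> \<kappa> ` K" using bij_betw_imp_surj_on[OF \<kappa>] by simp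
        then obtain k where k: "k \<in> K" "\<kappa> k = orbit \<tau> x" by force
        then have "x \<in> \<kappa> k" using permutation_self_in_orbit[OF perm] by simp
        then obtain t where "t < \<rho> k" "x = (\<tau> ^^ t) (z k)" using enum(1)[OF k(1)] by (auto simp: bij_betw_def)
        with k show "x \<in> (\<lambda>(k, t). (\<tau> ^^ t) (z k)) ` (SIGMA k:K. {..<\<rho> k})" by force
      qed
    qed
  qed
  with enum(2) show ?thesis using that by blast
qed

text \<open>Since the step is coprime to the modulus, every window of \<gamma> consecutive values of
  t meets each residue exactly once; the induction adds one window at a time.\<close>

lemma card_arith_progression_residue:
  fixes c e \<gamma> w r :: nat
  assumes "coprime e \<gamma>" "r < \<gamma>"
  shows "card {t. t < \<gamma> * w \<and> (c + t * e) mod \<gamma> = r} = w"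
proof (induction w)
  case 0
  then show ?case by simp
next
  case (Suc w)
  let ?f = "\<lambda>t. (c + t * e) mod \<gamma>"
  let ?I = "{\<gamma> * w..<\<gamma> * w + \<gamma>}"
  have inj: "inj_on ?f ?I"
  proof (rule inj_onI)
    have aux: "t = t'" if "t \<in> ?I" "t' \<in> ?I" "?f t = ?f t'" "t \<le> t'" for t t'
    proof -
      have "\<gamma> dvd (c + t' * e) - (c + t * e)"
        using that by (metis mod_eq_dvd_iff_nat add_le_mono1 mult_le_mono1 nat_add_left_cancel_le)
      then have "\<gamma> dvd (t' - t) * e" by (simp add: diff_mult_distrib)
      then have "\<gamma> dvd t' - t" using assms(1) by (simp add: coprime_dvd_mult_left_iff coprime_commute)
      moreover have "t' - t < \<gamma>" using that by auto
      ultimately have "t' - t = 0" by (metis nat_dvd_not_less not_gr_zero)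
      then show ?thesis using that by simp
    qed
    fix t t' assume "t \<in> ?I" "t' \<in> ?I" "?f t = ?f t'"
    then show "t = t'" using aux[of t t'] aux[of t' t] by (cases "t \<le> t'") auto
  qed
  have sub: "?f ` ?I \<subseteq> {..<\<gamma>}" using assms by auto
  have "?f ` ?I = {..<\<gamma>}"
    using card_image[OF inj] sub by (intro card_subset_eq) auto
  then have "r \<in> ?f ` ?I" using assms by simp
  then obtain t where t: "t \<in> ?I" "?f t = r" by blast
  have "{t' \<in> ?I. ?f t' = r} = {t}" using t inj_onD[OF inj] by blast
  moreover have "{t. t < \<gamma> * Suc w \<and> ?f t = r} = {t. t < \<gamma> * w \<and> ?f t = r} \<union> {t' \<in> ?I. ?f t' = r}"
    by auto
  ultimately have "{t. t < \<gamma> * Suc w \<and> ?f t = r} = insert t {t. t < \<gamma> * w \<and> ?f t = r}"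
    by simp
  moreover have "t \<notin> {t. t < \<gamma> * w \<and> ?f t = r}" using t by simp
  ultimately show ?case using Suc by simp
qed

text \<open>\<open>e h\<close> is the number of places by which the shift advances in an orbit of
  \<gamma> h rows; coprimality makes its multiples reach every place.\<close>

locale equivariant_rows = block_diagrams n \<mu> \<gamma> \<rho> K for n \<mu> \<gamma> \<rho> K +
  fixes S :: "nat set" and \<tau> :: "nat \<Rightarrow> nat" and z :: "nat \<Rightarrow> nat" and e :: "nat \<Rightarrow> nat"
  assumes fin_S: "finite S" and \<tau>: "\<tau> permutes S"
    and enum: "bij_betw (\<lambda>(k, t). (\<tau> ^^ t) (z k)) (SIGMA k:K. {..<\<rho> k}) S"
    and cyc: "\<And>k. k \<in> K \<Longrightarrow> (\<tau> ^^ \<rho> k) (z k) = z k"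
    and cop: "\<And>h. h \<in> {1..n} \<Longrightarrow> coprime (e h) (\<gamma> h)"
begin

definition rot :: "(nat \<times> nat) \<times> nat \<Rightarrow> (nat \<times> nat) \<times> nat" where
  "rot r = (fst r, (snd r + e (snd (fst r))) mod \<gamma> (snd (fst r)))"

text \<open>The row functions of fixed tabloids in coded form; the cardinality condition gives each
  fibre the size of its row.\<close>

definition "equivariant_maps = {f \<in> S \<rightarrow>\<^sub>E row_codes. (\<forall>x\<in>S. f (\<tau> x) = rot (f x)) \<and>
   (\<forall>((p, h), c)\<in>row_codes. card {x \<in> S. f x = ((p, h), c)} = \<mu> h (p * \<gamma> h + 1))}"

lemma rot_pow:
  assumes "((p, h), c) \<in> row_codes"
  shows "(rot ^^ t) ((p, h), c) = ((p, h), (c + t * e h) mod \<gamma> h)"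
proof (induction t)
  case 0
  then show ?case using assms by (simp add: row_codes_def)
next
  case (Suc t)
  have "((c + t * e h) mod \<gamma> h + e h) mod \<gamma> h = (c + Suc t * e h) mod \<gamma> h"
    by (subst mod_add_left_eq) (simp add: algebra_simps)
  with Suc show ?case by (simp add: rot_def)
qed

lemma rot_pow_period:
  assumes "r \<in> row_codes" "\<gamma> (snd (fst r)) dvd t"
  shows "(rot ^^ t) r = r"
proof -
  obtain p h c where r: "r = ((p, h), c)" by (metis prod.exhaust)
  then have "(rot ^^ t) r = ((p, h), (c + t * e h) mod \<gamma> h)" using assms rot_pow by simp
  also have "(c + t * e h) mod \<gamma> h = c"
    using assms r by (auto simp: row_codes_def mult.assoc elim!: dvdE)
  finally show ?thesis using r by simp
qed

lemma rot_row_codes: "r \<in> row_codes \<Longrightarrow> (rot ^^ t) r \<in> row_codes"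
proof -
  assume r: "r \<in> row_codes"
  obtain p h c where "r = ((p, h), c)" by (metis prod.exhaust)
  with r rot_pow[of p h c t] show ?thesis by (auto simp: row_codes_def)
qed

lemma z_in: "k \<in> K \<Longrightarrow> t < \<rho> k \<Longrightarrow> (\<tau> ^^ t) (z k) \<in> S"
  using enum by (auto simp: bij_betw_def)

lemma z_in0: "k \<in> K \<Longrightarrow> z k \<in> S"
  using z_in[of k 0] by (simp add: K_def)

lemma z_surj:
  assumes "x \<in> S" obtains k t where "k \<in> K" "t < \<rho> k" "x = (\<tau> ^^ t) (z k)"
  using enum assms by (auto simp: bij_betw_def)

lemma equivariant_pow:
  assumes "f \<in> equivariant_maps" "x \<in> S"
  shows "f ((\<tau> ^^ t) x) = (rot ^^ t) (f x)"
proof (induction t)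
  case (Suc t)
  have "(\<tau> ^^ t) x \<in> S" using assms(2) permutes_in_image[OF permutes_funpow[OF \<tau>]] by simp
  then show ?case using assms(1) Suc by (auto simp: equivariant_maps_def)
qed simp

text \<open>A cycle sent to the orbit (p, h) winds evenly around it and meets each position \<rho> k
  div \<gamma> h times, whatever its starting place. So the count does not depend on
  \<open>c\<close>.\<close>

lemma card_fibre:
  assumes f: "\<And>k t. k \<in> K \<Longrightarrow> t < \<rho> k \<Longrightarrow> f ((\<tau> ^^ t) (z k)) = (rot ^^ t) (g k)"
    and g: "\<And>k. k \<in> K \<Longrightarrow> g k \<in> row_codes \<and> \<gamma> (snd (fst (g k))) dvd \<rho> k"
    and h: "h \<in> {1..n}" and c: "c < \<gamma> h"
  shows "card {x \<in> S. f x = ((p, h), c)} = (\<Sum>k | k \<in> K \<and> fst (g k) = (p, h). \<rho> k div \<gamma> h)"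
proof -
  let ?E = "\<lambda>(k, t). (\<tau> ^^ t) (z k)"
  let ?A = "\<lambda>k. {t. t < \<rho> k \<and> (rot ^^ t) (g k) = ((p, h), c)}"
  have "{x \<in> S. f x = ((p, h), c)} = ?E ` (SIGMA k:K. ?A k)"
  proof (intro Set.set_eqI iffI)
    fix x assume x: "x \<in> {x \<in> S. f x = ((p, h), c)}"
    then obtain k t where "k \<in> K" "t < \<rho> k" "x = (\<tau> ^^ t) (z k)" using z_surj by blast
    with x f show "x \<in> ?E ` (SIGMA k:K. ?A k)" by force
  next
    fix x assume "x \<in> ?E ` (SIGMA k:K. ?A k)"
    then show "x \<in> {x \<in> S. f x = ((p, h), c)}" using f z_in by auto
  qed
  moreover have "inj_on ?E (SIGMA k:K. ?A k)"
    using enum by (auto simp: bij_betw_def intro: inj_on_subset)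
  ultimately have "card {x \<in> S. f x = ((p, h), c)} = (\<Sum>k\<in>K. card (?A k))"
    using fin_K by (simp add: card_image)
  also have "\<dots> = (\<Sum>k\<in>K. if fst (g k) = (p, h) then \<rho> k div \<gamma> h else 0)"
  proof (rule sum.cong[OF refl])
    fix k assume k: "k \<in> K"
    obtain p' h' c' where gk: "g k = ((p', h'), c')" by (metis prod.exhaust)
    then have A: "?A k = {t. t < \<rho> k \<and> p' = p \<and> h' = h \<and> (c' + t * e h') mod \<gamma> h' = c}"
      using rot_pow g[OF k] by auto
    show "card (?A k) = (if fst (g k) = (p, h) then \<rho> k div \<gamma> h else 0)"
    proof (cases "fst (g k) = (p, h)")
      case True
      then have ph: "p' = p" "h' = h" using gk by auto
      then have "\<rho> k = \<gamma> h * (\<rho> k div \<gamma> h)" using g[OF k] gk by auto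
      then show ?thesis
        unfolding A using True ph card_arith_progression_residue[OF cop[OF h] c, of "\<rho> k div \<gamma> h" c'] by simp
    next
      case False
      then have "?A k = {}" using A gk by auto
      then show ?thesis using False by simp
    qed
  qed
  also have "\<dots> = (\<Sum>k | k \<in> K \<and> fst (g k) = (p, h). \<rho> k div \<gamma> h)"
    using fin_K by (simp add: sum.If_cases Int_def)
  finally show ?thesis .
qed

lemma equivariant_to_assignment:
  assumes f: "f \<in> equivariant_maps"
  shows "(\<lambda>k\<in>K. f (z k)) \<in> block_assignments"
proof -
  let ?g = "\<lambda>k\<in>K. f (z k)"
  have codes: "?g k \<in> row_codes" if "k \<in> K" for k
    using f z_in0[OF that] that by (auto simp: equivariant_maps_def)
  have dv: "\<gamma> (snd (fst (?g k))) dvd \<rho> k" if k: "k \<in> K" for k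
  proof -
    obtain p h c where gk: "f (z k) = ((p, h), c)" by (metis prod.exhaust)
    then have r: "((p, h), c) \<in> row_codes" using codes[OF k] k by simp
    then have c: "c < \<gamma> h" "h \<in> {1..n}" by (auto simp: row_codes_def)
    \<comment> \<open>Once around the cycle leads back to the start, so \<rho> k * e h vanishes
      modulo \<gamma> h, and \<open>e h\<close> can be cancelled.\<close>
    have "f (z k) = (rot ^^ \<rho> k) (f (z k))"
      using equivariant_pow[OF f z_in0[OF k], of "\<rho> k"] cyc[OF k] by simp
    then have "(c + \<rho> k * e h) mod \<gamma> h = c mod \<gamma> h"
      using gk rot_pow[OF r, of "\<rho> k"] c by simp
    then have "\<gamma> h dvd \<rho> k * e h" by (metis add_diff_cancel_left' le_add1 mod_eq_dvd_iff_nat)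
    then have "\<gamma> h dvd \<rho> k" using cop[OF c(2)] by (simp add: coprime_dvd_mult_left_iff coprime_commute)
    then show ?thesis using gk k by simp
  qed
  have "(\<Sum>k | k \<in> K \<and> fst (?g k) = (p, h). \<rho> k div \<gamma> h) = \<mu> h (p * \<gamma> h + 1)" if h: "h \<in> {1..n}" for p h
  \<comment> \<open>Groups beyond the diagram have no codes, so nothing is sent there. In every
    other group the fibre over position 0 can be counted.\<close>
  proof (cases "\<mu> h (p * \<gamma> h + 1) = 0")
    case True
    then have "{k. k \<in> K \<and> fst (?g k) = (p, h)} = {}" using codes by (fastforce simp: row_codes_def)
    then show ?thesis using True by (metis sum.empty)
  next
    case False
    then have r: "((p, h), 0) \<in> row_codes" using h \<gamma>_pos[OF h] by (simp add: row_codes_def)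
    have "(\<Sum>k | k \<in> K \<and> fst (?g k) = (p, h). \<rho> k div \<gamma> h) = card {x \<in> S. f x = ((p, h), 0)}"
      using equivariant_pow[OF f z_in0] codes dv h \<gamma>_pos[OF h] by (intro card_fibre[symmetric]) auto
    also have "\<dots> = \<mu> h (p * \<gamma> h + 1)" using f r by (force simp: equivariant_maps_def)
    finally show ?thesis .
  qed
  then show ?thesis using codes dv unfolding block_assignments_def by auto
qed

text \<open>Equivariance determines a map from its values at the points \<open>z k\<close>, and any
  admissible values extend along the cycles.\<close>

lemma card_equivariant_maps: "card equivariant_maps = card block_assignments"
proof -
  let ?\<Psi> = "\<lambda>f. \<lambda>k\<in>K. f (z k)"
  have "inj_on ?\<Psi> equivariant_maps"
  proof (rule inj_onI)
    fix f f' assume f: "f \<in> equivariant_maps" and f': "f' \<in> equivariant_maps" and eq: "?\<Psi> f = ?\<Psi> f'"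
    show "f = f'"
    proof (rule extensionalityI[of _ S])
      show "f \<in> extensional S" "f' \<in> extensional S" using f f' by (auto simp: equivariant_maps_def PiE_def)
      fix x assume "x \<in> S"
      then obtain k t where k: "k \<in> K" "x = (\<tau> ^^ t) (z k)" using z_surj by metis
      then have "f (z k) = f' (z k)" using fun_cong[OF eq, of k] by simp
      then show "f x = f' x"
        using k equivariant_pow[OF f z_in0[OF k(1)]] equivariant_pow[OF f' z_in0[OF k(1)]] by simp
    qed
  qed
  moreover have "?\<Psi> ` equivariant_maps = block_assignments"
  proof
    show "?\<Psi> ` equivariant_maps \<subseteq> block_assignments" using equivariant_to_assignment by blast
    show "block_assignments \<subseteq> ?\<Psi> ` equivariant_maps"
    proof
      fix g assume g: "g \<in> block_assignments"
      let ?E = "\<lambda>(k, t). (\<tau> ^^ t) (z k)"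
      define E' where "E' = the_inv_into (SIGMA k:K. {..<\<rho> k}) ?E"
      define f where "f = (\<lambda>x\<in>S. (rot ^^ snd (E' x)) (g (fst (E' x))))"
      have E': "E' ((\<tau> ^^ t) (z k)) = (k, t)" if "k \<in> K" "t < \<rho> k" for k t
        using the_inv_into_f_f[of ?E "SIGMA k:K. {..<\<rho> k}" "(k, t)"] enum that
        by (auto simp: E'_def bij_betw_def)
      have f: "f ((\<tau> ^^ t) (z k)) = (rot ^^ t) (g k)" if "k \<in> K" "t < \<rho> k" for k t
        using that by (simp add: f_def z_in E')
      have gk: "g k \<in> row_codes \<and> \<gamma> (snd (fst (g k))) dvd \<rho> k" if "k \<in> K" for k
        using g that by (auto simp: block_assignments_def)
      have "f \<in> equivariant_maps"
        unfolding equivariant_maps_def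
      proof (intro CollectI conjI ballI)
        show "f \<in> S \<rightarrow>\<^sub>E row_codes"
        proof (rule PiE_I)
          fix x assume "x \<in> S"
          then obtain k t where "k \<in> K" "t < \<rho> k" "x = (\<tau> ^^ t) (z k)" by (rule z_surj)
          then show "f x \<in> row_codes" using f gk rot_row_codes by simp
        qed (simp add: f_def)
        fix x assume "x \<in> S"
        then obtain k t where k: "k \<in> K" "t < \<rho> k" "x = (\<tau> ^^ t) (z k)" by (rule z_surj)
        show "f (\<tau> x) = rot (f x)"
        proof (cases "Suc t < \<rho> k")
          case True
          then show ?thesis using k f[of k "Suc t"] f[of k t] by simp
        next
          case False
          \<comment> \<open>The wrap-around step: \<tau> x is \<open>z k\<close> again, and the
            power \<rho> k of \<open>rot\<close> fixes \<open>g k\<close> because \<gamma> divides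
            \<rho> k.\<close>
          then have t: "Suc t = \<rho> k" using k by simp
          then have "\<tau> x = (\<tau> ^^ 0) (z k)" using cyc[OF k(1)] k(3) by (simp flip: t)
          then have "f (\<tau> x) = g k" using f[of k 0] k by (simp add: K_def)
          moreover have "rot (f x) = (rot ^^ \<rho> k) (g k)" using f[of k t] k by (simp flip: t)
          ultimately show ?thesis using rot_pow_period gk[OF k(1)] by simp
        qed
      next
        fix r assume "r \<in> row_codes"
        then obtain p h c where r: "r = ((p, h), c)" "h \<in> {1..n}" "c < \<gamma> h" by (auto simp: row_codes_def)
        have "card {x \<in> S. f x = ((p, h), c)} = (\<Sum>k | k \<in> K \<and> fst (g k) = (p, h). \<rho> k div \<gamma> h)"
          using r by (intro card_fibre f gk)
        also have "\<dots> = \<mu> h (p * \<gamma> h + 1)" using g r by (auto simp: block_assignments_def)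
        finally show "case r of (a, b) \<Rightarrow> (case a of (p, h) \<Rightarrow> \<lambda>c. card {x \<in> S. f x = ((p, h), c)} = \<mu> h (p * \<gamma> h + 1)) b"
          using r by simp
      qed
      moreover have "?\<Psi> f = g"
      proof
        fix k show "?\<Psi> f k = g k"
        proof (cases "k \<in> K")
          case True
          then have "0 < \<rho> k" by (simp add: K_def)
          then show ?thesis using f[OF True, of 0] True by simp
        next
          case False
          then show ?thesis using g by (auto simp: block_assignments_def PiE_def extensional_def)
        qed
      qed
      ultimately show "g \<in> ?\<Psi> ` equivariant_maps" by blast
    qed
  qed
  ultimately show ?thesis by (metis card_image)
qed

end

section \<open>Partitions, the standard numbering and the block permutation\<close>

lemma partition_antimono:
  assumes "is_partition N \<mu>" "1 \<le> i" "i \<le> i'"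
  shows "\<mu> i' \<le> \<mu> i"
  using assms(3)
proof (induction i' rule: dec_induct)
  case (step k)
  have "\<mu> (Suc k) \<le> \<mu> k" using assms(1,2) step.hyps by (simp add: is_partition_def)
  with step.IH show ?case by simp
qed simp

lemma partition_bounded:
  assumes "is_partition N \<mu>"
  shows "\<exists>R. (\<forall>i\<ge>1. \<mu> i \<noteq> 0 \<longrightarrow> i \<le> R) \<and> (\<Sum>i=1..R. \<mu> i) = N"
proof -
  have fin: "finite {i. 1 \<le> i \<and> \<mu> i \<noteq> 0}" using assms by (simp add: is_partition_def)
  then obtain R where R: "\<forall>i\<in>{i. 1 \<le> i \<and> \<mu> i \<noteq> 0}. i \<le> R"
    unfolding finite_nat_set_iff_bounded_le by blast
  then have "(\<Sum>i | 1 \<le> i \<and> \<mu> i \<noteq> 0. \<mu> i) = (\<Sum>i=1..R. \<mu> i)"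
    by (intro sum.mono_neutral_left) auto
  then show ?thesis using R assms by (intro exI[of _ R]) (auto simp: is_partition_def)
qed

text \<open>With v the length of the first row of the block, the rows of length at least v form an
  interval {1..N'}. Its size is a sum of multiplicities divisible by \<open>l\<close>, so N' is a
  multiple of \<open>l\<close> and the interval cannot end inside the block.\<close>

lemma l_partition_block:
  assumes lp: "is_l_partition l N \<mu>" and l: "0 < l" and i: "1 \<le> i" and i0: "i0 = (i - 1) div l * l + 1"
  shows "\<mu> i = \<mu> i0"
proof (rule antisym)
  have part: "is_partition N \<mu>" using lp by (simp add: is_l_partition_def)
  have "(i - 1) div l * l \<le> i - 1" by simp
  then have i0_le: "i0 \<le> i" using i i0 by linarith
  show "\<mu> i \<le> \<mu> i0" using i0 i0_le by (intro partition_antimono[OF part]) auto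
  show "\<mu> i0 \<le> \<mu> i"
  proof (cases "\<mu> i0 = 0")
    case False
    define v where "v = \<mu> i0"
    define A where "A = {k. 1 \<le> k \<and> v \<le> \<mu> k}"
    have v: "1 \<le> v" using False by (simp add: v_def)
    obtain R where R: "\<And>i. 1 \<le> i \<Longrightarrow> \<mu> i \<noteq> 0 \<Longrightarrow> i \<le> R" using partition_bounded[OF part] by auto
    have "A \<subseteq> {..R}" using R v by (force simp: A_def)
    then have fin: "finite A" by (rule finite_subset) simp
    have "A = (\<Union>w\<in>{v..\<mu> 1}. {k. 1 \<le> k \<and> \<mu> k = w})"
      using partition_antimono[OF part, of 1] by (auto simp: A_def)
    moreover have "finite {k. 1 \<le> k \<and> \<mu> k = w}" if "w \<in> {v..\<mu> 1}" for w
      using fin by (rule rev_finite_subset) (use that in \<open>auto simp: A_def\<close>)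
    ultimately have "card A = (\<Sum>w\<in>{v..\<mu> 1}. card {k. 1 \<le> k \<and> \<mu> k = w})"
      by (simp only:) (intro card_UN_disjoint, auto)
    also have "l dvd \<dots>" using lp v by (intro dvd_sum) (auto simp: is_l_partition_def)
    finally have dvd: "l dvd card A" .
    have i0A: "i0 \<in> A" using i0 by (simp add: A_def v_def)
    have "Max A \<in> A" using fin i0A by (intro Max_in) auto
    have "A = {1..Max A}"
    proof (intro Set.set_eqI iffI)
      fix k assume "k \<in> A"
      then show "k \<in> {1..Max A}" using fin by (auto simp: A_def)
    next
      fix k assume k: "k \<in> {1..Max A}"
      then have "\<mu> (Max A) \<le> \<mu> k" by (intro partition_antimono[OF part]) auto
      with k \<open>Max A \<in> A\<close> show "k \<in> A" by (auto simp: A_def)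
    qed
    then obtain N' where N': "A = {1..N'}" by blast
    with dvd have "l dvd N'" by simp
    then obtain b where b: "N' = b * l" by (metis dvd_def mult.commute)
    have "i0 \<le> b * l" using i0A N' b by simp
    then have "(i - 1) div l * l < b * l" using i0 by linarith
    then have "(i - 1) div l < b" using mult_less_cancel2 by blast
    then have "((i - 1) div l + 1) * l \<le> b * l" by (intro mult_le_mono1) simp
    moreover have "i - 1 < ((i - 1) div l + 1) * l"
      using dividend_less_times_div[OF l, of "i - 1"] by (simp add: algebra_simps)
    ultimately have "i \<in> A" using i N' b by simp
    then show ?thesis by (simp add: A_def v_def)
  qed simp
qed

text \<open>Applied twice: to the rows of one component with their lengths, and to the components
  with their sizes \<open>m h\<close>. The standard numbering is the composite.\<close>

lemma bij_betw_concat: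
  "bij_betw (\<lambda>(i, j). (\<Sum>i'=1..<i. w i') + j) {(i, j). 1 \<le> i \<and> i \<le> N \<and> 1 \<le> j \<and> j \<le> w i} {1..\<Sum>i=1..N. w i}"
  for w :: "nat \<Rightarrow> nat"
proof (induction N)
  case 0
  have "{(i, j). 1 \<le> i \<and> i \<le> (0::nat) \<and> 1 \<le> j \<and> j \<le> w i} = {}" "{1..\<Sum>i=1..0. w i} = {}" by auto
  then show ?case by (simp only: bij_betw_def inj_on_empty image_empty simp_thms)
next
  case (Suc N)
  let ?f = "\<lambda>(i, j). (\<Sum>i'=1..<i. w i') + j"
  let ?s = "\<Sum>i=1..N. w i"
  have eq: "{1..<Suc N} = {1..N}" by auto
  have "bij_betw ?f (Pair (Suc N) ` {1..w (Suc N)}) {?s + 1..?s + w (Suc N)}"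
  proof -
    have "?f ` Pair (Suc N) ` {1..w (Suc N)} = (\<lambda>j. j + ?s) ` {1..w (Suc N)}"
      unfolding image_image by (intro image_cong refl) (simp only: prod.case eq add.commute)
    also have "\<dots> = {?s + 1..?s + w (Suc N)}"
      by (subst image_add_atLeastAtMost') (simp add: add.commute)
    finally show ?thesis unfolding bij_betw_def by (auto simp: inj_on_def)
  qed
  then have "bij_betw ?f ({(i, j). 1 \<le> i \<and> i \<le> N \<and> 1 \<le> j \<and> j \<le> w i} \<union> Pair (Suc N) ` {1..w (Suc N)})
      ({1..?s} \<union> {?s + 1..?s + w (Suc N)})"
    by (rule bij_betw_combine[OF Suc.IH]) auto
  moreover have "{(i, j). 1 \<le> i \<and> i \<le> N \<and> 1 \<le> j \<and> j \<le> w i} \<union> Pair (Suc N) ` {1..w (Suc N)}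
    = {(i, j). 1 \<le> i \<and> i \<le> Suc N \<and> 1 \<le> j \<and> j \<le> w i}"
    by (auto simp: le_Suc_eq)
  moreover have "{1..?s} \<union> {?s + 1..?s + w (Suc N)} = {1..\<Sum>i=1..Suc N. w i}" by auto
  ultimately show ?case by (simp only:)
qed

section \<open>Evaluating products of disjoint cycles\<close>

lemma foldr_comp_fixes: "\<forall>f\<in>set fs. f x = x \<Longrightarrow> foldr (\<circ>) fs id x = x"
  by (induction fs) auto

lemma foldr_comp_concat:
  "foldr (\<circ>) (concat fss) id = foldr (\<circ>) (map (\<lambda>fs. foldr (\<circ>) fs id) fss) (id :: 'a \<Rightarrow> 'a)"
proof (induction fss)
  case (Cons fs fss)
  have app: "foldr (\<circ>) fs g = foldr (\<circ>) fs id \<circ> g" for g :: "'a \<Rightarrow> 'a"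
    by (induction fs) (auto simp: comp_assoc)
  have "foldr (\<circ>) (concat (fs # fss)) id = foldr (\<circ>) fs (foldr (\<circ>) (concat fss) id)"
    by (simp only: concat.simps foldr_append)
  also have "\<dots> = foldr (\<circ>) fs id \<circ> foldr (\<circ>) (concat fss) id" by (rule app)
  also have "\<dots> = foldr (\<circ>) (map (\<lambda>fs. foldr (\<circ>) fs id) (fs # fss)) id" unfolding Cons.IH by simp
  finally show ?case .
qed simp

text \<open>The factors applied before that of \<open>c\<close> see \<open>x\<close>, those applied
  after it see \<open>y\<close>; therefore all of them must fix both points.\<close>

lemma foldr_comp_single:
  assumes "distinct zs" "c \<in> set zs" "F c x = y"
    and "\<And>z. z \<in> set zs \<Longrightarrow> z \<noteq> c \<Longrightarrow> F z x = x \<and> F z y = y"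
  shows "foldr (\<circ>) (map F zs) id x = y"
  using assms
proof (induction zs)
  case (Cons z zs)
  have step: "foldr (\<circ>) (map F (z # zs)) id x = F z (foldr (\<circ>) (map F zs) id x)" by simp
  show ?case
  proof (cases "z = c")
    case True
    then have "foldr (\<circ>) (map F zs) id x = x"
      using Cons.prems by (intro foldr_comp_fixes) auto
    then show ?thesis unfolding step using True Cons.prems(3) by metis
  next
    case False
    then have "foldr (\<circ>) (map F zs) id x = y" using Cons.prems by (intro Cons.IH) auto
    moreover have "F z y = y" using False Cons.prems by simp
    ultimately show ?thesis unfolding step by metis
  qed
qed simp

lemma foldr_comp_permutes: "\<forall>f\<in>set fs. f permutes S \<Longrightarrow> foldr (\<circ>) fs id permutes S"
  by (induction fs) (auto intro: permutes_compose permutes_id)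

lemma cycle_of_list_nth:
  assumes "distinct cs" "k < length cs"
  shows "cycle_of_list cs (cs ! k) = cs ! (Suc k mod length cs)"
proof -
  have "map (cycle_of_list cs) cs = rotate1 cs"
    using cyclic_rotation[OF assms(1), of 1] by simp
  then have "map (cycle_of_list cs) cs ! k = rotate1 cs ! k" by simp
  then show ?thesis using assms(2) by (simp add: nth_rotate1)
qed

section \<open>Cyclic shifts inside blocks of rows\<close>

lemma block_index_div: "1 \<le> s \<Longrightarrow> s \<le> l \<Longrightarrow> (l * q + s - 1) div l = q" for l q s :: nat
  by (rule div_nat_eqI) auto

definition block_shift :: "nat \<Rightarrow> nat \<Rightarrow> nat \<Rightarrow> nat" where
  "block_shift l J i = l * ((i - 1) div l) + ((i - 1) mod l + J) mod l + 1"

lemma block_shift_div: "0 < l \<Longrightarrow> (block_shift l J i - 1) div l = (i - 1) div l"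
  by (simp add: block_shift_def)

lemma block_shift_mod: "0 < l \<Longrightarrow> (block_shift l J i - 1) mod l = ((i - 1) mod l + J) mod l"
  by (simp add: block_shift_def)

lemma block_shift_pos: "1 \<le> block_shift l J i" by (simp add: block_shift_def)

lemma block_shift_add:
  assumes "0 < l"
  shows "block_shift l J (block_shift l J' i) = block_shift l (J + J') i"
proof -
  have "(((i - 1) mod l + J') mod l + J) mod l = ((i - 1) mod l + (J + J')) mod l"
    by (subst mod_add_left_eq) (simp only: add.assoc add.commute[of J J'])
  then show ?thesis
    unfolding block_shift_def[of l J] block_shift_div[OF assms] block_shift_mod[OF assms]
    by (simp only: block_shift_def)
qed

lemma block_shift_period:
  assumes "1 \<le> i" "l dvd J"
  shows "block_shift l J i = i"
proof -
  have "((i - 1) mod l + J) mod l = (i - 1) mod l"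
    using assms(2) by (auto simp: mod_simps elim!: dvdE)
  then show ?thesis using assms(1) by (simp add: block_shift_def)
qed

section \<open>The standard numbering, the shift of boxes and \<open>a_perm\<close>\<close>

locale multi_diagram =
  fixes n :: nat and m l :: "nat \<Rightarrow> nat" and \<mu> :: "nat \<Rightarrow> nat \<Rightarrow> nat"
  assumes n_pos: "1 \<le> n" and l_pos: "\<And>h. h \<in> {1..n} \<Longrightarrow> 0 < l h"
    and mp: "is_multi_partition n l m \<mu>"
begin

abbreviation "B \<equiv> boxes n \<mu>"
abbreviation "S \<equiv> {1..\<Sum>h=1..n. m h}"
abbreviation "t \<equiv> std_numbering n m \<mu>"
abbreviation "L \<equiv> lcm_tuple n l"

lemma part: "h \<in> {1..n} \<Longrightarrow> is_partition (m h) (\<mu> h)"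
  using mp by (auto simp: is_multi_partition_def is_l_partition_def)

lemma \<mu>_mono: "h \<in> {1..n} \<Longrightarrow> 1 \<le> i \<Longrightarrow> i \<le> i' \<Longrightarrow> \<mu> h i' \<le> \<mu> h i"
  by (rule partition_antimono[OF part])

lemma \<mu>_block_eq:
  assumes h: "h \<in> {1..n}" and i: "1 \<le> i" "1 \<le> i'" and eq: "(i - 1) div l h = (i' - 1) div l h"
  shows "\<mu> h i = \<mu> h i'"
proof -
  have lp: "is_l_partition (l h) (m h) (\<mu> h)" using mp h by (auto simp: is_multi_partition_def)
  show ?thesis
    using l_partition_block[OF lp l_pos[OF h] i(1) refl] l_partition_block[OF lp l_pos[OF h] i(2) refl] eq
    by simp
qed

lemma bij_std_numbering: "bij_betw t B S"
proof -
  let ?f = "\<lambda>h. \<lambda>(i, j). (\<Sum>i'=1..<i. \<mu> h i') + j"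
  have row: "bij_betw (?f h) {(i, j). 1 \<le> i \<and> 1 \<le> j \<and> j \<le> \<mu> h i} {1..m h}" if h: "h \<in> {1..n}" for h
  proof -
    obtain R where R: "\<And>i. 1 \<le> i \<Longrightarrow> \<mu> h i \<noteq> 0 \<Longrightarrow> i \<le> R" "(\<Sum>i=1..R. \<mu> h i) = m h"
      using partition_bounded[OF part[OF h]] by auto
    have "{(i, j). 1 \<le> i \<and> 1 \<le> j \<and> j \<le> \<mu> h i} = {(i, j). 1 \<le> i \<and> i \<le> R \<and> 1 \<le> j \<and> j \<le> \<mu> h i}"
      using R(1) by fastforce
    then show ?thesis using bij_betw_concat[of "\<mu> h" R] R(2) by simp
  qed
  let ?g = "\<lambda>(i, j, h). (h, ?f h (i, j))"
  have "bij_betw ?g B {(h, x). 1 \<le> h \<and> h \<le> n \<and> 1 \<le> x \<and> x \<le> m h}"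
    unfolding bij_betw_def
  proof
    show "inj_on ?g B"
    proof (rule inj_onI)
      fix x y assume xy: "x \<in> B" "y \<in> B" "?g x = ?g y"
      obtain i j h where x: "x = (i, j, h)" by (cases x)
      obtain i' j' h' where y: "y = (i', j', h')" by (cases y)
      have hh: "h' = h" "h \<in> {1..n}" using xy x y by (auto simp: boxes_def)
      have "?f h (i, j) = ?f h (i', j')" using xy(3) x y hh by simp
      moreover have "(i, j) \<in> {(i, j). 1 \<le> i \<and> 1 \<le> j \<and> j \<le> \<mu> h i}"
        "(i', j') \<in> {(i, j). 1 \<le> i \<and> 1 \<le> j \<and> j \<le> \<mu> h i}" using xy x y hh by (auto simp: boxes_def)
      ultimately have "(i, j) = (i', j')"
        using bij_betw_imp_inj_on[OF row[OF hh(2)]] by (rule_tac inj_onD)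
      then show "x = y" using x y hh by simp
    qed
    show "?g ` B = {(h, x). 1 \<le> h \<and> h \<le> n \<and> 1 \<le> x \<and> x \<le> m h}"
    proof (intro Set.set_eqI iffI)
      fix y assume "y \<in> ?g ` B"
      then obtain i j h where *: "(i, j, h) \<in> B" "y = (h, ?f h (i, j))" by auto
      then have h: "h \<in> {1..n}" and "(i, j) \<in> {(i, j). 1 \<le> i \<and> 1 \<le> j \<and> j \<le> \<mu> h i}" by (auto simp: boxes_def)
      then have "?f h (i, j) \<in> {1..m h}" using bij_betw_apply[OF row[OF h]] by blast
      then show "y \<in> {(h, x). 1 \<le> h \<and> h \<le> n \<and> 1 \<le> x \<and> x \<le> m h}" using * h by simp
    next
      fix y assume "y \<in> {(h, x). 1 \<le> h \<and> h \<le> n \<and> 1 \<le> x \<and> x \<le> m h}"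
      then obtain h x where *: "y = (h, x)" "h \<in> {1..n}" "x \<in> {1..m h}" by auto
      then have "x \<in> ?f h ` {(i, j). 1 \<le> i \<and> 1 \<le> j \<and> j \<le> \<mu> h i}"
        using bij_betw_imp_surj_on[OF row[OF *(2)]] by simp
      then obtain i j where "1 \<le> i" "1 \<le> j" "j \<le> \<mu> h i" "x = ?f h (i, j)" by auto
      then have "(i, j, h) \<in> B" "y = ?g (i, j, h)" using * by (auto simp: boxes_def)
      then show "y \<in> ?g ` B" by blast
    qed
  qed
  then have "bij_betw ((\<lambda>(i, j). (\<Sum>i'=1..<i. m i') + j) \<circ> ?g) B S"
    by (rule bij_betw_trans[OF _ bij_betw_concat[of m n]])
  then show ?thesis
    by (rule bij_betw_cong[THEN iffD1, rotated]) (auto simp: std_numbering_def)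
qed

lemma fin_B: "finite B" using bij_betw_finite[OF bij_std_numbering] by simp

lemma card_B: "card B = (\<Sum>h=1..n. m h)" using bij_betw_same_card[OF bij_std_numbering] by simp

lemma t_num: "t \<in> numberings n m \<mu>"
  using bij_std_numbering by (simp add: numberings_def std_numbering_def)

definition box_shift :: "box \<Rightarrow> box" where "box_shift = (\<lambda>(i, j, h). (block_shift (l h) 1 i, j, h))"

lemma box_shift_pow:
  assumes "(i, j, h) \<in> B"
  shows "(box_shift ^^ J) (i, j, h) = (block_shift (l h) J i, j, h)"
proof -
  have h: "h \<in> {1..n}" "1 \<le> i" using assms by (auto simp: boxes_def)
  show ?thesis
  proof (induction J)
    case 0
    then show ?case using block_shift_period[OF h(2), of "l h" 0] by simp
  next
    case (Suc J)
    then show ?case using block_shift_add[OF l_pos[OF h(1)], of 1 J i] by (simp add: box_shift_def)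
  qed
qed

lemma block_shift_box:
  assumes "(i, j, h) \<in> B"
  shows "(block_shift (l h) J i, j, h) \<in> B"
proof -
  have h: "h \<in> {1..n}" "1 \<le> i" using assms by (auto simp: boxes_def)
  have "\<mu> h (block_shift (l h) J i) = \<mu> h i"
    using h by (intro \<mu>_block_eq block_shift_pos block_shift_div l_pos)
  then show ?thesis using assms block_shift_pos by (auto simp: boxes_def)
qed

lemma box_shift_pow_B: "b \<in> B \<Longrightarrow> (box_shift ^^ J) b \<in> B"
  by (cases b) (simp add: box_shift_pow block_shift_box)

lemma box_shift_B: "b \<in> B \<Longrightarrow> box_shift b \<in> B"
  using box_shift_pow_B[of b 1] by simp

lemma l_dvd_L: "h \<in> {1..n} \<Longrightarrow> l h dvd L" by (simp add: lcm_tuple_def)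

lemma L_pos: "0 < L"
proof -
  have "0 \<notin> l ` {1..n}" using l_pos by (metis imageE less_not_refl)
  then show ?thesis by (simp add: lcm_tuple_def Lcm_0_iff_nat gr0I) (metis Lcm_0_iff finite_imageI finite_atLeastAtMost not_gr0)
qed

lemma box_shift_period: "b \<in> B \<Longrightarrow> (box_shift ^^ L) b = b"
proof -
  assume b: "b \<in> B"
  obtain i j h where x: "b = (i, j, h)" by (cases b)
  then have "h \<in> {1..n}" "1 \<le> i" using b by (auto simp: boxes_def)
  then show ?thesis using b x block_shift_period[OF _ l_dvd_L] by (simp add: box_shift_pow)
qed

lemma bij_box_shift: "bij_betw (box_shift ^^ J) B B"
proof -
  have "inj_on (box_shift ^^ J) B"
  proof (rule inj_onI)
    fix x y assume xy: "x \<in> B" "y \<in> B" "(box_shift ^^ J) x = (box_shift ^^ J) y"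
    have "(box_shift ^^ (L * k)) b = b" if "b \<in> B" for b k
      using that by (induction k) (auto simp: funpow_add box_shift_period)
    \<comment> \<open>Further L * J - J steps complete the exponent to L * J, where the shift is the
      identity.\<close>
    moreover have "(box_shift ^^ (L * J - J + J)) x = (box_shift ^^ (L * J - J + J)) y"
      unfolding funpow_add using xy(3) by simp
    moreover have "L * J - J + J = L * J" using L_pos by simp
    ultimately show "x = y" using xy by metis
  qed
  moreover have "(box_shift ^^ J) ` B \<subseteq> B" using box_shift_pow_B by auto
  ultimately show ?thesis
    unfolding bij_betw_def using endo_inj_surj[OF fin_B] by blast
qed

text \<open>Among the cycles only the one through the block and column of \<open>b\<close> moves the
  entry of \<open>b\<close> or its image. The product is regrouped into three nested levels
  (components, blocks, columns), and \<open>foldr_comp_single\<close> evaluates each.\<close>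

lemma a_perm_t:
  assumes b: "b \<in> B"
  shows "a_perm n m l \<mu> (t b) = t (box_shift b)"
proof -
  obtain i j h where x: "b = (i, j, h)" by (cases b)
  have h: "h \<in> {1..n}" "1 \<le> i" "1 \<le> j" "j \<le> \<mu> h i" using b x by (auto simp: boxes_def)
  define q where "q = (i - 1) div l h"
  define C where "C h' q' j' = [t (l h' * q' + s, j', h'). s \<leftarrow> [1..<Suc (l h')]]" for h' q' j'
  define cyc where "cyc h' q' j' = cycle_of_list (C h' q' j')" for h' q' j'
  define J where "J h' q' = [1..<Suc (\<mu> h' (l h' * q' + 1))]" for h' q'
  have a: "a_perm n m l \<mu> =
     foldr (\<circ>) (map (\<lambda>h'. foldr (\<circ>) (map (\<lambda>q'. foldr (\<circ>) (map (\<lambda>j'. cyc h' q' j') (J h' q')) id)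
        [0..<m h']) id) [1..<Suc n]) id"
    unfolding a_perm_def foldr_comp_concat map_map comp_def[of "\<lambda>fs. foldr (\<circ>) fs id"]
    by (simp add: cyc_def C_def J_def comp_def del: upt_Suc)
  have boxC: "(l h' * q' + s, j', h') \<in> B"
    if "h' \<in> {1..n}" "j' \<in> set (J h' q')" "s \<in> {1..l h'}" for h' q' j' s
  proof -
    have "\<mu> h' (l h' * q' + s) = \<mu> h' (l h' * q' + 1)"
    proof (rule \<mu>_block_eq[OF that(1)])
      show "(l h' * q' + s - 1) div l h' = (l h' * q' + 1 - 1) div l h'"
        using that by (subst (1 2) block_index_div) auto
    qed (use that in auto)
    then show ?thesis using that by (auto simp: boxes_def J_def)
  qed
  have fixed: "cyc h' q' j' (t b') = t b'"
    if "h' \<in> {1..n}" "j' \<in> set (J h' q')" and b': "b' \<in> B" "b' \<notin> {(l h' * q' + s, j', h') | s. s \<in> {1..l h'}}" for h' q' j' b'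
  proof -
    have "t b' \<notin> set (C h' q' j')"
    proof
      assume "t b' \<in> set (C h' q' j')"
      then obtain s where s: "s \<in> {1..l h'}" "t b' = t (l h' * q' + s, j', h')"
        unfolding C_def set_map set_upt atLeastLessThanSuc_atLeastAtMost by blast
      then have "b' = (l h' * q' + s, j', h')"
        using inj_onD[OF bij_betw_imp_inj_on[OF bij_std_numbering] s(2) b'(1) boxC[OF that(1,2) s(1)]] by simp
      with b' s show False by blast
    qed
    then show ?thesis unfolding cyc_def by (rule id_outside_supp)
  qed
  let ?x = "t b" and ?y = "t (box_shift b)"
  have bsb: "box_shift b = (block_shift (l h) 1 i, j, h)" "box_shift b \<in> B" using box_shift_B[OF b] by (auto simp: x box_shift_def)
  have qx: "(i - 1) div l h = q" "(block_shift (l h) 1 i - 1) div l h = q"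
    using block_shift_div[OF l_pos[OF h(1)]] by (auto simp: q_def)
  have qs: "(l h * q' + s - 1) div l h = q'" if "s \<in> {1..l h}" for q' s
    using that by (intro block_index_div) auto
  \<comment> \<open>Component, block and column determine the cycle through a box, and
    \<open>box_shift\<close> preserves all three.\<close>
  have fixed': "cyc h' q' j' ?x = ?x \<and> cyc h' q' j' ?y = ?y"
    if "h' \<in> {1..n}" "j' \<in> set (J h' q')" "(h', q', j') \<noteq> (h, q, j)" for h' q' j'
  proof (intro conjI fixed that(1,2) b bsb(2))
    show "b \<notin> {(l h' * q' + s, j', h') | s. s \<in> {1..l h'}}" using that(3) qs qx x by auto
    show "box_shift b \<notin> {(l h' * q' + s, j', h') | s. s \<in> {1..l h'}}" using that(3) qs qx bsb(1) by auto
  qed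
  have jJ: "j \<in> set (J h q)"
  proof -
    have "\<mu> h (l h * q + 1) = \<mu> h i" using h l_pos[OF h(1)] by (intro \<mu>_block_eq) (auto simp: q_def)
    then show ?thesis
      unfolding J_def set_upt atLeastLessThanSuc_atLeastAtMost using h by simp
  qed
  have cyc: "cyc h q j ?x = ?y"
  proof -
    let ?k = "(i - 1) mod l h"
    have len: "length (C h q j) = l h" by (simp add: C_def)
    have nth: "C h q j ! k = t (l h * q + (k + 1), j, h)" if "k < l h" for k
      using that by (simp add: C_def nth_upt del: upt_Suc)
    have "inj_on (\<lambda>s. t (l h * q + s, j, h)) (set [1..<Suc (l h)])"
    proof (rule inj_onI)
      fix s s' assume s: "s \<in> set [1..<Suc (l h)]" "s' \<in> set [1..<Suc (l h)]" "t (l h * q + s, j, h) = t (l h * q + s', j, h)"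
      have "s \<in> {1..l h}" "s' \<in> {1..l h}" using s by auto
      then have "(l h * q + s, j, h) = (l h * q + s', j, h)"
        using inj_onD[OF bij_betw_imp_inj_on[OF bij_std_numbering] s(3)] boxC[OF h(1) jJ] by blast
      then show "s = s'" by simp
    qed
    then have dist: "distinct (C h q j)" unfolding C_def by (simp add: distinct_map del: upt_Suc)
    have k: "?k < l h" using l_pos[OF h(1)] by simp
    have "l h * q + ?k = i - 1" unfolding q_def by (rule mult_div_mod_eq)
    then have ik: "l h * q + (?k + 1) = i" using h(2) by linarith
    have "cycle_of_list (C h q j) (C h q j ! ?k) = C h q j ! (Suc ?k mod l h)"
      using cycle_of_list_nth[OF dist, of ?k] len k by simp
    also have "C h q j ! ?k = ?x" using nth[OF k] ik x by simp
    also have "C h q j ! (Suc ?k mod l h) = ?y"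
      using nth[of "Suc ?k mod l h"] l_pos[OF h(1)] bsb(1) by (simp add: block_shift_def q_def)
    finally show ?thesis by (simp add: cyc_def)
  qed
  have 1: "foldr (\<circ>) (map (\<lambda>j'. cyc h q j') (J h q)) id ?x = ?y"
  proof (rule foldr_comp_single[where c = j and F = "\<lambda>j'. cyc h q j'"])
    show "distinct (J h q)" unfolding J_def by (rule distinct_upt)
    fix j' assume "j' \<in> set (J h q)" "j' \<noteq> j"
    then show "cyc h q j' ?x = ?x \<and> cyc h q j' ?y = ?y" by (intro fixed'[OF h(1)]) auto
  qed (rule jJ, rule cyc)
  \<comment> \<open>Rows 1 to \<open>i\<close> are nonempty, so \<open>i\<close> is at most the
    number \<open>m h\<close> of boxes; hence the block index stays below the cutoff in
    \<open>a_perm\<close>.\<close>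
  have qm: "q \<in> set [0..<m h]"
  proof -
    obtain R where R: "\<And>i. 1 \<le> i \<Longrightarrow> \<mu> h i \<noteq> 0 \<Longrightarrow> i \<le> R" "(\<Sum>i=1..R. \<mu> h i) = m h"
      using partition_bounded[OF part[OF h(1)]] by auto
    have "i \<le> R" using R(1)[of i] h by simp
    have "i = (\<Sum>i'=1..i. 1)" by simp
    also have "\<dots> \<le> (\<Sum>i'=1..i. \<mu> h i')"
    proof (rule sum_mono)
      fix i' assume "i' \<in> {1..i}"
      then have "\<mu> h i \<le> \<mu> h i'" using h(1) by (intro \<mu>_mono) auto
      then show "1 \<le> \<mu> h i'" using h by simp
    qed
    also have "\<dots> \<le> (\<Sum>i'=1..R. \<mu> h i')" using \<open>i \<le> R\<close> by (intro sum_mono2) auto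
    finally have "i \<le> m h" using R(2) by simp
    moreover have "q \<le> i - 1" unfolding q_def by simp
    ultimately show ?thesis using h(2) by simp
  qed
  have 2: "foldr (\<circ>) (map (\<lambda>q'. foldr (\<circ>) (map (\<lambda>j'. cyc h q' j') (J h q')) id) [0..<m h]) id ?x = ?y"
  proof (rule foldr_comp_single[where c = q and
      F = "\<lambda>q'. foldr (\<circ>) (map (\<lambda>j'. cyc h q' j') (J h q')) id"])
    fix q' assume "q' \<noteq> q"
    then show "foldr (\<circ>) (map (\<lambda>j'. cyc h q' j') (J h q')) id ?x = ?x \<and>
      foldr (\<circ>) (map (\<lambda>j'. cyc h q' j') (J h q')) id ?y = ?y"
      using fixed'[OF h(1)] by (intro conjI foldr_comp_fixes) auto
  qed (rule distinct_upt, rule qm, rule 1)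
  show ?thesis
    unfolding a
  proof (rule foldr_comp_single[where c = h and
      F = "\<lambda>h'. foldr (\<circ>) (map (\<lambda>q'. foldr (\<circ>) (map (\<lambda>j'. cyc h' q' j') (J h' q')) id) [0..<m h']) id"])
    fix h' assume h': "h' \<in> set [1..<Suc n]" "h' \<noteq> h"
    then have "h' \<in> {1..n}" by auto
    then have in_fixes: "foldr (\<circ>) (map (\<lambda>j'. cyc h' q' j') (J h' q')) id ?x = ?x"
      "foldr (\<circ>) (map (\<lambda>j'. cyc h' q' j') (J h' q')) id ?y = ?y" for q'
      using fixed' h'(2) by (auto intro!: foldr_comp_fixes)
    then show "foldr (\<circ>) (map (\<lambda>q'. foldr (\<circ>) (map (\<lambda>j'. cyc h' q' j') (J h' q')) id) [0..<m h']) id ?x = ?x \<and>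
      foldr (\<circ>) (map (\<lambda>q'. foldr (\<circ>) (map (\<lambda>j'. cyc h' q' j') (J h' q')) id) [0..<m h']) id ?y = ?y"
      by (intro conjI foldr_comp_fixes) auto
  next
    show "h \<in> set [1..<Suc n]" using h(1) by auto
  qed (rule distinct_upt, rule 2)
qed

lemma a_perm_permutes: "a_perm n m l \<mu> permutes S"
  unfolding a_perm_def
proof (rule foldr_comp_permutes, rule ballI)
  fix f assume "f \<in> set [cycle_of_list [t (l h * q + s, j, h). s \<leftarrow> [1..<Suc (l h)]].
          h \<leftarrow> [1..<Suc n], q \<leftarrow> [0..<m h], j \<leftarrow> [1..<Suc (\<mu> h (l h * q + 1))]]"
  then obtain h q j where f: "f = cycle_of_list [t (l h * q + s, j, h). s \<leftarrow> [1..<Suc (l h)]]"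
    and h: "h \<in> {1..n}" and j: "1 \<le> j" "j \<le> \<mu> h (l h * q + 1)"
    by (auto simp: less_Suc_eq_le simp del: upt_Suc)
  have "t (l h * q + s, j, h) \<in> S" if "s \<in> {1..l h}" for s
  proof -
    have "\<mu> h (l h * q + s) = \<mu> h (l h * q + 1)"
    proof (rule \<mu>_block_eq[OF h])
      show "(l h * q + s - 1) div l h = (l h * q + 1 - 1) div l h"
        using that by (subst (1 2) block_index_div) auto
    qed (use that in auto)
    then have "(l h * q + s, j, h) \<in> B" using that h j by (auto simp: boxes_def)
    then show ?thesis using bij_betw_apply[OF bij_std_numbering] by blast
  qed
  then have "set [t (l h * q + s, j, h). s \<leftarrow> [1..<Suc (l h)]] \<subseteq> S"
    by (auto simp: less_Suc_eq_le simp del: upt_Suc)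
  with f show "f permutes S" using cycle_permutes permutes_subset by metis
qed

end

section \<open>Tabloids as row functions\<close>

text \<open>Writing \<open>i - 1 = l * q + d * c + r\<close> with \<open>r < d\<close>, the shift by a multiple of \<open>d\<close> inside the block
  \<open>q\<close> fixes \<open>p = q * d + r\<close> and rotates \<open>c\<close>.\<close>

definition block_code :: "nat \<Rightarrow> nat \<Rightarrow> nat \<Rightarrow> nat \<times> nat" where
  "block_code l d i = ((i - 1) div l * d + (i - 1) mod l mod d, (i - 1) mod l div d)"

definition block_decode :: "nat \<Rightarrow> nat \<Rightarrow> nat \<times> nat \<Rightarrow> nat" where
  "block_decode l d = (\<lambda>(p, c). l * (p div d) + (d * c + p mod d) + 1)"

lemma block_code_decode:
  assumes "l = d * \<gamma>" "0 < d" "c < \<gamma>"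
  shows "block_code l d (block_decode l d (p, c)) = (p, c)"
proof -
  have "p mod d < d" using assms by simp
  then have "d * c + p mod d < d * Suc c" by simp
  also have "\<dots> \<le> l" unfolding assms(1) using assms by (intro mult_le_mono2) simp
  finally have lt: "d * c + p mod d < l" .
  have "block_decode l d (p, c) - 1 = l * (p div d) + (d * c + p mod d)" by (simp add: block_decode_def)
  moreover have "(l * (p div d) + (d * c + p mod d)) div l = p div d"
    using lt by (simp add: div_nat_eqI)
  moreover have "(l * (p div d) + (d * c + p mod d)) mod l = d * c + p mod d"
    using lt by simp
  moreover have "(d * c + p mod d) mod d = p mod d" "(d * c + p mod d) div d = c" using assms(2) by simp_all
  ultimately show ?thesis by (simp add: block_code_def)
qed

lemma block_decode_code:
  assumes "0 < d" "1 \<le> i"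
  shows "block_decode l d (block_code l d i) = i"
proof -
  have "((i - 1) div l * d + (i - 1) mod l mod d) div d = (i - 1) div l"
    using assms by simp
  moreover have "((i - 1) div l * d + (i - 1) mod l mod d) mod d = (i - 1) mod l mod d" by simp
  moreover have "d * ((i - 1) mod l div d) + (i - 1) mod l mod d = (i - 1) mod l" by simp
  moreover have "l * ((i - 1) div l) + (i - 1) mod l = i - 1" by (rule mult_div_mod_eq)
  ultimately show ?thesis using assms(2) by (simp only: block_code_def block_decode_def prod.case) linarith
qed

lemma block_decode_div:
  assumes "l = d * \<gamma>" "0 < d" "c < \<gamma>"
  shows "(block_decode l d (p, c) - 1) div l = p div d"
proof -
  have "fst (block_code l d (block_decode l d (p, c))) div d = p div d"
    using block_code_decode[OF assms] by simp
  then show ?thesis using assms(2) by (simp add: block_code_def)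
qed

lemma snd_block_code_less:
  assumes "l = d * \<gamma>" "0 < l"
  shows "snd (block_code l d i) < \<gamma>"
proof -
  have "(i - 1) mod l < d * \<gamma>" using assms by (metis mod_less_divisor)
  then show ?thesis by (simp add: block_code_def less_mult_imp_div_less mult.commute)
qed

lemma block_code_shift:
  assumes "l = d * \<gamma>" "0 < l" "d dvd J"
  shows "block_code l d (block_shift l J i) =
    (fst (block_code l d i), (snd (block_code l d i) + J div d) mod \<gamma>)"
proof -
  have d: "0 < d" using assms by (cases d) auto
  define s where "s = (i - 1) mod l"
  have eq: "(s + J) mod l = d * ((s + J) div d mod \<gamma>) + (s + J) mod d"
    unfolding assms(1) by (rule mod_mult2_eq)
  have "(s + J) mod d = s mod d" using assms(3) by (auto elim!: dvdE)
  moreover have "(s + J) div d = s div d + J div d" using assms(3) by (rule div_plus_div_distrib_dvd_right)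
  ultimately have "(s + J) mod l mod d = s mod d" "(s + J) mod l div d = (s div d + J div d) mod \<gamma>"
    unfolding eq using d by simp_all
  then show ?thesis
    unfolding block_code_def block_shift_div[OF assms(2)] block_shift_mod[OF assms(2)] s_def[symmetric]
    by simp
qed

context multi_diagram
begin

abbreviation "Num \<equiv> numberings n m \<mu>"
abbreviation "tab \<equiv> tabloid_of n m \<mu>"

definition row_fun :: "(box \<Rightarrow> nat) \<Rightarrow> nat \<Rightarrow> nat \<times> nat" where
  "row_fun T = (\<lambda>x\<in>S. case inv_into B T x of (i, j, h) \<Rightarrow> (i, h))"

definition row_shift :: "nat \<Rightarrow> nat \<times> nat \<Rightarrow> nat \<times> nat" where
  "row_shift J = (\<lambda>(i, h). (block_shift (l h) J i, h))"

definition "Rows = {(i, h). h \<in> {1..n} \<and> 1 \<le> i \<and> 0 < \<mu> h i}"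

lemma Num_bij: "T \<in> Num \<Longrightarrow> bij_betw T B S"
  by (simp add: numberings_def)

lemma Num_S: "T \<in> Num \<Longrightarrow> b \<in> B \<Longrightarrow> T b \<in> S"
  by (rule bij_betw_apply[OF Num_bij])

lemma Num_surj:
  assumes "T \<in> Num" "x \<in> S" obtains i j h where "(i, j, h) \<in> B" "x = T (i, j, h)"
proof -
  have "x \<in> T ` B" using bij_betw_imp_surj_on[OF Num_bij[OF assms(1)]] assms(2) by simp
  then obtain b where "b \<in> B" "x = T b" by blast
  then show ?thesis using that by (cases b) blast
qed

lemma row_fun_apply: "T \<in> Num \<Longrightarrow> (i, j, h) \<in> B \<Longrightarrow> row_fun T (T (i, j, h)) = (i, h)"
  using Num_S[of T "(i, j, h)"] inv_into_f_f[OF bij_betw_imp_inj_on[OF Num_bij], of T "(i, j, h)"]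
  by (simp add: row_fun_def)

lemma row_fun_ext: "row_fun T \<in> extensional S" by (simp add: row_fun_def)

lemma row_fun_eqI:
  assumes "T \<in> Num" "f \<in> extensional S" "\<And>i j h. (i, j, h) \<in> B \<Longrightarrow> f (T (i, j, h)) = (i, h)"
  shows "row_fun T = f"
proof (rule extensionalityI[OF row_fun_ext assms(2)])
  fix x assume "x \<in> S"
  then obtain i j h where "(i, j, h) \<in> B" "x = T (i, j, h)" by (rule Num_surj[OF assms(1)])
  then show "row_fun T x = f x" using row_fun_apply[OF assms(1)] assms(3) by simp
qed

lemma row_fun_Rows:
  assumes "T \<in> Num" "x \<in> S"
  shows "row_fun T x \<in> Rows"
proof -
  obtain i j h where b: "(i, j, h) \<in> B" "x = T (i, j, h)" by (rule Num_surj[OF assms])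
  then have "row_fun T x = (i, h)" using row_fun_apply[OF assms(1)] by simp
  then show ?thesis using b(1) by (simp add: Rows_def boxes_def)
qed

lemma row_image:
  assumes T: "T \<in> Num" and h: "h \<in> {1..n}" "1 \<le> i"
  shows "(\<lambda>j. T (i, j, h)) ` {1..\<mu> h i} = {x \<in> S. row_fun T x = (i, h)}"
proof (intro Set.set_eqI iffI)
  fix x assume "x \<in> (\<lambda>j. T (i, j, h)) ` {1..\<mu> h i}"
  then obtain j where "x = T (i, j, h)" "(i, j, h) \<in> B" using h by (auto simp: boxes_def)
  then show "x \<in> {x \<in> S. row_fun T x = (i, h)}" using row_fun_apply[OF T] Num_S[OF T] by simp
next
  fix x assume x: "x \<in> {x \<in> S. row_fun T x = (i, h)}"
  then obtain i' j h' where b: "(i', j, h') \<in> B" "x = T (i', j, h')" using Num_surj[OF T] by blast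
  then have "i' = i" "h' = h" using x row_fun_apply[OF T b(1)] by auto
  then show "x \<in> (\<lambda>j. T (i, j, h)) ` {1..\<mu> h i}" using b by (auto simp: boxes_def)
qed

lemma card_row_fun_fibre:
  assumes "T \<in> Num" "h \<in> {1..n}" "1 \<le> i"
  shows "card {x \<in> S. row_fun T x = (i, h)} = \<mu> h i"
proof -
  have "inj_on (\<lambda>j. T (i, j, h)) {1..\<mu> h i}"
  proof (rule inj_onI)
    fix j j' assume "j \<in> {1..\<mu> h i}" "j' \<in> {1..\<mu> h i}" "T (i, j, h) = T (i, j', h)"
    moreover from this have "(i, j, h) \<in> B" "(i, j', h) \<in> B" using assms by (auto simp: boxes_def)
    ultimately show "j = j'" using inj_onD[OF bij_betw_imp_inj_on[OF Num_bij[OF assms(1)]]] by blast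
  qed
  then show ?thesis using card_image row_image[OF assms] by fastforce
qed

lemma row_equiv_iff: "(T, T') \<in> row_equiv n m \<mu> \<longleftrightarrow> T \<in> Num \<and> T' \<in> Num \<and> row_fun T = row_fun T'"
proof
  assume *: "(T, T') \<in> row_equiv n m \<mu>"
  then have T: "T \<in> Num" "T' \<in> Num"
    and rows: "\<And>h i. h \<in> {1..n} \<Longrightarrow> 1 \<le> i \<Longrightarrow> (\<lambda>j. T (i, j, h)) ` {1..\<mu> h i} = (\<lambda>j. T' (i, j, h)) ` {1..\<mu> h i}"
    by (auto simp: row_equiv_def)
  have "row_fun T = row_fun T'"
  proof (rule row_fun_eqI[OF T(1) row_fun_ext])
    fix i j h assume b: "(i, j, h) \<in> B"
    then have h: "h \<in> {1..n}" "1 \<le> i" by (auto simp: boxes_def)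
    have "T (i, j, h) \<in> {x \<in> S. row_fun T x = (i, h)}" using row_fun_apply[OF T(1) b] Num_S[OF T(1) b] by simp
    then have "T (i, j, h) \<in> {x \<in> S. row_fun T' x = (i, h)}"
      unfolding row_image[OF T(1) h, symmetric] rows[OF h] row_image[OF T(2) h] .
    then show "row_fun T' (T (i, j, h)) = (i, h)" by simp
  qed
  with T show "T \<in> Num \<and> T' \<in> Num \<and> row_fun T = row_fun T'" by simp
next
  assume "T \<in> Num \<and> T' \<in> Num \<and> row_fun T = row_fun T'"
  then show "(T, T') \<in> row_equiv n m \<mu>"
    using row_image[of T] row_image[of T'] by (auto simp: row_equiv_def)
qed

lemma tab_eq: "T \<in> Num \<Longrightarrow> tab T = {T' \<in> Num. row_fun T' = row_fun T}"
  by (auto simp: tabloid_of_def row_equiv_iff)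

lemma tab_eq_iff: "T \<in> Num \<Longrightarrow> T' \<in> Num \<Longrightarrow> tab T = tab T' \<longleftrightarrow> row_fun T = row_fun T'"
  by (auto simp: tab_eq)

lemma tabloids_eq: "tabloids n m \<mu> = tab ` Num"
  by (auto simp: tabloids_def quotient_def tabloid_of_def)

lemma finite_tabloids: "finite (tabloids n m \<mu>)"
proof -
  have "Num \<subseteq> B \<rightarrow>\<^sub>E S" by (auto simp: numberings_def PiE_def dest: bij_betw_apply)
  then show ?thesis unfolding tabloids_eq using finite_PiE[OF fin_B, of "\<lambda>_. S"]
    by (intro finite_imageI) (auto intro: finite_subset)
qed

section \<open>The action on numbers and the shift of boxes, seen on row functions\<close>

lemma Num_perm:
  assumes "\<sigma> permutes S" "T \<in> Num"
  shows "compose B \<sigma> T \<in> Num"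
proof -
  have "bij_betw (\<sigma> \<circ> T) B S"
    using bij_betw_trans[OF Num_bij[OF assms(2)] permutes_imp_bij[OF assms(1)]] .
  then have "bij_betw (compose B \<sigma> T) B S"
    by (rule bij_betw_cong[THEN iffD1, rotated]) (simp add: compose_def)
  then show ?thesis by (simp add: numberings_def)
qed

lemma Num_shift:
  assumes "T \<in> Num"
  shows "compose B T (box_shift ^^ J) \<in> Num"
proof -
  have "bij_betw (T \<circ> (box_shift ^^ J)) B S"
    using bij_betw_trans[OF bij_box_shift Num_bij[OF assms]] .
  then have "bij_betw (compose B T (box_shift ^^ J)) B S"
    by (rule bij_betw_cong[THEN iffD1, rotated]) (simp add: compose_def)
  then show ?thesis by (simp add: numberings_def)
qed

text \<open>The inverse appears because \<open>x\<close> occupies in the new numbering the box that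
  held the preimage of \<open>x\<close> in \<open>T\<close>.\<close>

lemma row_fun_perm:
  assumes "\<sigma> permutes S" "T \<in> Num"
  shows "row_fun (compose B \<sigma> T) = (\<lambda>x\<in>S. row_fun T (inv_into UNIV \<sigma> x))"
proof (rule row_fun_eqI[OF Num_perm[OF assms]])
  fix i j h assume b: "(i, j, h) \<in> B"
  then have "\<sigma> (T (i, j, h)) \<in> S" using Num_S[OF assms(2)] permutes_in_image[OF assms(1)] by blast
  then show "(\<lambda>x\<in>S. row_fun T (inv_into UNIV \<sigma> x)) (compose B \<sigma> T (i, j, h)) = (i, h)"
    using b row_fun_apply[OF assms(2) b] by (simp add: compose_def permutes_inverses(2)[OF assms(1)])
qed simp

lemma row_shift_inj:
  assumes "r \<in> Rows" "r' \<in> Rows" "row_shift J r = row_shift J r'"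
  shows "r = r'"
proof -
  obtain i h i' where r: "r = (i, h)" "r' = (i', h)" and h: "h \<in> {1..n}" "1 \<le> i" "1 \<le> i'"
    and eq: "block_shift (l h) J i = block_shift (l h) J i'"
    using assms by (auto simp: Rows_def row_shift_def)
  \<comment> \<open>As for boxes, the shift is completed to a multiple of its period.\<close>
  have "block_shift (l h) (l h * J - J + J) i = block_shift (l h) (l h * J - J + J) i'"
    using eq block_shift_add[OF l_pos[OF h(1)], of "l h * J - J" J] by metis
  moreover have "l h * J - J + J = l h * J" using l_pos[OF h(1)] by simp
  ultimately show ?thesis
    using r block_shift_period[OF h(2), of "l h"] block_shift_period[OF h(3), of "l h"] by simp
qed

text \<open>Precomposition puts into a box the entry that \<open>T\<close> has in the shifted box,
  so entries move against the shift. This is why \<open>row_shift\<close> stands on the side of the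
  new numbering.\<close>

lemma row_fun_shift:
  assumes "T \<in> Num" "x \<in> S"
  shows "row_shift J (row_fun (compose B T (box_shift ^^ J)) x) = row_fun T x"
proof -
  obtain i j h where b: "(i, j, h) \<in> B" "x = compose B T (box_shift ^^ J) (i, j, h)"
    using Num_surj[OF Num_shift[OF assms(1)] assms(2)] by metis
  have "row_fun T x = (block_shift (l h) J i, h)"
    using b row_fun_apply[OF assms(1) block_shift_box[OF b(1)]] by (simp add: compose_def box_shift_pow)
  moreover have "row_fun (compose B T (box_shift ^^ J)) x = (i, h)"
    using b row_fun_apply[OF Num_shift[OF assms(1)] b(1)] by simp
  ultimately show ?thesis by (simp add: row_shift_def)
qed

text \<open>\<open>tabloid_act\<close> is the image of a whole class, so it must also be shown that
  the image fills the new class; preimages come from the inverse of \<sigma>.\<close>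

lemma act_tab:
  assumes \<sigma>: "\<sigma> permutes S" and T: "T \<in> Num"
  shows "tabloid_act n \<mu> \<sigma> (tab T) = tab (compose B \<sigma> T)"
proof (intro Set.set_eqI iffI)
  fix U assume "U \<in> tabloid_act n \<mu> \<sigma> (tab T)"
  then obtain T' where "T' \<in> Num" "row_fun T' = row_fun T" "U = compose B \<sigma> T'"
    by (auto simp: tabloid_act_def tab_eq[OF T])
  then show "U \<in> tab (compose B \<sigma> T)"
    using \<sigma> T by (simp add: tab_eq Num_perm row_fun_perm)
next
  fix U assume "U \<in> tab (compose B \<sigma> T)"
  then have U: "U \<in> Num" "row_fun U = row_fun (compose B \<sigma> T)" using \<sigma> T by (auto simp: tab_eq Num_perm)
  have inv: "inv_into UNIV \<sigma> permutes S" using permutes_inv[OF \<sigma>] .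
  let ?T' = "compose B (inv_into UNIV \<sigma>) U"
  have "row_fun ?T' = (\<lambda>x\<in>S. row_fun U (\<sigma> x))"
    using row_fun_perm[OF inv U(1)] permutes_inv_inv[OF \<sigma>] by simp
  also have "\<dots> = row_fun T"
  proof (rule extensionalityI[OF _ row_fun_ext])
    fix x assume x: "x \<in> S"
    then have "\<sigma> x \<in> S" using permutes_in_image[OF \<sigma>] by simp
    then show "(\<lambda>x\<in>S. row_fun U (\<sigma> x)) x = row_fun T x"
      using x U(2) row_fun_perm[OF \<sigma> T] permutes_inverses(2)[OF \<sigma>] by simp
  qed simp
  finally have mem: "?T' \<in> tab T" using Num_perm[OF inv U(1)] by (simp add: tab_eq[OF T])
  have eq: "compose B \<sigma> ?T' = U"
  proof (rule extensionalityI[of _ B])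
    show "U \<in> extensional B" using U by (simp add: numberings_def)
    fix b assume "b \<in> B"
    then show "compose B \<sigma> ?T' b = U b" by (simp add: compose_def permutes_inverses(1)[OF \<sigma>])
  qed simp
  show "U \<in> tabloid_act n \<mu> \<sigma> (tab T)"
    unfolding tabloid_act_def by (rule image_eqI[where x = ?T'], rule eq[symmetric], rule mem)
qed

text \<open>Boxes are moved by precomposition, whereas \<open>tabloid_act\<close> composes after the
  numbering; the two operations commute for this reason alone.\<close>

definition shift :: "(box \<Rightarrow> nat) set \<Rightarrow> (box \<Rightarrow> nat) set" where
  "shift X = (\<lambda>T. compose B T box_shift) ` X"

lemma shift_tab:
  assumes T: "T \<in> Num"
  shows "shift (tab T) = tab (compose B T box_shift)"
proof -
  have Num1: "compose B T' box_shift \<in> Num" if "T' \<in> Num" for T' using Num_shift[OF that, of 1] by simp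
  have rf1: "row_shift 1 (row_fun (compose B T' box_shift) x) = row_fun T' x" if "T' \<in> Num" "x \<in> S" for T' x
    using row_fun_shift[OF that, of 1] by simp
  show ?thesis
  proof (intro Set.set_eqI iffI)
    fix U assume "U \<in> shift (tab T)"
    then obtain T' where T': "T' \<in> Num" "row_fun T' = row_fun T" "U = compose B T' box_shift"
      by (auto simp: shift_def tab_eq[OF T])
    have "row_fun (compose B T' box_shift) = row_fun (compose B T box_shift)"
    proof (rule extensionalityI[OF row_fun_ext row_fun_ext])
      fix x assume x: "x \<in> S"
      have "row_shift 1 (row_fun (compose B T' box_shift) x) = row_shift 1 (row_fun (compose B T box_shift) x)"
        unfolding rf1[OF T'(1) x] rf1[OF T x] T'(2) ..
      then show "row_fun (compose B T' box_shift) x = row_fun (compose B T box_shift) x"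
        by (rule row_shift_inj[OF row_fun_Rows[OF Num1[OF T'(1)] x] row_fun_Rows[OF Num1[OF T] x]])
    qed
    then show "U \<in> tab (compose B T box_shift)" using T' T by (simp add: tab_eq Num1)
  next
    fix U assume "U \<in> tab (compose B T box_shift)"
    then have U: "U \<in> Num" "row_fun U = row_fun (compose B T box_shift)" using T by (auto simp: tab_eq Num1)
    have bij: "bij_betw box_shift B B" using bij_box_shift[of 1] by simp
    let ?T' = "compose B U (inv_into B box_shift)"
    have "bij_betw (U \<circ> inv_into B box_shift) B S"
      using bij_betw_trans[OF bij_betw_inv_into[OF bij] Num_bij[OF U(1)]] .
    then have "bij_betw ?T' B S"
      by (rule bij_betw_cong[THEN iffD1, rotated]) (simp add: compose_def)
    then have T': "?T' \<in> Num" by (simp add: numberings_def)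
    have eq: "compose B ?T' box_shift = U"
    proof (rule extensionalityI[of _ B])
      show "U \<in> extensional B" using U by (simp add: numberings_def)
      fix b assume "b \<in> B"
      then show "compose B ?T' box_shift b = U b"
        using box_shift_B inv_into_f_f[OF bij_betw_imp_inj_on[OF bij]] by (simp add: compose_def)
    qed simp
    have "row_fun ?T' = row_fun T"
    proof (rule extensionalityI[OF row_fun_ext row_fun_ext])
      fix x assume x: "x \<in> S"
      show "row_fun ?T' x = row_fun T x" using rf1[OF T' x] rf1[OF T x] eq U(2) by simp
    qed
    then have mem: "?T' \<in> tab T" using T' by (simp add: tab_eq[OF T])
    show "U \<in> shift (tab T)" unfolding shift_def by (rule image_eqI[where x = ?T'], rule eq[symmetric], rule mem)
  qed
qed

lemma compose_funpow_Suc: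
  assumes "T \<in> Num"
  shows "compose B (compose B T (box_shift ^^ i)) box_shift = compose B T (box_shift ^^ Suc i)"
  using box_shift_B by (auto simp: compose_def fun_eq_iff funpow_swap1)

lemma shift_pow_tab:
  assumes T: "T \<in> Num"
  shows "(shift ^^ i) (tab T) = tab (compose B T (box_shift ^^ i))"
proof (induction i)
  case 0
  have "compose B T (box_shift ^^ 0) = T"
    using T by (intro extensionalityI[of _ B]) (auto simp: numberings_def compose_def)
  then show ?case using funpow_0[of shift "tab T"] by metis
next
  case (Suc i)
  have "(shift ^^ Suc i) (tab T) = shift ((shift ^^ i) (tab T))" by simp
  also have "\<dots> = tab (compose B T (box_shift ^^ Suc i))"
    unfolding Suc.IH shift_tab[OF Num_shift[OF T]] compose_funpow_Suc[OF T] ..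
  finally show ?case .
qed

lemma shift_period:
  assumes "X \<in> tabloids n m \<mu>"
  shows "(shift ^^ L) X = X"
proof -
  obtain T where T: "T \<in> Num" "X = tab T" using assms tabloids_eq by auto
  have "compose B T (box_shift ^^ L) = T"
    using T by (intro extensionalityI[of _ B]) (auto simp: numberings_def compose_def box_shift_period)
  then show ?thesis using shift_pow_tab[OF T(1)] T by simp
qed

lemma shift_comm:
  "tabloid_act n \<mu> \<sigma> (shift X) = shift (tabloid_act n \<mu> \<sigma> X)"
proof -
  have "compose B \<sigma> (compose B T box_shift) = compose B (compose B \<sigma> T) box_shift" for T :: "box \<Rightarrow> nat"
    using box_shift_B by (auto simp: compose_def fun_eq_iff)
  then show ?thesis by (simp add: tabloid_act_def shift_def image_image)
qed

text \<open>The generators of \<open>I_tilde\<close> involve every power of \<open>a_perm\<close>.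
  The induction works because \<open>a_perm_t\<close> holds at all boxes, including those already
  shifted.\<close>

lemma a_perm_pow_t:
  "tabloid_act n \<mu> (a_perm n m l \<mu> ^^ i) (tab t) = (shift ^^ i) (tab t)"
proof -
  have *: "(a_perm n m l \<mu> ^^ i) (t b) = t ((box_shift ^^ i) b)" if "b \<in> B" for b
    using that by (induction i) (auto simp: a_perm_t box_shift_pow_B)
  have "compose B (a_perm n m l \<mu> ^^ i) t = compose B t (box_shift ^^ i)"
    using * by (auto simp: compose_def fun_eq_iff)
  then show ?thesis
    using act_tab[OF permutes_funpow[OF a_perm_permutes] t_num] shift_pow_tab[OF t_num] by simp
qed

lemma tabloid_transitive:
  assumes "X \<in> tabloids n m \<mu>"
  shows "\<exists>\<sigma>. \<sigma> permutes S \<and> tabloid_act n \<mu> \<sigma> (tab t) = X"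
proof -
  obtain T where T: "T \<in> Num" "X = tab T" using assms tabloids_eq by auto
  define \<sigma> where "\<sigma> x = (if x \<in> S then T (inv_into B t x) else x)" for x
  have "bij_betw (T \<circ> inv_into B t) S S"
    using bij_betw_trans[OF bij_betw_inv_into[OF bij_std_numbering] Num_bij[OF T(1)]] .
  then have "bij_betw \<sigma> S S"
    by (rule bij_betw_cong[THEN iffD1, rotated]) (simp add: \<sigma>_def)
  then have \<sigma>: "\<sigma> permutes S" by (rule bij_imp_permutes) (simp only: \<sigma>_def if_False)
  have "compose B \<sigma> t = T"
  proof (rule extensionalityI[of _ B])
    show "T \<in> extensional B" using T by (simp add: numberings_def)
    fix b assume b: "b \<in> B"
    then show "compose B \<sigma> t b = T b"
      using Num_S[OF t_num b] inv_into_f_f[OF bij_betw_imp_inj_on[OF bij_std_numbering] b]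
      by (simp add: compose_def \<sigma>_def)
  qed simp
  then show ?thesis using act_tab[OF \<sigma> t_num] \<sigma> T by auto
qed

section \<open>Characters as counts of tabloids fixed by twisted actions\<close>

lemma Char_M_eq:
  assumes \<sigma>: "\<sigma> permutes S"
  shows "Char_M n m l \<mu> k \<sigma> = (\<Sum>i<L. inverse (zeta L ^ k) ^ i *
     of_nat (card {X \<in> tabloids n m \<mu>. tabloid_act n \<mu> \<sigma> ((shift ^^ i) X) = X})) / of_nat L"
proof -
  let ?X = "tabloids n m \<mu>"
  let ?G = "{tabloid_act n \<mu> \<sigma> | \<sigma>. \<sigma> permutes S}"
  interpret cyclic_quotient ?X "tab t" L shift "zeta L ^ k" ?G
  proof
    show "finite ?X" by (rule finite_tabloids)
    show "tab t \<in> ?X" using t_num tabloids_eq by simp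
    show "0 < L" by (rule L_pos)
    have "zeta L powi int L = 1" by (subst zeta_power_eq_1_iff[OF L_pos]) simp
    then have "(zeta L ^ L) ^ k = 1" by simp
    then show "(zeta L ^ k) ^ L = 1" by (simp only: power_mult[symmetric] mult.commute)
    show "g x \<in> ?X" if "g \<in> ?G" "x \<in> ?X" for g x
      using that by (auto simp: tabloids_eq act_tab Num_perm)
    show "shift x \<in> ?X" if "x \<in> ?X" for x
      using that Num_shift[of _ 1] by (auto simp: tabloids_eq shift_tab)
    show "g (shift x) = shift (g x)" if "g \<in> ?G" "x \<in> ?X" for g x
      using that shift_comm by auto
    show "(shift ^^ L) x = x" if "x \<in> ?X" for x by (rule shift_period[OF that])
    show "\<exists>g\<in>?G. g (tab t) = x" if "x \<in> ?X" for x using tabloid_transitive[OF that] by blast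
  qed
  have perm: "perm_act n m \<mu> \<sigma> = lin_ext ?X (tabloid_act n \<mu> \<sigma>)" for \<sigma>
    by (simp add: perm_act_def lin_ext_def fun_eq_iff)
  \<comment> \<open>Once powers of \<open>a_perm\<close> at the standard tabloid are written as
    powers of \<open>shift\<close>, both sides are intersections of the same family of
    submodules.\<close>
  have "I_tilde n m l \<mu> k = W"
    unfolding I_tilde_def Let_def W_def generated_submodule_def perm perm_module_def a_perm_pow_t power_mult
    by (rule arg_cong[of _ _ Inter]) blast
  then show ?thesis
    unfolding Char_M_def M_quot_def perm_module_def perm
    using lin_trace_cyclic_quotient[of "tabloid_act n \<mu> \<sigma>"] \<sigma> by auto
qed

lemma sum_Char_M:
  assumes \<sigma>: "\<sigma> permutes S" and J: "J = nat (j mod int L)"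
  shows "(\<Sum>k<L. zeta L powi (j * int k) * Char_M n m l \<mu> k \<sigma>) =
    of_nat (card {X \<in> tabloids n m \<mu>. tabloid_act n \<mu> \<sigma> ((shift ^^ J) X) = X})"
proof -
  define c where "c i = (of_nat (card {X \<in> tabloids n m \<mu>. tabloid_act n \<mu> \<sigma> ((shift ^^ i) X) = X}) :: complex)" for i
  have L0: "int L > 0" using L_pos by simp
  have J': "int J = j mod int L" "J < L" using J L0 by (auto simp: nat_less_iff)
  have "(\<Sum>k<L. zeta L powi (j * int k) * Char_M n m l \<mu> k \<sigma>)
      = (\<Sum>k<L. \<Sum>i<L. (zeta L powi (j * int k) * inverse (zeta L ^ k) ^ i) * (c i / of_nat L))"
    unfolding Char_M_eq[OF \<sigma>] c_def[symmetric] by (simp add: sum_distrib_left sum_divide_distrib mult.assoc)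
  also have "\<dots> = (\<Sum>i<L. (\<Sum>k<L. zeta L powi (j * int k) * inverse (zeta L ^ k) ^ i) * (c i / of_nat L))"
    unfolding sum_distrib_right by (rule sum.swap)
  \<comment> \<open>Orthogonality keeps only the i below \<open>L\<close> congruent to
    \<open>j\<close>, which is \<open>J\<close>.\<close>
  also have "\<dots> = (\<Sum>i<L. if i = J then c i else 0)"
  proof (rule sum.cong[OF refl])
    fix i assume "i \<in> {..<L}"
    then have "int L dvd j - int i \<longleftrightarrow> int i = j mod int L"
      by (metis L0 J'(1) lessThan_iff mod_eq_dvd_iff mod_less of_nat_mod)
    then have "int L dvd j - int i \<longleftrightarrow> i = J" using J' by auto
    then show "(\<Sum>k<L. zeta L powi (j * int k) * inverse (zeta L ^ k) ^ i) * (c i / of_nat L) = (if i = J then c i else 0)"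
      unfolding sum_zeta_powers[OF L_pos] using L_pos by simp
  qed
  also have "\<dots> = c J" using J' by simp
  finally show ?thesis by (simp add: c_def)
qed

end

section \<open>Fixed tabloids and the theorem\<close>

context multi_diagram
begin

text \<open>Being fixed first reads as an identity for the shifted numbering. Applying the injective
  map \<open>row_shift J\<close> to both sides moves the shift over to \<open>T\<close>.\<close>

lemma fixed_tabloid_iff:
  assumes \<sigma>: "\<sigma> permutes S" and T: "T \<in> Num"
  shows "tabloid_act n \<mu> \<sigma> ((shift ^^ J) (tab T)) = tab T \<longleftrightarrow>
    (\<forall>x\<in>S. row_fun T (inv_into UNIV \<sigma> x) = row_shift J (row_fun T x))"
proof -
  let ?U = "compose B T (box_shift ^^ J)"
  note U = Num_shift[OF T, of J]
  have inv: "inv_into UNIV \<sigma> x \<in> S" if "x \<in> S" for x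
    using permutes_in_image[OF permutes_inv[OF \<sigma>]] that by blast
  have "tabloid_act n \<mu> \<sigma> ((shift ^^ J) (tab T)) = tab T \<longleftrightarrow> (\<lambda>x\<in>S. row_fun ?U (inv_into UNIV \<sigma> x)) = row_fun T"
    unfolding shift_pow_tab[OF T] act_tab[OF \<sigma> U] tab_eq_iff[OF Num_perm[OF \<sigma> U] T] row_fun_perm[OF \<sigma> U] ..
  also have "\<dots> \<longleftrightarrow> (\<forall>x\<in>S. row_fun ?U (inv_into UNIV \<sigma> x) = row_fun T x)"
  proof
    assume eq: "(\<lambda>x\<in>S. row_fun ?U (inv_into UNIV \<sigma> x)) = row_fun T"
    show "\<forall>x\<in>S. row_fun ?U (inv_into UNIV \<sigma> x) = row_fun T x"
    proof
      fix x assume x: "x \<in> S"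
      show "row_fun ?U (inv_into UNIV \<sigma> x) = row_fun T x" using fun_cong[OF eq, of x] unfolding restrict_apply'[OF x] .
    qed
  next
    assume "\<forall>x\<in>S. row_fun ?U (inv_into UNIV \<sigma> x) = row_fun T x"
    then show "(\<lambda>x\<in>S. row_fun ?U (inv_into UNIV \<sigma> x)) = row_fun T"
      by (intro extensionalityI[OF restrict_extensional row_fun_ext]) simp
  qed
  also have "\<dots> \<longleftrightarrow> (\<forall>x\<in>S. row_fun T (inv_into UNIV \<sigma> x) = row_shift J (row_fun T x))"
  proof (rule ball_cong[OF refl])
    fix x assume x: "x \<in> S"
    show "row_fun ?U (inv_into UNIV \<sigma> x) = row_fun T x \<longleftrightarrow> row_fun T (inv_into UNIV \<sigma> x) = row_shift J (row_fun T x)"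
    proof
      assume "row_fun ?U (inv_into UNIV \<sigma> x) = row_fun T x"
      then show "row_fun T (inv_into UNIV \<sigma> x) = row_shift J (row_fun T x)" using row_fun_shift[OF T inv[OF x], of J] by metis
    next
      assume "row_fun T (inv_into UNIV \<sigma> x) = row_shift J (row_fun T x)"
      then have "row_shift J (row_fun ?U (inv_into UNIV \<sigma> x)) = row_shift J (row_fun T x)" using row_fun_shift[OF T inv[OF x], of J] by metis
      then show "row_fun ?U (inv_into UNIV \<sigma> x) = row_fun T x"
        by (rule row_shift_inj[OF row_fun_Rows[OF U inv[OF x]] row_fun_Rows[OF T x]])
    qed
  qed
  finally show ?thesis .
qed

text \<open>The numbers of each fibre are written into their row in an arbitrary order.\<close>

lemma row_fun_surj:
  assumes f: "f \<in> S \<rightarrow>\<^sub>E Rows"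
    and card: "\<And>i h. (i, h) \<in> Rows \<Longrightarrow> card {x \<in> S. f x = (i, h)} = \<mu> h i"
  obtains T where "T \<in> Num" "row_fun T = f"
proof -
  have "\<forall>r\<in>Rows. \<exists>g. bij_betw g {1..\<mu> (snd r) (fst r)} {x \<in> S. f x = r}"
  proof
    fix r assume r: "r \<in> Rows"
    have "finite {x \<in> S. f x = r}" by simp
    then obtain g where "bij_betw g {1..card {x \<in> S. f x = r}} {x \<in> S. f x = r}"
      using ex_bij_betw_nat_finite_1 by blast
    moreover have "card {x \<in> S. f x = r} = \<mu> (snd r) (fst r)"
      using card[of "fst r" "snd r"] r by (simp only: prod.collapse)
    ultimately show "\<exists>g. bij_betw g {1..\<mu> (snd r) (fst r)} {x \<in> S. f x = r}" by auto
  qed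
  then obtain g where g: "\<And>r. r \<in> Rows \<Longrightarrow> bij_betw (g r) {1..\<mu> (snd r) (fst r)} {x \<in> S. f x = r}"
    by metis
  define T where "T = (\<lambda>(i, j, h)\<in>B. g (i, h) j)"
  have row: "(i, h) \<in> Rows" "j \<in> {1..\<mu> h i}" if "(i, j, h) \<in> B" for i j h
    using that by (auto simp: boxes_def Rows_def)
  have T: "T (i, j, h) = g (i, h) j" if "(i, j, h) \<in> B" for i j h using that by (simp add: T_def)
  have Tf: "T (i, j, h) \<in> S \<and> f (T (i, j, h)) = (i, h)" if "(i, j, h) \<in> B" for i j h
    using bij_betw_apply[OF g[OF row(1)[OF that]], of j] row(2)[OF that] T[OF that] by simp
  have "inj_on T B"
  proof (rule inj_onI)
    fix b b' assume b: "b \<in> B" "b' \<in> B" "T b = T b'"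
    obtain i j h where x: "b = (i, j, h)" by (cases b)
    obtain i' j' h' where y: "b' = (i', j', h')" by (cases b')
    have ih: "i' = i" "h' = h" using Tf[of i j h] Tf[of i' j' h'] b x y by auto
    then have "g (i, h) j = g (i, h) j'" using b T x y by simp
    moreover have "j \<in> {1..\<mu> h i}" "j' \<in> {1..\<mu> h i}" "(i, h) \<in> Rows"
      using row[of i j h] row[of i j' h] b x y ih by auto
    ultimately have "j = j'"
      using inj_onD[OF bij_betw_imp_inj_on[OF g, of "(i, h)"], of j j'] by simp
    then show "b = b'" using x y ih by simp
  qed
  moreover have "T ` B = S"
  proof
    show "T ` B \<subseteq> S" using Tf by fastforce
    show "S \<subseteq> T ` B"
    proof
      fix x assume x: "x \<in> S"
      then have r: "f x \<in> Rows" using f by blast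
      obtain i h where ih: "f x = (i, h)" by (cases "f x")
      have "x \<in> g (i, h) ` {1..\<mu> h i}"
        using bij_betw_imp_surj_on[OF g[OF r]] x ih by simp
      then obtain j where j: "j \<in> {1..\<mu> h i}" "x = g (i, h) j" by blast
      then have "(i, j, h) \<in> B" using r ih by (auto simp: Rows_def boxes_def)
      then show "x \<in> T ` B" using T j by (intro image_eqI[where x = "(i, j, h)"]) auto
    qed
  qed
  ultimately have num: "T \<in> Num" by (simp add: numberings_def bij_betw_def T_def)
  moreover have "row_fun T = f"
    using f Tf by (intro row_fun_eqI[OF num]) (auto simp: PiE_def)
  ultimately show ?thesis by (rule that)
qed

lemma card_fixed_tabloids:
  assumes \<sigma>: "\<sigma> permutes S" and ct: "has_cycle_type (\<Sum>h=1..n. m h) \<sigma> \<rho>"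
    and \<gamma>: "\<And>h. h \<in> {1..n} \<Longrightarrow> \<gamma> h = l h div gcd (l h) J"
  shows "card {X \<in> tabloids n m \<mu>. tabloid_act n \<mu> \<sigma> ((shift ^^ J) X) = X} = card (marked_tabloids n \<rho> \<gamma> \<mu>)"
proof -
  define K where "K = {k. 1 \<le> k \<and> \<rho> k \<noteq> 0}"
  \<comment> \<open>The shift by \<open>J\<close> splits a block of \<open>l h\<close> rows into
    \<open>d h\<close> orbits, the residue classes modulo \<open>d h\<close>; one shift advances
    \<open>e h\<close> places inside an orbit.\<close>
  define d where "d h = gcd (l h) J" for h
  define e where "e h = J div d h" for h
  define \<tau> where "\<tau> = inv_into UNIV \<sigma>"
  have part: "is_partition (\<Sum>h=1..n. m h) \<rho>" using ct by (simp add: has_cycle_type_def)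
  have fin_K: "finite K" using part by (simp add: is_partition_def K_def)
  have d: "0 < d h" "l h = d h * \<gamma> h" "d h dvd J" "0 < \<gamma> h" if "h \<in> {1..n}" for h
  proof -
    show "0 < d h" using l_pos[OF that] by (simp add: d_def)
    show ld: "l h = d h * \<gamma> h" using \<gamma>[OF that] by (simp add: d_def)
    show "d h dvd J" by (simp add: d_def)
    show "0 < \<gamma> h" using ld l_pos[OF that] by (cases "\<gamma> h") auto
  qed
  have \<tau>: "\<tau> permutes S" using permutes_inv[OF \<sigma>] by (simp add: \<tau>_def)
  have perm: "permutation \<sigma>" using \<sigma> by (auto simp: permutation_permutes)
  have "image_mset card (mset_set (orbit \<sigma> ` S)) = image_mset \<rho> (mset_set K)"
    using ct by (simp add: has_cycle_type_def cycle_type_def K_def)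
  then obtain \<kappa> where \<kappa>: "bij_betw \<kappa> K (orbit \<sigma> ` S)" "\<forall>k\<in>K. card (\<kappa> k) = \<rho> k"
    using image_mset_eq_imp_bij[of K "orbit \<sigma> ` S" card \<rho>] fin_K by auto
  \<comment> \<open>Fixed tabloids involve the inverse of \<sigma>, which has the same orbits, so
    the cycles named for \<sigma> can be used.\<close>
  have "orbit \<tau> = orbit \<sigma>" using orbit_inv_eq[OF perm] by (simp add: \<tau>_def fun_eq_iff)
  then obtain z where z: "bij_betw (\<lambda>(k, t). (\<tau> ^^ t) (z k)) (SIGMA k:K. {..<\<rho> k}) S"
    "\<And>k. k \<in> K \<Longrightarrow> (\<tau> ^^ \<rho> k) (z k) = z k"
    using cycle_representatives[of \<tau> S \<kappa> K \<rho>] \<tau> \<kappa> by auto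
  interpret D: equivariant_rows n \<mu> \<gamma> \<rho> K S \<tau> z e
  proof
    show "1 \<le> n" by (rule n_pos)
    show "0 < \<gamma> h" if "h \<in> {1..n}" for h using d(4)[OF that] .
    show "\<mu> h i' \<le> \<mu> h i" if "h \<in> {1..n}" "1 \<le> i" "i \<le> i'" for h i i' using \<mu>_mono[OF that] .
    \<comment> \<open>Since \<gamma> h divides \<open>l h\<close>, a group of \<gamma> h consecutive
      rows does not cross the border of a block.\<close>
    show "\<mu> h i = \<mu> h ((i - 1) div \<gamma> h * \<gamma> h + 1)" if h: "h \<in> {1..n}" "1 \<le> i" for h i
    proof (rule \<mu>_block_eq[OF h])
      have "(i - 1) div \<gamma> h * \<gamma> h div (\<gamma> h * d h) = (i - 1) div (\<gamma> h * d h)"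
        using d(4)[OF h(1)] by (simp add: div_mult2_eq)
      then show "(i - 1) div l h = ((i - 1) div \<gamma> h * \<gamma> h + 1 - 1) div l h"
        using d(2)[OF h(1)] by (simp add: mult.commute)
    qed simp
    show "K = {k. 1 \<le> k \<and> \<rho> k \<noteq> 0}" by (rule K_def)
    show "finite K" by (rule fin_K)
    show "finite B" by (rule fin_B)
    show "sum \<rho> K = card B" using part by (simp add: is_partition_def K_def card_B)
    show "finite S" by simp
    show "\<tau> permutes S" by (rule \<tau>)
    show "bij_betw (\<lambda>(k, t). (\<tau> ^^ t) (z k)) (SIGMA k:K. {..<\<rho> k}) S" by (rule z(1))
    show "(\<tau> ^^ \<rho> k) (z k) = z k" if "k \<in> K" for k using z(2)[OF that] .
    show "coprime (e h) (\<gamma> h)" if "h \<in> {1..n}" for h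
      using l_pos[OF that] \<gamma>[OF that] div_gcd_coprime[of "l h" J] by (simp add: e_def d_def coprime_commute)
  qed
  define code where "code = (\<lambda>(i, h). ((fst (block_code (l h) (d h) i), h), snd (block_code (l h) (d h) i)))"
  define decode where "decode = (\<lambda>((p, h), c). (block_decode (l h) (d h) (p, c), h))"
  \<comment> \<open>The p-th group of consecutive rows and the p-th orbit lie in the same block,
    number p div d h, so their rows have equal length even where the rows themselves differ. This
    permits one to stand for the other.\<close>
  have \<mu>_code: "\<mu> h (p * \<gamma> h + 1) = \<mu> h (block_decode (l h) (d h) (p, c))"
    if h: "h \<in> {1..n}" and c: "c < \<gamma> h" for p h c
  proof (rule \<mu>_block_eq[OF h])
    have "p * \<gamma> h div (d h * \<gamma> h) = p div d h" using d(4)[OF h] by simp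
    then show "(p * \<gamma> h + 1 - 1) div l h = (block_decode (l h) (d h) (p, c) - 1) div l h"
      unfolding block_decode_div[OF d(2)[OF h] d(1)[OF h] c] using d(2)[OF h] by simp
  qed (simp_all add: block_decode_def)
  have decode_Rows: "decode r \<in> Rows" and code_decode: "code (decode r) = r" if r: "r \<in> D.row_codes" for r
  proof -
    obtain p h c where x: "r = ((p, h), c)" "h \<in> {1..n}" "0 < \<mu> h (p * \<gamma> h + 1)" "c < \<gamma> h"
      using r by (auto simp: D.row_codes_def)
    show "decode r \<in> Rows"
      using x \<mu>_code[OF x(2,4), of p] by (simp add: decode_def Rows_def) (simp add: block_decode_def)
    show "code (decode r) = r"
      using x block_code_decode[OF d(2)[OF x(2)] d(1)[OF x(2)] x(4), of p] by (simp add: code_def decode_def)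
  qed
  have code_in: "code r \<in> D.row_codes" and decode_code: "decode (code r) = r" if r: "r \<in> Rows" for r
  proof -
    obtain i h where x: "r = (i, h)" "h \<in> {1..n}" "1 \<le> i" "0 < \<mu> h i" using r by (auto simp: Rows_def)
    have dc: "block_decode (l h) (d h) (block_code (l h) (d h) i) = i"
      by (rule block_decode_code[OF d(1)[OF x(2)] x(3)])
    show "decode (code r) = r" using x dc by (simp add: code_def decode_def)
    have c: "snd (block_code (l h) (d h) i) < \<gamma> h"
      by (rule snd_block_code_less[OF d(2)[OF x(2)] l_pos[OF x(2)]])
    show "code r \<in> D.row_codes"
      using x c dc \<mu>_code[OF x(2) c, of "fst (block_code (l h) (d h) i)"]
      by (simp add: code_def D.row_codes_def)
  qed
  have code_row_shift: "code (row_shift J r) = D.rot (code r)" if r: "r \<in> Rows" for r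
  proof -
    obtain i h where x: "r = (i, h)" "h \<in> {1..n}" using r by (auto simp: Rows_def)
    show ?thesis
      using x block_code_shift[OF d(2)[OF x(2)] l_pos[OF x(2)] d(3)[OF x(2)], of i]
      by (simp add: code_def row_shift_def D.rot_def e_def)
  qed
  have row_shift_Rows: "row_shift J r \<in> Rows" if r: "r \<in> Rows" for r
  proof -
    obtain i h where x: "r = (i, h)" "h \<in> {1..n}" "1 \<le> i" "0 < \<mu> h i" using r by (auto simp: Rows_def)
    then have "(i, 1, h) \<in> B" by (simp add: boxes_def)
    from block_shift_box[OF this, of J] show ?thesis using x by (simp add: row_shift_def boxes_def Rows_def)
  qed
  \<comment> \<open>All members of a tabloid have the same row function, so the result does not
    depend on the member picked by \<open>SOME\<close>.\<close>
  define \<Theta> where "\<Theta> X = (\<lambda>x\<in>S. code (row_fun (SOME T. T \<in> X) x))" for X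
  have \<Theta>: "\<Theta> (tab T) = (\<lambda>x\<in>S. code (row_fun T x))" if T: "T \<in> Num" for T
  proof -
    have "T \<in> tab T" using T by (simp add: tab_eq)
    then have "(SOME T'. T' \<in> tab T) \<in> tab T" by (rule someI[of "\<lambda>T'. T' \<in> tab T"])
    then have "row_fun (SOME T'. T' \<in> tab T) = row_fun T" by (simp add: tab_eq[OF T])
    then show ?thesis by (simp add: \<Theta>_def)
  qed
  let ?F = "{X \<in> tabloids n m \<mu>. tabloid_act n \<mu> \<sigma> ((shift ^^ J) X) = X}"
  have "inj_on \<Theta> ?F"
  proof (rule inj_onI)
    fix X X' assume X: "X \<in> ?F" "X' \<in> ?F" and eq: "\<Theta> X = \<Theta> X'"
    obtain T where T: "T \<in> Num" "X = tab T" using X(1) unfolding tabloids_eq by blast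
    obtain T' where T': "T' \<in> Num" "X' = tab T'" using X(2) unfolding tabloids_eq by blast
    have "row_fun T = row_fun T'"
    proof (rule extensionalityI[OF row_fun_ext row_fun_ext])
      fix x assume x: "x \<in> S"
      have "(\<lambda>x\<in>S. code (row_fun T x)) x = (\<lambda>x\<in>S. code (row_fun T' x)) x"
        using eq unfolding T(2) T'(2) \<Theta>[OF T(1)] \<Theta>[OF T'(1)] by (rule fun_cong)
      then have "code (row_fun T x) = code (row_fun T' x)" unfolding restrict_apply'[OF x] .
      then show "row_fun T x = row_fun T' x"
        using decode_code[OF row_fun_Rows[OF T(1) x]] decode_code[OF row_fun_Rows[OF T'(1) x]] by metis
    qed
    then show "X = X'" using tab_eq_iff[OF T(1) T'(1)] T T' by simp
  qed
  moreover have "\<Theta> ` ?F = D.equivariant_maps"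
  proof
    show "\<Theta> ` ?F \<subseteq> D.equivariant_maps"
    proof (rule image_subsetI)
      fix X assume X: "X \<in> ?F"
      then obtain T where T: "T \<in> Num" "X = tab T" unfolding tabloids_eq by blast
      have eqv: "row_fun T (\<tau> x) = row_shift J (row_fun T x)" if "x \<in> S" for x
        using X fixed_tabloid_iff[OF \<sigma> T(1)] that unfolding T(2) \<tau>_def by blast
      let ?f = "\<lambda>x\<in>S. code (row_fun T x)"
      have "?f \<in> D.equivariant_maps"
        unfolding D.equivariant_maps_def
      proof (intro CollectI conjI ballI)
        show "?f \<in> S \<rightarrow>\<^sub>E D.row_codes" using code_in[OF row_fun_Rows[OF T(1)]] by (intro PiE_I) auto
        fix x assume x: "x \<in> S"
        then have "\<tau> x \<in> S" using permutes_in_image[OF \<tau>] by blast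
        then show "?f (\<tau> x) = D.rot (?f x)"
          unfolding restrict_apply'[OF x] restrict_apply'[OF \<open>\<tau> x \<in> S\<close>] eqv[OF x]
          by (intro code_row_shift row_fun_Rows T x)
      next
        fix r assume r: "r \<in> D.row_codes"
        obtain p h c where x: "r = ((p, h), c)" "h \<in> {1..n}" "c < \<gamma> h" using r by (auto simp: D.row_codes_def)
        have iff: "code (row_fun T x) = r \<longleftrightarrow> row_fun T x = decode r" if "x \<in> S" for x
          using decode_code[OF row_fun_Rows[OF T(1) that]] code_decode[OF r] by metis
        have "{x \<in> S. ?f x = r} = {x \<in> S. row_fun T x = decode r}" 
        proof (rule Collect_cong, rule conj_cong[OF refl])
          fix x assume x: "x \<in> S"
          show "?f x = r \<longleftrightarrow> row_fun T x = decode r" unfolding restrict_apply'[OF x] by (rule iff[OF x])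
        qed
        also have "card \<dots> = \<mu> h (block_decode (l h) (d h) (p, c))"
          using x card_row_fun_fibre[OF T(1) x(2), of "block_decode (l h) (d h) (p, c)"]
          by (simp add: decode_def block_decode_def)
        finally show "case r of (a, b) \<Rightarrow> (case a of (p, h) \<Rightarrow> \<lambda>c. card {x \<in> S. ?f x = ((p, h), c)} = \<mu> h (p * \<gamma> h + 1)) b"
          using x \<mu>_code[OF x(2,3), of p] by simp
      qed
      then show "\<Theta> X \<in> D.equivariant_maps" unfolding T(2) \<Theta>[OF T(1)] .
    qed
    show "D.equivariant_maps \<subseteq> \<Theta> ` ?F"
    proof
      fix f assume f: "f \<in> D.equivariant_maps"
      have f_in: "f x \<in> D.row_codes" if "x \<in> S" for x
        using f that unfolding D.equivariant_maps_def by blast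
      let ?f = "\<lambda>x\<in>S. decode (f x)"
      have "?f \<in> S \<rightarrow>\<^sub>E Rows" using decode_Rows[OF f_in] by (intro PiE_I) auto
      moreover have "card {x \<in> S. ?f x = (i, h)} = \<mu> h i" if r: "(i, h) \<in> Rows" for i h
      proof -
        obtain p c where x: "code (i, h) = ((p, h), c)" by (simp add: code_def)
        have mem: "((p, h), c) \<in> D.row_codes" using code_in[OF r] x by simp
        have hc: "h \<in> {1..n}" "c < \<gamma> h" using mem by (auto simp: D.row_codes_def)
        have iff: "decode (f x) = (i, h) \<longleftrightarrow> f x = ((p, h), c)" if "x \<in> S" for x
          using decode_code[OF r] code_decode[OF f_in[OF that]] x by metis
        have "{x \<in> S. ?f x = (i, h)} = {x \<in> S. f x = ((p, h), c)}"
        proof (rule Collect_cong, rule conj_cong[OF refl])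
          fix x assume x: "x \<in> S"
          show "?f x = (i, h) \<longleftrightarrow> f x = ((p, h), c)" unfolding restrict_apply'[OF x] by (rule iff[OF x])
        qed
        also have "card \<dots> = \<mu> h (p * \<gamma> h + 1)" using f mem unfolding D.equivariant_maps_def by fast
        also have "\<dots> = \<mu> h i" using \<mu>_code[OF hc, of p] decode_code[OF r] x by (simp add: decode_def)
        finally show ?thesis .
      qed
      ultimately obtain T where T: "T \<in> Num" "row_fun T = ?f" by (rule row_fun_surj)
      have rfT: "row_fun T x = decode (f x)" if "x \<in> S" for x using T(2) that by simp
      have "\<Theta> (tab T) = f"
      proof (rule extensionalityI[of _ S])
        show "\<Theta> (tab T) \<in> extensional S" by (simp add: \<Theta>_def)
        show "f \<in> extensional S" using f unfolding D.equivariant_maps_def PiE_def by blast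
        fix x assume x: "x \<in> S"
        show "\<Theta> (tab T) x = f x"
          unfolding \<Theta>[OF T(1)] restrict_apply'[OF x] rfT[OF x] by (rule code_decode[OF f_in[OF x]])
      qed
      moreover have "tab T \<in> ?F"
      proof -
        have "row_fun T (\<tau> x) = row_shift J (row_fun T x)" if x: "x \<in> S" for x
        proof -
          have \<tau>x: "\<tau> x \<in> S" using permutes_in_image[OF \<tau>] x by blast
          have "f (\<tau> x) = D.rot (f x)" using f x unfolding D.equivariant_maps_def by blast
          also have "\<dots> = D.rot (code (decode (f x)))" using code_decode[OF f_in[OF x]] by simp
          also have "\<dots> = code (row_shift J (decode (f x)))" using code_row_shift[OF decode_Rows[OF f_in[OF x]]] by simp
          finally have "decode (f (\<tau> x)) = row_shift J (decode (f x))"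
            using decode_code[OF row_shift_Rows[OF decode_Rows[OF f_in[OF x]]]] by simp
          then show ?thesis unfolding rfT[OF x] rfT[OF \<tau>x] .
        qed
        then show ?thesis using fixed_tabloid_iff[OF \<sigma> T(1), of J] T(1) unfolding tabloids_eq \<tau>_def by blast
      qed
      ultimately show "f \<in> \<Theta> ` ?F" by blast
    qed
  qed
  ultimately have "bij_betw \<Theta> ?F D.equivariant_maps" by (rule bij_betw_imageI)
  then have "card ?F = card D.equivariant_maps" by (rule bij_betw_same_card)
  also have "\<dots> = card (marked_tabloids n \<rho> \<gamma> \<mu>)"
    unfolding D.card_equivariant_maps D.card_marked_tabloids ..
  finally show ?thesis .
qed

end

theorem theorem3p1:
  fixes n :: nat and m l \<gamma> \<rho> \<sigma> :: "nat \<Rightarrow> nat" and \<mu> :: "nat \<Rightarrow> nat \<Rightarrow> nat" and j :: int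
  assumes "1 \<le> n"
    and "\<And>h. h \<in> {1..n} \<Longrightarrow> 0 < m h"
    and "\<And>h. h \<in> {1..n} \<Longrightarrow> 0 < l h"
    and "is_multi_partition n l m \<mu>"
    and "\<And>h. h \<in> {1..n} \<Longrightarrow> \<gamma> h = mult_order (zeta (l h) powi j)"
    and "\<sigma> permutes {1..\<Sum>h=1..n. m h}"
    and "has_cycle_type (\<Sum>h=1..n. m h) \<sigma> \<rho>"
  shows "(\<Sum>k<lcm_tuple n l. zeta (lcm_tuple n l) powi (j * int k) * Char_M n m l \<mu> k \<sigma>)
           = of_nat (card (marked_tabloids n \<rho> \<gamma> \<mu>))"
proof -
  interpret multi_diagram n m l \<mu>
    using assms(1,3,4) by (rule multi_diagram.intro)
  define J where "J = nat (j mod int L)"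
  have J: "int J = j mod int L" using L_pos by (simp add: J_def)
  have "\<gamma> h = l h div gcd (l h) J" if h: "h \<in> {1..n}" for h
  proof -
    obtain q where q: "L = l h * q" using l_dvd_L[OF h] by blast
    \<comment> \<open>Only \<open>j\<close> modulo \<open>L\<close> matters, because
      \<open>l h\<close> divides \<open>L\<close>; thus the order \<gamma> h can be expressed
      through the natural number \<open>J\<close>.\<close>
    have "gcd (int (l h)) j = gcd (int (l h)) (j mod int L)"
    proof -
      have "j = j mod int L + int (l h) * (int q * (j div int L))"
        using mod_mult_div_eq[of j "int L"] by (simp add: q mult.assoc)
      then show ?thesis by (metis gcd_add_mult add.commute mult.commute)
    qed
    then have "nat (gcd (int (l h)) j) = gcd (l h) J"
      unfolding J[symmetric] by simp
    then show ?thesis using assms(5)[OF h] mult_order_zeta[OF l_pos[OF h], of j] by simp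
  qed
  then have "card {X \<in> tabloids n m \<mu>. tabloid_act n \<mu> \<sigma> ((shift ^^ J) X) = X} = card (marked_tabloids n \<rho> \<gamma> \<mu>)"
    by (rule card_fixed_tabloids[OF assms(6,7)])
  then show ?thesis using sum_Char_M[OF assms(6) J_def] by simp
qed

end
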